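(* Let $\mathcal{C}$ be a rigid, pseudo-abelian, $\mathbb{Q}$-linear ACU tensor category with unit object $\mathbb{I}$, let $V\in\mathcal{C}$ and let $r:=\mathrm{rank}(V)=\mathrm{ev}_V^{\tau}\circ C_V\in \mathrm{End}(\mathbb{I})$. For all integers $g\ge i\ge 0$ the following identities hold. (1) As morphisms $\vee^iV\otimes\vee^iV^\vee\to\mathbb{I}$, $$\mathrm{ev}_{13,24}\circ(D^{i,g}\otimes D_{i,g})=\binom{g}{g-i}^{-1}\binom{r+g-1}{g-i}\cdot \mathrm{ev}_{V,s}^{i,\tau}.$$ (2) As morphisms $\vee^iV^\vee\otimes\vee^{g-i}V^\vee\to\vee^gV^\vee$, $$\mathrm{ev}_{13}\circ(D_{i,g}\otimes 1_{\vee^{g-i}V^\vee})=(\mathrm{ev}_{V,s}^{i}\otimes 1_{\vee^gV^\vee})\circ(1_{\vee^iV^\vee}\otimes D_{g-i,g}),$$ and, as morphisms $\vee^iV\otimes\vee^{g-i}V\to\vee^gV^{\vee\vee}$, $$\mathrm{ev}_{13}\circ(D^{i,g}\otimes 1_{\vee^{g-i}V})=(\mathrm{ev}_{V,s}^{i,\tau}\otimes 1_{\vee^gV^{\vee\vee}})\circ(1_{\vee^iV}\otimes D^{g-i,g}).$$ (3) As endomorphisms of $\vee^iV$, respectively of $\vee^{g-i}V^\vee$, $$(1_{\vee^iV}\otimes \mathrm{ev}_{V^\vee,s}^{g,\tau})\circ(D_{g-i,g}\otimes 1_{\vee^gV^{\vee\vee}})\circ D^{i,g}=\binom{g}{g-i}^{-1}\binom{r+g-1}{g-i},$$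 $$(1_{\vee^{g-i}V^\vee}\otimes \mathrm{ev}_{V^\vee,s}^{g})\circ(D^{i,g}\otimes 1_{\vee^gV^{\vee}})\circ D_{g-i,g}=\binom{g}{i}^{-1}\binom{r+g-1}{i}.$$ (4) As morphisms $\vee^iV\otimes\vee^{g-i}V\to\vee^gV^{\vee\vee}$, respectively $\vee^iV^\vee\otimes\vee^{g-i}V^\vee\to\vee^gV^{\vee}$, $$\varphi_{g-i,i}^{13\to\vee^gV^{\vee\vee}}\circ(D^{i,g}\otimes D^{g-i,g})=\binom{g}{g-i}^{-1}\binom{r+g-1}{g-i}\cdot i_{\vee^gV}\circ\varphi_{i,g-i},$$ $$\varphi_{g-i,i}^{13\to\vee^gV^{\vee}}\circ(D_{i,g}\otimes D_{g-i,g})=\binom{g}{g-i}^{-1}\binom{r+g-1}{g-i}\cdot\varphi_{i,g-i}.$$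
   Context: ACU tensor category: additive symmetric monoidal category with biadditive $\otimes$ (associativity and unit constraints suppressed, symmetry $\tau_{X,Y}$), with internal homs $\hom(X,Y)$ and evaluations $\mathrm{ev}_{X,Y}:\hom(X,Y)\otimes X\to Y$; $X^\vee=\hom(X,\mathbb{I})$, $\mathrm{ev}_X:X^\vee\otimes X\to\mathbb{I}$. Rigid: the canonical maps $\bigotimes\hom(X_i,Y_i)\to\hom(\bigotimes X_i,\bigotimes Y_i)$ and $i_X:X\to X^{\vee\vee}$ are isomorphisms. Pseudo-abelian: idempotents split. A superscript $\tau$ on an evaluation means precomposition with the symmetry, e.g. $\mathrm{ev}_X^\tau=\mathrm{ev}_X\circ\tau_{X,X^\vee}:X\otimes X^\vee\to\mathbb{I}$. $C_X:\mathbb{I}\to X\otimes X^\vee$ is the coevaluation (Casimir element). $\alpha_{X,Y}:Y\otimes X^\vee\to\hom(X,Y)$ is the canonical isomorphism, corresponding to $1_Y\otimes\mathrm{ev}_X$. Elements of the commutative $\mathbb{Q}$-algebra $\mathrm{End}(\mathbb{I})$ act on every object. $\binom{T}{k}=\frac1{k!}T(T-1)\cdots(T-k+1)\in\mathbb{Q}[T]$ for $k\ge1$, $\binom T0=1$. Symmetric algebra: $\vee^iV$ is the direct factor of $\otimes^iV$ cut out by the symmetrizer $\frac1{i!}\sum_{\sigma\in S_i}\sigma$ ($S_i$ acting through $\tau$), with injection $i_V^i:\vee^iV\to\otimes^iV$ and projection $p_V^i:\otimes^iV\to\vee^iV$. Multiplication: $\varphi_{i,j}=p_V^{i+j}\circ(i_V^i\otimes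 i_V^j):\vee^iV\otimes\vee^jV\to\vee^{i+j}V$; the same notation is used for $V^\vee$ in place of $V$. Duals: $\mathrm{ev}_V^i:(\otimes^iV^\vee)\otimes(\otimes^iV)\to\mathbb{I}$ pairs the $k$-th factor $V^\vee$ with the $k$-th factor $V$ (after reordering by $\tau$), and $\mathrm{ev}_{V,s}^i=\mathrm{ev}_V^i\circ(i_{V^\vee}^i\otimes i_V^i):\vee^iV^\vee\otimes\vee^iV\to\mathbb{I}$. This makes $\vee^iV^\vee:=\vee^i(V^\vee)$ the dual of $\vee^iV$; likewise $\vee^iV^{\vee\vee}:=\vee^i(V^{\vee\vee})$ is the dual of $\vee^iV^\vee$ via $\mathrm{ev}_{V^\vee,s}^i$. The reflexivity isomorphism $i_{\vee^gV}:\vee^gV\to\vee^gV^{\vee\vee}$ is taken with respect to these pairings. Internal multiplications and Poincaré morphisms: for $j\ge i$ let $\iota_{i,j}:\vee^iV\to\hom(\vee^jV^\vee,\vee^{j-i}V^\vee)$ and $\iota^*_{i,j}:\vee^iV^\vee\to\hom(\vee^jV,\vee^{j-i}V)$ correspond by adjunction to $$p_{V^\vee}^{j-i}\circ(\mathrm{ev}_V^{i,\tau}\otimes1_{\otimes^{j-i}V^\vee})\circ(i_V^i\otimes i_{V^\vee}^j),\qquad p_V^{j-i}\circ(\mathrm{ev}_V^i\otimes1_{\otimes^{j-i}V})\circ(i_{V^\vee}^i\otimes i_V^j),$$ where the first $i$ factors of the $j$-fold tensor power are contracted. For $g\ge i$, $$D^{i,g}=\alpha^{-1}\circ\iota_{i,g}:\vee^iV\to\vee^{g-i}V^\vee\otimes\vee^gV^{\vee\vee},\qquad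 D_{i,g}=\alpha^{-1}\circ\iota^*_{i,g}:\vee^iV^\vee\to\vee^{g-i}V\otimes\vee^gV^\vee .$$ $\mathrm{ev}_{13,24}$ denotes the contraction of the 1st with the 3rd and of the 2nd with the 4th tensor factor (after reordering by $\tau$), and $\mathrm{ev}_{13}$ the contraction of the 1st with the 3rd factor leaving the 2nd one. The morphism $\varphi_{g-i,i}^{13\to\vee^gV^{\vee\vee}}:\vee^{g-i}V^\vee\otimes\vee^gV^{\vee\vee}\otimes\vee^iV^\vee\otimes\vee^gV^{\vee\vee}\to\vee^gV^{\vee\vee}$ interchanges the 2nd and 3rd factors, applies $\varphi_{g-i,i}$ to the first two factors obtaining $\vee^gV^\vee\otimes\vee^gV^{\vee\vee}\otimes\vee^gV^{\vee\vee}$, and then applies $\mathrm{ev}_{V^\vee,s}^{g,\tau}\otimes 1$. The morphism $\varphi_{g-i,i}^{13\to\vee^gV^{\vee}}:\vee^{g-i}V\otimes\vee^gV^{\vee}\otimes\vee^iV\otimes\vee^gV^{\vee}\to\vee^gV^{\vee}$ is defined likewise (interchange the 2nd and 3rd factors, multiply the first two to get $\vee^gV\otimes\vee^gV^\vee\otimes\vee^gV^\vee$, apply $\mathrm{ev}_{V,s}^{g,\tau}\otimes1$). *)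

theory Defs
  imports Complex_Main "HOL-Algebra.Module" "HOL-Combinatorics.Permutations"
begin

definition rat_ring :: "rat ring" where
  "rat_ring = \<lparr>carrier = UNIV, monoid.mult = (*), one = 1, zero = 0, add = (+)\<rparr>"

text \<open>
  The objects are all elements of the type \<open>'o\<close>.  The morphisms from \<open>X\<close> to \<open>Y\<close> form a
  \<open>\<rat>\<close>-module \<open>Mor X Y\<close>; the fields \<open>mult\<close> and \<open>one\<close> of that record are not used.
  Associativity and unit constraints are explicit, and no strictness is assumed.
\<close>

record ('o, 'm) tensor_category =
  Mor    :: "'o \<Rightarrow> 'o \<Rightarrow> (rat, 'm) module"
  Ident  :: "'o \<Rightarrow> 'm" ("\<^bold>1\<index>")
  Comp   :: "'m \<Rightarrow> 'm \<Rightarrow> 'm" (infixr "\<cdot>\<index>" 70)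
  Tens   :: "'o \<Rightarrow> 'o \<Rightarrow> 'o" (infixr "\<otimes>\<^sub>o\<index>" 75)
  TensM  :: "'m \<Rightarrow> 'm \<Rightarrow> 'm" (infixr "\<otimes>\<^sub>m\<index>" 75)
  Unit   :: 'o ("\<I>\<index>")
  Assoc  :: "'o \<Rightarrow> 'o \<Rightarrow> 'o \<Rightarrow> 'm" ("\<a>\<index>")
  Lunit  :: "'o \<Rightarrow> 'm" ("\<l>\<index>")
  Runit  :: "'o \<Rightarrow> 'm" ("\<r>\<index>")
  Swap   :: "'o \<Rightarrow> 'o \<Rightarrow> 'm" ("\<tau>\<index>")
  IHom   :: "'o \<Rightarrow> 'o \<Rightarrow> 'o"
  Eval   :: "'o \<Rightarrow> 'o \<Rightarrow> 'm"

abbreviation Hom :: "('o, 'm, 'z) tensor_category_scheme \<Rightarrow> 'o \<Rightarrow> 'o \<Rightarrow> 'm set" where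
  "Hom C X Y \<equiv> carrier (Mor C X Y)"

definition dual :: "('o, 'm, 'z) tensor_category_scheme \<Rightarrow> 'o \<Rightarrow> 'o"
    ("_\<^sup>\<or>\<index>" [1000] 1000) where
  "X\<^sup>\<or>\<^bsub>C\<^esub> = IHom C X \<I>\<^bsub>C\<^esub>"

context
  fixes C :: "('o, 'm, 'z) tensor_category_scheme" (structure)
begin

definition is_inverse :: "'o \<Rightarrow> 'o \<Rightarrow> 'm \<Rightarrow> 'm \<Rightarrow> bool" where
  "is_inverse X Y f g \<longleftrightarrow> f \<in> Hom C X Y \<and> g \<in> Hom C Y X \<and> g \<cdot> f = \<^bold>1 X \<and> f \<cdot> g = \<^bold>1 Y"

definition is_iso :: "'o \<Rightarrow> 'o \<Rightarrow> 'm \<Rightarrow> bool" where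
  "is_iso X Y f \<longleftrightarrow> (\<exists>g. is_inverse X Y f g)"

definition inverse_mor :: "'o \<Rightarrow> 'o \<Rightarrow> 'm \<Rightarrow> 'm" where
  "inverse_mor X Y f = (THE g. is_inverse X Y f g)"

definition assoc_inv :: "'o \<Rightarrow> 'o \<Rightarrow> 'o \<Rightarrow> 'm" where
  "assoc_inv X Y Z = inverse_mor ((X \<otimes>\<^sub>o Y) \<otimes>\<^sub>o Z) (X \<otimes>\<^sub>o (Y \<otimes>\<^sub>o Z)) (\<a> X Y Z)"

definition is_splitting :: "'o \<Rightarrow> 'm \<Rightarrow> 'o \<Rightarrow> 'm \<Rightarrow> 'm \<Rightarrow> bool" where
  "is_splitting A e S i p \<longleftrightarrow>
     i \<in> Hom C S A \<and> p \<in> Hom C A S \<and> p \<cdot> i = \<^bold>1 S \<and> i \<cdot> p = e"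

text \<open>\<open>interchange A B X Y : (A \<otimes> B) \<otimes> (X \<otimes> Y) \<rightarrow> (A \<otimes> X) \<otimes> (B \<otimes> Y)\<close>\<close>

definition interchange :: "'o \<Rightarrow> 'o \<Rightarrow> 'o \<Rightarrow> 'o \<Rightarrow> 'm" where
  "interchange A B X Y =
     assoc_inv A X (B \<otimes>\<^sub>o Y)
     \<cdot> (\<^bold>1 A \<otimes>\<^sub>m (\<a> X B Y \<cdot> (\<tau> B X \<otimes>\<^sub>m \<^bold>1 Y) \<cdot> assoc_inv B X Y))
     \<cdot> \<a> A B (X \<otimes>\<^sub>o Y)"

text \<open>
  Contractions along a pairing \<open>e\<close> with values in the unit object:
  \<open>contr_left e A B R : A \<otimes> (B \<otimes> R) \<rightarrow> R\<close> is \<open>e \<otimes> 1\<close> for \<open>e : A \<otimes> B \<rightarrow> \<I>\<close>,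
  \<open>contr_right e Y A B : (Y \<otimes> A) \<otimes> B \<rightarrow> Y\<close> is \<open>1 \<otimes> e\<close> for \<open>e : A \<otimes> B \<rightarrow> \<I>\<close>,
  \<open>contr13 e A B X : (A \<otimes> B) \<otimes> X \<rightarrow> B\<close> for \<open>e : A \<otimes> X \<rightarrow> \<I>\<close>, and
  \<open>contr13_24 e e' A B X Y : (A \<otimes> B) \<otimes> (X \<otimes> Y) \<rightarrow> \<I>\<close> for \<open>e : A \<otimes> X \<rightarrow> \<I>\<close>,
  \<open>e' : B \<otimes> Y \<rightarrow> \<I>\<close>.
\<close>

definition contr_left :: "'m \<Rightarrow> 'o \<Rightarrow> 'o \<Rightarrow> 'o \<Rightarrow> 'm" where
  "contr_left e A B R = \<l> R \<cdot> (e \<otimes>\<^sub>m \<^bold>1 R) \<cdot> assoc_inv A B R"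

definition contr_right :: "'m \<Rightarrow> 'o \<Rightarrow> 'o \<Rightarrow> 'o \<Rightarrow> 'm" where
  "contr_right e Y A B = \<r> Y \<cdot> (\<^bold>1 Y \<otimes>\<^sub>m e) \<cdot> \<a> Y A B"

definition contr13 :: "'m \<Rightarrow> 'o \<Rightarrow> 'o \<Rightarrow> 'o \<Rightarrow> 'm" where
  "contr13 e A B X = contr_left e A X B \<cdot> (\<^bold>1 A \<otimes>\<^sub>m \<tau> B X) \<cdot> \<a> A B X"

definition contr13_24 :: "'m \<Rightarrow> 'm \<Rightarrow> 'o \<Rightarrow> 'o \<Rightarrow> 'o \<Rightarrow> 'o \<Rightarrow> 'm" where
  "contr13_24 e e' A B X Y = \<l> \<I> \<cdot> (e \<otimes>\<^sub>m e') \<cdot> interchange A B X Y"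

text \<open>\<open>transp Z X Y f : Z \<rightarrow> hom(X, Y)\<close> is the morphism adjoint to \<open>f : Z \<otimes> X \<rightarrow> Y\<close>.\<close>

definition transp :: "'o \<Rightarrow> 'o \<Rightarrow> 'o \<Rightarrow> 'm \<Rightarrow> 'm" where
  "transp Z X Y f =
     (THE h. h \<in> Hom C Z (IHom C X Y) \<and> Eval C X Y \<cdot> (h \<otimes>\<^sub>m \<^bold>1 X) = f)"

definition ev :: "'o \<Rightarrow> 'm" where
  "ev X = Eval C X \<I>"

definition refl_mor :: "'o \<Rightarrow> 'm" where
  "refl_mor X = transp X X\<^sup>\<or> \<I> (ev X \<cdot> \<tau> X X\<^sup>\<or>)"

primrec tens_list :: "'o list \<Rightarrow> 'o" where
  "tens_list [] = \<I>"
| "tens_list (X # Xs) = X \<otimes>\<^sub>o tens_list Xs"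

primrec eval_list :: "('o \<times> 'o) list \<Rightarrow> 'm" where
  "eval_list [] = \<l> \<I>"
| "eval_list (P # Ps) =
     (Eval C (fst P) (snd P) \<otimes>\<^sub>m eval_list Ps)
     \<cdot> interchange (IHom C (fst P) (snd P)) (tens_list (map (\<lambda>(X, Y). IHom C X Y) Ps))
         (fst P) (tens_list (map fst Ps))"

text \<open>The canonical morphism \<open>\<Otimes> hom(X\<^sub>i, Y\<^sub>i) \<rightarrow> hom(\<Otimes> X\<^sub>i, \<Otimes> Y\<^sub>i)\<close>\<close>

definition tens_hom_mor :: "('o \<times> 'o) list \<Rightarrow> 'm" where
  "tens_hom_mor Ps =
     transp (tens_list (map (\<lambda>(X, Y). IHom C X Y) Ps))
       (tens_list (map fst Ps)) (tens_list (map snd Ps)) (eval_list Ps)"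

text \<open>
  \<open>\<alpha> : Y \<otimes> D \<rightarrow> hom(X, Y)\<close> for an object \<open>D\<close> that is made a dual of \<open>X\<close> by a pairing
  \<open>e : D \<otimes> X \<rightarrow> \<I>\<close>
\<close>

definition alpha :: "'m \<Rightarrow> 'o \<Rightarrow> 'o \<Rightarrow> 'o \<Rightarrow> 'm" where
  "alpha e D X Y = transp (Y \<otimes>\<^sub>o D) X Y (contr_right e Y D X)"

definition alpha_inv :: "'m \<Rightarrow> 'o \<Rightarrow> 'o \<Rightarrow> 'o \<Rightarrow> 'm" where
  "alpha_inv e D X Y = inverse_mor (Y \<otimes>\<^sub>o D) (IHom C X Y) (alpha e D X Y)"

definition coev :: "'o \<Rightarrow> 'm" where
  "coev X = alpha_inv (ev X) X\<^sup>\<or> X X \<cdot> transp \<I> X X (\<l> X)"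

definition rank :: "'o \<Rightarrow> 'm" where
  "rank X = ev X \<cdot> \<tau> X X\<^sup>\<or> \<cdot> coev X"

text \<open>The action of \<open>c \<in> End(\<I>)\<close> on a morphism \<open>f : X \<rightarrow> Y\<close>\<close>

definition act :: "'o \<Rightarrow> 'o \<Rightarrow> 'm \<Rightarrow> 'm \<Rightarrow> 'm" where
  "act X Y c f = \<l> Y \<cdot> (c \<otimes>\<^sub>m f) \<cdot> inverse_mor (\<I> \<otimes>\<^sub>o X) X (\<l> X)"

primrec falling :: "'m \<Rightarrow> nat \<Rightarrow> 'm" where
  "falling t 0 = \<^bold>1 \<I>"
| "falling t (Suc k) =
     falling t k \<cdot> (t \<oplus>\<^bsub>Mor C \<I> \<I>\<^esub> (- of_nat k) \<odot>\<^bsub>Mor C \<I> \<I>\<^esub> \<^bold>1 \<I>)"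

definition binom :: "'m \<Rightarrow> nat \<Rightarrow> 'm" where
  "binom t k = (1 / fact k) \<odot>\<^bsub>Mor C \<I> \<I>\<^esub> falling t k"

text \<open>The element \<open>(g choose k)\<^sup>-\<^sup>1 (r + g - 1 choose k)\<close> of \<open>End(\<I>)\<close>, where \<open>r = rank V\<close>\<close>

definition coeff :: "'o \<Rightarrow> nat \<Rightarrow> nat \<Rightarrow> 'm" where
  "coeff V g k = (1 / of_nat (g choose k)) \<odot>\<^bsub>Mor C \<I> \<I>\<^esub>
     binom (rank V \<oplus>\<^bsub>Mor C \<I> \<I>\<^esub> (of_nat g - 1) \<odot>\<^bsub>Mor C \<I> \<I>\<^esub> \<^bold>1 \<I>) k"

primrec tpow :: "nat \<Rightarrow> 'o \<Rightarrow> 'o" where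
  "tpow 0 V = \<I>"
| "tpow (Suc n) V = V \<otimes>\<^sub>o tpow n V"

text \<open>\<open>join V m n : \<otimes>\<^sup>mV \<otimes> \<otimes>\<^sup>nV \<rightarrow> \<otimes>\<^sup>m\<^sup>+\<^sup>nV\<close>\<close>

primrec join :: "'o \<Rightarrow> nat \<Rightarrow> nat \<Rightarrow> 'm" where
  "join V 0 n = \<l> (tpow n V)"
| "join V (Suc m) n = (\<^bold>1 V \<otimes>\<^sub>m join V m n) \<cdot> \<a> V (tpow m V) (tpow n V)"

definition cut :: "'o \<Rightarrow> nat \<Rightarrow> nat \<Rightarrow> 'm" where
  "cut V m n = inverse_mor (tpow m V \<otimes>\<^sub>o tpow n V) (tpow (m + n) V) (join V m n)"

text \<open>
  For \<open>k \<le> n\<close>, \<open>to_front V n k\<close> is the automorphism of \<open>\<otimes>\<^sup>n\<^sup>+\<^sup>1V\<close> that moves factor \<open>k\<close>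
  (counting from 0) past the factors \<open>0, \<dots>, k - 1\<close> to the front.
\<close>

fun to_front :: "'o \<Rightarrow> nat \<Rightarrow> nat \<Rightarrow> 'm" where
  "to_front V n 0 = \<^bold>1 (tpow (Suc n) V)"
| "to_front V (Suc n) (Suc k) =
     \<a> V V (tpow n V) \<cdot> (\<tau> V V \<otimes>\<^sub>m \<^bold>1 (tpow n V)) \<cdot> assoc_inv V V (tpow n V)
     \<cdot> (\<^bold>1 V \<otimes>\<^sub>m to_front V n k)"
| "to_front V 0 (Suc k) = \<^bold>1 (tpow (Suc 0) V)"

text \<open>
  The action of a permutation \<open>\<sigma>\<close> of \<open>{..<n}\<close> on \<open>\<otimes>\<^sup>nV\<close>: factor \<open>j\<close> of the target is factor
  \<open>\<sigma> j\<close> of the source.  First factor \<open>\<sigma> 0\<close> is moved to the front; on the remaining factors,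
  renumbered from 0, acts the permutation that \<open>\<sigma>\<close> induces.
\<close>

primrec perm_mor :: "'o \<Rightarrow> nat \<Rightarrow> (nat \<Rightarrow> nat) \<Rightarrow> 'm" where
  "perm_mor V 0 \<sigma> = \<^bold>1 \<I>"
| "perm_mor V (Suc n) \<sigma> =
     (\<^bold>1 V \<otimes>\<^sub>m perm_mor V n (\<lambda>j. if \<sigma> (Suc j) > \<sigma> 0 then \<sigma> (Suc j) - 1 else \<sigma> (Suc j)))
     \<cdot> to_front V n (\<sigma> 0)"

definition symmetrizer :: "'o \<Rightarrow> nat \<Rightarrow> 'm" where
  "symmetrizer V n = (1 / fact n) \<odot>\<^bsub>Mor C (tpow n V) (tpow n V)\<^esub>
     (\<Oplus>\<^bsub>Mor C (tpow n V) (tpow n V)\<^esub> \<sigma> \<in> {\<sigma>. \<sigma> permutes {..<n}}. perm_mor V n \<sigma>)"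

text \<open>\<open>ev\<^sup>n : \<otimes>\<^sup>nV\<^sup>\<or> \<otimes> \<otimes>\<^sup>nV \<rightarrow> \<I>\<close>\<close>

primrec ev_pow :: "nat \<Rightarrow> 'o \<Rightarrow> 'm" where
  "ev_pow 0 V = \<l> \<I>"
| "ev_pow (Suc n) V =
     contr13_24 (ev V) (ev_pow n V) V\<^sup>\<or> (tpow n V\<^sup>\<or>) V (tpow n V)"

end

locale linear_category =
  fixes C :: "('o, 'm, 'z) tensor_category_scheme" (structure)
  assumes Mor_module: "module rat_ring (Mor C X Y)"
    and Ident_closed: "\<^bold>1 X \<in> Hom C X X"
    and Comp_closed: "\<lbrakk>g \<in> Hom C Y Z; f \<in> Hom C X Y\<rbrakk> \<Longrightarrow> g \<cdot> f \<in> Hom C X Z"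
    and Comp_assoc:
      "\<lbrakk>h \<in> Hom C Z W; g \<in> Hom C Y Z; f \<in> Hom C X Y\<rbrakk> \<Longrightarrow> (h \<cdot> g) \<cdot> f = h \<cdot> (g \<cdot> f)"
    and Comp_Ident_left: "f \<in> Hom C X Y \<Longrightarrow> \<^bold>1 Y \<cdot> f = f"
    and Comp_Ident_right: "f \<in> Hom C X Y \<Longrightarrow> f \<cdot> \<^bold>1 X = f"
    and Comp_add_left: "\<lbrakk>g \<in> Hom C Y Z; g' \<in> Hom C Y Z; f \<in> Hom C X Y\<rbrakk>
      \<Longrightarrow> (g \<oplus>\<^bsub>Mor C Y Z\<^esub> g') \<cdot> f = (g \<cdot> f) \<oplus>\<^bsub>Mor C X Z\<^esub> (g' \<cdot> f)"
    and Comp_add_right: "\<lbrakk>g \<in> Hom C Y Z; f \<in> Hom C X Y; f' \<in> Hom C X Y\<rbrakk>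
      \<Longrightarrow> g \<cdot> (f \<oplus>\<^bsub>Mor C X Y\<^esub> f') = (g \<cdot> f) \<oplus>\<^bsub>Mor C X Z\<^esub> (g \<cdot> f')"
    and Comp_smult_left: "\<lbrakk>g \<in> Hom C Y Z; f \<in> Hom C X Y\<rbrakk>
      \<Longrightarrow> (q \<odot>\<^bsub>Mor C Y Z\<^esub> g) \<cdot> f = q \<odot>\<^bsub>Mor C X Z\<^esub> (g \<cdot> f)"
    and Comp_smult_right: "\<lbrakk>g \<in> Hom C Y Z; f \<in> Hom C X Y\<rbrakk>
      \<Longrightarrow> g \<cdot> (q \<odot>\<^bsub>Mor C X Y\<^esub> f) = q \<odot>\<^bsub>Mor C X Z\<^esub> (g \<cdot> f)"

locale additive_category = linear_category +
  assumes zero_object: "\<exists>Z. \<^bold>1 Z = \<zero>\<^bsub>Mor C Z Z\<^esub>"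
    and biproducts: "\<exists>S. \<exists>i \<in> Hom C X S. \<exists>j \<in> Hom C Y S. \<exists>p \<in> Hom C S X. \<exists>q \<in> Hom C S Y.
      p \<cdot> i = \<^bold>1 X \<and> q \<cdot> j = \<^bold>1 Y \<and> p \<cdot> j = \<zero>\<^bsub>Mor C Y X\<^esub> \<and> q \<cdot> i = \<zero>\<^bsub>Mor C X Y\<^esub> \<and>
      (i \<cdot> p) \<oplus>\<^bsub>Mor C S S\<^esub> (j \<cdot> q) = \<^bold>1 S"

locale acu_tensor_category = additive_category +
  assumes TensM_closed:
      "\<lbrakk>f \<in> Hom C X Y; g \<in> Hom C Z W\<rbrakk> \<Longrightarrow> f \<otimes>\<^sub>m g \<in> Hom C (X \<otimes>\<^sub>o Z) (Y \<otimes>\<^sub>o W)"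
    and TensM_Ident: "\<^bold>1 X \<otimes>\<^sub>m \<^bold>1 Y = \<^bold>1 (X \<otimes>\<^sub>o Y)"
    and TensM_Comp:
      "\<lbrakk>g \<in> Hom C Y Z; f \<in> Hom C X Y; g' \<in> Hom C Y' Z'; f' \<in> Hom C X' Y'\<rbrakk>
       \<Longrightarrow> (g \<cdot> f) \<otimes>\<^sub>m (g' \<cdot> f') = (g \<otimes>\<^sub>m g') \<cdot> (f \<otimes>\<^sub>m f')"
    and TensM_add_left: "\<lbrakk>f \<in> Hom C X Y; f' \<in> Hom C X Y; g \<in> Hom C Z W\<rbrakk>
      \<Longrightarrow> (f \<oplus>\<^bsub>Mor C X Y\<^esub> f') \<otimes>\<^sub>m g
        = (f \<otimes>\<^sub>m g) \<oplus>\<^bsub>Mor C (X \<otimes>\<^sub>o Z) (Y \<otimes>\<^sub>o W)\<^esub> (f' \<otimes>\<^sub>m g)"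
    and TensM_add_right: "\<lbrakk>f \<in> Hom C X Y; g \<in> Hom C Z W; g' \<in> Hom C Z W\<rbrakk>
      \<Longrightarrow> f \<otimes>\<^sub>m (g \<oplus>\<^bsub>Mor C Z W\<^esub> g')
        = (f \<otimes>\<^sub>m g) \<oplus>\<^bsub>Mor C (X \<otimes>\<^sub>o Z) (Y \<otimes>\<^sub>o W)\<^esub> (f \<otimes>\<^sub>m g')"
    and TensM_smult_left: "\<lbrakk>f \<in> Hom C X Y; g \<in> Hom C Z W\<rbrakk>
      \<Longrightarrow> (q \<odot>\<^bsub>Mor C X Y\<^esub> f) \<otimes>\<^sub>m g = q \<odot>\<^bsub>Mor C (X \<otimes>\<^sub>o Z) (Y \<otimes>\<^sub>o W)\<^esub> (f \<otimes>\<^sub>m g)"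
    and TensM_smult_right: "\<lbrakk>f \<in> Hom C X Y; g \<in> Hom C Z W\<rbrakk>
      \<Longrightarrow> f \<otimes>\<^sub>m (q \<odot>\<^bsub>Mor C Z W\<^esub> g) = q \<odot>\<^bsub>Mor C (X \<otimes>\<^sub>o Z) (Y \<otimes>\<^sub>o W)\<^esub> (f \<otimes>\<^sub>m g)"
    and Assoc_iso: "is_iso C ((X \<otimes>\<^sub>o Y) \<otimes>\<^sub>o Z) (X \<otimes>\<^sub>o (Y \<otimes>\<^sub>o Z)) (\<a> X Y Z)"
    and Assoc_natural: "\<lbrakk>f \<in> Hom C X X'; g \<in> Hom C Y Y'; h \<in> Hom C Z Z'\<rbrakk>
      \<Longrightarrow> \<a> X' Y' Z' \<cdot> ((f \<otimes>\<^sub>m g) \<otimes>\<^sub>m h) = (f \<otimes>\<^sub>m (g \<otimes>\<^sub>m h)) \<cdot> \<a> X Y Z"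
    and Lunit_iso: "is_iso C (\<I> \<otimes>\<^sub>o X) X (\<l> X)"
    and Lunit_natural: "f \<in> Hom C X Y \<Longrightarrow> \<l> Y \<cdot> (\<^bold>1 \<I> \<otimes>\<^sub>m f) = f \<cdot> \<l> X"
    and Runit_iso: "is_iso C (X \<otimes>\<^sub>o \<I>) X (\<r> X)"
    and Runit_natural: "f \<in> Hom C X Y \<Longrightarrow> \<r> Y \<cdot> (f \<otimes>\<^sub>m \<^bold>1 \<I>) = f \<cdot> \<r> X"
    and pentagon: "\<a> X Y (Z \<otimes>\<^sub>o W) \<cdot> \<a> (X \<otimes>\<^sub>o Y) Z W
      = (\<^bold>1 X \<otimes>\<^sub>m \<a> Y Z W) \<cdot> \<a> X (Y \<otimes>\<^sub>o Z) W \<cdot> (\<a> X Y Z \<otimes>\<^sub>m \<^bold>1 W)"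
    and triangle: "(\<^bold>1 X \<otimes>\<^sub>m \<l> Y) \<cdot> \<a> X \<I> Y = \<r> X \<otimes>\<^sub>m \<^bold>1 Y"
    and Swap_closed: "\<tau> X Y \<in> Hom C (X \<otimes>\<^sub>o Y) (Y \<otimes>\<^sub>o X)"
    and Swap_natural: "\<lbrakk>f \<in> Hom C X X'; g \<in> Hom C Y Y'\<rbrakk>
      \<Longrightarrow> \<tau> X' Y' \<cdot> (f \<otimes>\<^sub>m g) = (g \<otimes>\<^sub>m f) \<cdot> \<tau> X Y"
    and Swap_Swap: "\<tau> Y X \<cdot> \<tau> X Y = \<^bold>1 (X \<otimes>\<^sub>o Y)"
    and hexagon: "\<a> Y Z X \<cdot> \<tau> X (Y \<otimes>\<^sub>o Z) \<cdot> \<a> X Y Z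
      = (\<^bold>1 Y \<otimes>\<^sub>m \<tau> X Z) \<cdot> \<a> Y X Z \<cdot> (\<tau> X Y \<otimes>\<^sub>m \<^bold>1 Z)"
    and Eval_closed: "Eval C X Y \<in> Hom C (IHom C X Y \<otimes>\<^sub>o X) Y"
    and Eval_universal: "f \<in> Hom C (Z \<otimes>\<^sub>o X) Y
      \<Longrightarrow> \<exists>!h. h \<in> Hom C Z (IHom C X Y) \<and> Eval C X Y \<cdot> (h \<otimes>\<^sub>m \<^bold>1 X) = f"

locale rigid_tensor_category = acu_tensor_category +
  assumes tens_hom_mor_iso: "is_iso C (tens_list C (map (\<lambda>(X, Y). IHom C X Y) Ps))
      (IHom C (tens_list C (map fst Ps)) (tens_list C (map snd Ps))) (tens_hom_mor C Ps)"
    and refl_mor_iso: "is_iso C X X\<^sup>\<or>\<^sup>\<or> (refl_mor C X)"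

locale pseudo_abelian_rigid_tensor_category = rigid_tensor_category +
  assumes idempotents_split:
    "\<lbrakk>e \<in> Hom C X X; e \<cdot> e = e\<rbrakk> \<Longrightarrow> \<exists>S i p. is_splitting C X e S i p"

text \<open>
  The symmetric powers are determined only up to isomorphism.  We fix an arbitrary choice of
  splittings of the symmetrizers; it exists because idempotents split.
\<close>

record ('o, 'm) sym_tensor_category = "('o, 'm) tensor_category" +
  Sym     :: "nat \<Rightarrow> 'o \<Rightarrow> 'o"
  Sym_inj :: "nat \<Rightarrow> 'o \<Rightarrow> 'm"
  Sym_prj :: "nat \<Rightarrow> 'o \<Rightarrow> 'm"

locale pseudo_abelian_rigid_tensor_category_with_Sym =
  pseudo_abelian_rigid_tensor_category C
  for C :: "('o, 'm, 'z) sym_tensor_category_scheme" (structure) +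
  assumes Sym_splitting:
    "is_splitting C (tpow C n X) (symmetrizer C X n) (Sym C n X) (Sym_inj C n X) (Sym_prj C n X)"

context
  fixes C :: "('o, 'm, 'z) sym_tensor_category_scheme" (structure)
begin

definition Sym_mult :: "nat \<Rightarrow> nat \<Rightarrow> 'o \<Rightarrow> 'm" where
  "Sym_mult i j V =
     Sym_prj C (i + j) V \<cdot> join C V i j \<cdot> (Sym_inj C i V \<otimes>\<^sub>m Sym_inj C j V)"

text \<open>\<open>ev_Sym i V : \<or>\<^sup>iV\<^sup>\<or> \<otimes> \<or>\<^sup>iV \<rightarrow> \<I>\<close> and \<open>ev_Sym_tau i V : \<or>\<^sup>iV \<otimes> \<or>\<^sup>iV\<^sup>\<or> \<rightarrow> \<I>\<close>\<close>

definition ev_Sym :: "nat \<Rightarrow> 'o \<Rightarrow> 'm" where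
  "ev_Sym i V = ev_pow C i V \<cdot> (Sym_inj C i V\<^sup>\<or> \<otimes>\<^sub>m Sym_inj C i V)"

definition ev_Sym_tau :: "nat \<Rightarrow> 'o \<Rightarrow> 'm" where
  "ev_Sym_tau i V = ev_Sym i V \<cdot> \<tau> (Sym C i V) (Sym C i V\<^sup>\<or>)"

text \<open>
  \<open>\<or>\<^sup>nV \<rightarrow> \<or>\<^sup>nV\<^sup>\<or>\<^sup>\<or>\<close>, the reflexivity morphism after identification of \<open>\<or>\<^sup>nV\<^sup>\<or>\<^sup>\<or>\<close> with the
  dual \<open>hom(\<or>\<^sup>nV\<^sup>\<or>, \<I>)\<close> through the pairing \<open>ev_Sym n (V\<^sup>\<or>)\<close>
\<close>

definition Sym_refl :: "nat \<Rightarrow> 'o \<Rightarrow> 'm" where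
  "Sym_refl n V =
     inverse_mor C (Sym C n V\<^sup>\<or>\<^sup>\<or>) ((Sym C n V\<^sup>\<or>)\<^sup>\<or>)
       (transp C (Sym C n V\<^sup>\<or>\<^sup>\<or>) (Sym C n V\<^sup>\<or>) \<I> (ev_Sym n V\<^sup>\<or>))
     \<cdot> transp C (Sym C n V) (Sym C n V\<^sup>\<or>) \<I> (ev_Sym_tau n V)"

text \<open>
  Internal multiplication \<open>\<or>\<^sup>iV \<rightarrow> hom(\<or>\<^sup>jW, \<or>\<^sup>j\<^sup>-\<^sup>iW)\<close> along a pairing
  \<open>e : \<otimes>\<^sup>iV \<otimes> \<otimes>\<^sup>iW \<rightarrow> \<I>\<close>, for \<open>i \<le> j\<close>
\<close>

definition int_mult :: "'m \<Rightarrow> 'o \<Rightarrow> 'o \<Rightarrow> nat \<Rightarrow> nat \<Rightarrow> 'm" where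
  "int_mult e V W i j =
     transp C (Sym C i V) (Sym C j W) (Sym C (j - i) W)
       (Sym_prj C (j - i) W
        \<cdot> contr_left C e (tpow C i V) (tpow C i W) (tpow C (j - i) W)
        \<cdot> (Sym_inj C i V \<otimes>\<^sub>m (cut C W i (j - i) \<cdot> Sym_inj C j W)))"

definition iota :: "nat \<Rightarrow> nat \<Rightarrow> 'o \<Rightarrow> 'm" where
  "iota i j V =
     int_mult (ev_pow C i V \<cdot> \<tau> (tpow C i V) (tpow C i V\<^sup>\<or>)) V V\<^sup>\<or> i j"

definition iota_star :: "nat \<Rightarrow> nat \<Rightarrow> 'o \<Rightarrow> 'm" where
  "iota_star i j V = int_mult (ev_pow C i V) V\<^sup>\<or> V i j"

text \<open>
  The Poincare morphisms \<open>D\<^sup>i\<^sup>,\<^sup>g : \<or>\<^sup>iV \<rightarrow> \<or>\<^sup>g\<^sup>-\<^sup>iV\<^sup>\<or> \<otimes> \<or>\<^sup>gV\<^sup>\<or>\<^sup>\<or>\<close> and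
  \<open>D\<^sub>i\<^sub>,\<^sub>g : \<or>\<^sup>iV\<^sup>\<or> \<rightarrow> \<or>\<^sup>g\<^sup>-\<^sup>iV \<otimes> \<or>\<^sup>gV\<^sup>\<or>\<close>
\<close>

definition D_up :: "nat \<Rightarrow> nat \<Rightarrow> 'o \<Rightarrow> 'm" where
  "D_up i g V =
     alpha_inv C (ev_Sym g V\<^sup>\<or>) (Sym C g V\<^sup>\<or>\<^sup>\<or>) (Sym C g V\<^sup>\<or>)
       (Sym C (g - i) V\<^sup>\<or>)
     \<cdot> iota i g V"

definition D_down :: "nat \<Rightarrow> nat \<Rightarrow> 'o \<Rightarrow> 'm" where
  "D_down i g V =
     alpha_inv C (ev_Sym g V) (Sym C g V\<^sup>\<or>) (Sym C g V) (Sym C (g - i) V)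
     \<cdot> iota_star i g V"

text \<open>
  For \<open>W = V\<^sup>\<or>\<close>, respectively \<open>W = V\<close>, with \<open>a = g - i\<close> and \<open>b = i\<close>, this is the morphism
  \<open>\<phi>\<close> with superscript \<open>13 \<rightarrow> \<or>\<^sup>gV\<^sup>\<or>\<^sup>\<or>\<close>, respectively \<open>13 \<rightarrow> \<or>\<^sup>gV\<^sup>\<or>\<close>:
  \<open>(\<or>\<^sup>aW \<otimes> \<or>\<^sup>gW\<^sup>\<or>) \<otimes> (\<or>\<^sup>bW \<otimes> \<or>\<^sup>gW\<^sup>\<or>) \<rightarrow> \<or>\<^sup>gW\<^sup>\<or>\<close>, where \<open>g = a + b\<close>.
\<close>

definition phi13 :: "nat \<Rightarrow> nat \<Rightarrow> 'o \<Rightarrow> 'm" where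
  "phi13 a b W =
     contr_left C (ev_Sym_tau (a + b) W)
       (Sym C (a + b) W) (Sym C (a + b) W\<^sup>\<or>) (Sym C (a + b) W\<^sup>\<or>)
     \<cdot> (Sym_mult a b W
         \<otimes>\<^sub>m \<^bold>1 (Sym C (a + b) W\<^sup>\<or> \<otimes>\<^sub>o Sym C (a + b) W\<^sup>\<or>))
     \<cdot> interchange C (Sym C a W) (Sym C (a + b) W\<^sup>\<or>)
         (Sym C b W) (Sym C (a + b) W\<^sup>\<or>)"

end

end

theory Submission
  imports Defs
begin

text \<open>
  Identities between composites of structural isomorphisms are checked on elements. Fix a list
  \<open>L\<close> of objects. An element of \<open>X\<close> in the context \<open>S\<close>, a set of positions in \<open>L\<close>, is a morphism to \<open>X\<close>
  from the tensor product of the \<open>L ! k\<close> with \<open>k \<in> S\<close>. For disjoint contexts elements can be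
  tensored, and since the unshuffles are coassociative and cocommutative, the structural
  isomorphisms act on pure tensors as they do in linear algebra. Only the coevaluations are not pure
  tensors; they enter through the zigzag identities.

  For the pairings between the symmetric powers of \<open>V\<close> and of its dual, internal multiplication by \<open>y\<close>
  is adjoint to multiplication by \<open>y\<close>. All identities thus come down to the trace of
  \<open>z \<mapsto> x (y \<rfloor> z)\<close> on \<open>\<or>\<^sup>gV\<close>, which is the pairing of \<open>y\<close> with the image of \<open>x\<close> under the partial trace
  of the symmetrizer \<open>e\<^sub>g\<close> over \<open>g - i\<close> factors. Let \<open>b\<^sub>n\<close> be the average over \<open>k \<le> n\<close> of the moves of
  factor \<open>k\<close> to the front. Then \<open>e\<^sub>n\<^sub>+\<^sub>1 = (1 \<otimes> e\<^sub>n) b\<^sub>n\<close>. Closing the first strand turns the move of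
  factor \<open>k \<ge> 1\<close> into a permutation of \<open>n\<close> factors, which \<open>e\<^sub>n\<close> absorbs, and the move of factor 0
  into the rank \<open>r\<close>; so the partial trace of \<open>e\<^sub>n\<^sub>+\<^sub>1\<close> over one factor is \<open>(r + n) / (n + 1)\<close> times \<open>e\<^sub>n\<close>.
\<close>

text \<open>The constraints are explicit, so even a zigzag for a tensor product of dual pairs is an
  equation between long composites of them. Elements restore diagrammatic reasoning: a tensor
  category has no diagonals, each variable may be used only once, and disjointness of contexts says
  just that. A coevaluation occurs as a closed subterm in the empty context, which no rule for pure
  tensors can open.

  The recursion for \<open>perm_mor\<close> does not show that permutations compose. The invariance
  of the symmetrizer is therefore derived from its own recursion by the braid relation, and only on
  one side; the other side follows by transposition from the dual object.

  Rigidity speaks of internal homs. It yields a coevaluation as the preimage of an identity, and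
  from then on dual pairs replace internal homs, also for symmetric powers. The trace over the
  symmetric power of degree g has to be split into g - i strands that form a loop and i strands that
  carry the arguments. Its coevaluation is thus taken from a product of two tensor powers, not from
  the single power of degree g.\<close>

section \<open>Coherence\<close>

text \<open>A morphism together with its source and target, so that the simplifier decides composability.
  The constants in capital letters below are arrows of this kind; many of them carry a constant of
  the definitions, such as \<open>ASS\<close> for \<open>\<a>\<close>.\<close>

datatype ('o, 'm) arrow = Arrow (src: 'o) (mor: 'm) (trg: 'o)

context linear_category
begin

definition ar :: "('o, 'm) arrow \<Rightarrow> bool" where
  "ar f \<longleftrightarrow> mor f \<in> Hom C (src f) (trg f)"

definition cmp :: "('o, 'm) arrow \<Rightarrow> ('o, 'm) arrow \<Rightarrow> ('o, 'm) arrow" (infixr "\<bullet>" 70) where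
  "g \<bullet> f = Arrow (src f) (mor g \<cdot> mor f) (trg g)"

definition ID :: "'o \<Rightarrow> ('o, 'm) arrow" where
  "ID X = Arrow X (\<^bold>1 X) X"

lemma ar_Arrow [simp]: "ar (Arrow X f Y) \<longleftrightarrow> f \<in> Hom C X Y"
  by (simp add: ar_def)

lemma cmp_simps [simp]: "src (g \<bullet> f) = src f" "trg (g \<bullet> f) = trg g" "mor (g \<bullet> f) = mor g \<cdot> mor f"
  by (simp_all add: cmp_def)

lemma ID_simps [simp]: "src (ID X) = X" "trg (ID X) = X" "mor (ID X) = \<^bold>1 X" "ar (ID X)"
  by (simp_all add: ID_def Ident_closed)

lemma ar_cmp [simp]: "\<lbrakk>ar f; ar g; trg f = src g\<rbrakk> \<Longrightarrow> ar (g \<bullet> f)"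
  by (auto simp: ar_def intro: Comp_closed)

lemma cmp_assoc: "\<lbrakk>ar f; ar g; ar h; trg f = src g; trg g = src h\<rbrakk> \<Longrightarrow> (h \<bullet> g) \<bullet> f = h \<bullet> g \<bullet> f"
  by (auto simp: ar_def cmp_def intro: Comp_assoc)

lemma cmp_ID [simp]:
  "\<lbrakk>ar f; trg f = X\<rbrakk> \<Longrightarrow> ID X \<bullet> f = f" "\<lbrakk>ar f; src f = X\<rbrakk> \<Longrightarrow> f \<bullet> ID X = f"
  by (cases f; auto simp: ar_def cmp_def ID_def Comp_Ident_left Comp_Ident_right)+

lemma cmp_extend:
  assumes "g \<bullet> f = h" "ar g" "ar f" "ar k" "trg k = src f" "trg f = src g"
  shows "g \<bullet> f \<bullet> k = h \<bullet> k"
  using assms by (metis cmp_assoc)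

definition inverses :: "('o, 'm) arrow \<Rightarrow> ('o, 'm) arrow \<Rightarrow> bool" where
  "inverses f g \<longleftrightarrow> ar f \<and> ar g \<and> src g = trg f \<and> trg g = src f \<and>
     g \<bullet> f = ID (src f) \<and> f \<bullet> g = ID (trg f)"

lemma inverse_unique:
  assumes "is_inverse C X Y f g" "is_inverse C X Y f h" shows "g = h"
proof -
  have "g = (h \<cdot> f) \<cdot> g" using assms Comp_Ident_left [of g Y X] by (simp add: is_inverse_def)
  also have "\<dots> = h \<cdot> (f \<cdot> g)"
    by (rule Comp_assoc) (use assms in \<open>auto simp: is_inverse_def\<close>)
  also have "\<dots> = h" using assms Comp_Ident_right [of h Y X] by (simp add: is_inverse_def)
  finally show ?thesis .
qed

lemma inverse_mor_eq: "is_inverse C X Y f g \<Longrightarrow> inverse_mor C X Y f = g"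
  unfolding inverse_mor_def by (rule the_equality) (auto intro: inverse_unique)

lemma is_inverse_inverse_mor: "is_iso C X Y f \<Longrightarrow> is_inverse C X Y f (inverse_mor C X Y f)"
  by (metis is_iso_def inverse_mor_eq)

lemma inverses_Arrow: "inverses (Arrow X f Y) (Arrow Y g X) \<longleftrightarrow> is_inverse C X Y f g"
  by (auto simp: inverses_def is_inverse_def ID_def cmp_def)

lemma inverses_inverse_mor:
  "is_iso C X Y f \<Longrightarrow> inverses (Arrow X f Y) (Arrow Y (inverse_mor C X Y f) X)"
  by (simp add: inverses_Arrow is_inverse_inverse_mor)

lemma inverse_mor_Arrow: "inverses (Arrow X f Y) g \<Longrightarrow> inverse_mor C X Y f = mor g"
  by (cases g) (metis arrow.sel inverse_mor_eq inverses_Arrow inverses_def)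

lemma inverses_sym: "inverses f g \<Longrightarrow> inverses g f"
  by (auto simp: inverses_def)

lemma inverses_cmp:
  assumes "inverses f f'" "inverses g g'" "trg f = src g"
  shows "inverses (g \<bullet> f) (f' \<bullet> g')"
proof -
  have *: "f' \<bullet> g' \<bullet> g \<bullet> f = f' \<bullet> f" "g \<bullet> f \<bullet> f' \<bullet> g' = g \<bullet> g'"
    using assms by (simp_all add: inverses_def cmp_extend [of g' g "ID (src g)" f] cmp_extend [of f
        f' "ID (src g)" g'])
  show ?thesis using assms * by (simp add: inverses_def cmp_assoc)
qed

text \<open>Generic elements and unshuffles will be cancelled on the right. A section suffices for
  that and, unlike the property of being epi, it is inherited by tensor products.\<close>

definition split_epi :: "('o, 'm) arrow \<Rightarrow> bool" where
  "split_epi f \<longleftrightarrow> ar f \<and> (\<exists>g. ar g \<and> src g = trg f \<and> trg g = src f \<and> f \<bullet> g = ID (trg f))"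

lemma split_epi_cancel:
  assumes "g \<bullet> f = h \<bullet> f" "split_epi f" "ar g" "ar h" "src g = trg f" "src h = trg f"
  shows "g = h"
proof -
  obtain k where k: "ar k" "src k = trg f" "trg k = src f" "f \<bullet> k = ID (trg f)" "ar f"
    using assms(2) by (auto simp: split_epi_def)
  have "g = g \<bullet> f \<bullet> k" using assms k by simp
  also have "\<dots> = h \<bullet> f \<bullet> k" using assms k by (metis cmp_assoc)
  also have "\<dots> = h" using assms k by simp
  finally show ?thesis .
qed

lemma inverses_split_epi: "inverses f g \<Longrightarrow> split_epi f"
  by (auto simp: inverses_def split_epi_def)

lemma split_epi_cmp:
  assumes "split_epi f" "split_epi g" "trg f = src g"
  shows "split_epi (g \<bullet> f)"
proof -
  obtain k where k: "ar k" "src k = trg f" "trg k = src f" "f \<bullet> k = ID (trg f)" "ar f"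
    using assms by (auto simp: split_epi_def)
  obtain l where l: "ar l" "src l = trg g" "trg l = src g" "g \<bullet> l = ID (trg g)" "ar g"
    using assms by (auto simp: split_epi_def)
  have "(g \<bullet> f) \<bullet> k \<bullet> l = ID (trg g)"
    using k l assms cmp_extend [of f k "ID (src g)" l] by (simp add: cmp_assoc)
  then show ?thesis unfolding split_epi_def using k l assms
    by (intro conjI exI [of _ "k \<bullet> l"]) auto
qed

lemma inverses_cancel_left:
  assumes "inverses f g" "f \<bullet> h = f \<bullet> k" "ar h" "ar k" "trg h = src f" "trg k = src f"
  shows "h = k"
proof -
  have "g \<bullet> f \<bullet> h = g \<bullet> f \<bullet> k" using assms by simp
  then show ?thesis using assms(1,3-)
    by (simp add: inverses_def cmp_extend [of g f "ID (src f)"])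
qed

end

section \<open>Unit coherence from pentagon, triangle and hexagon\<close>

context acu_tensor_category
begin

definition tens (infixr "\<boxtimes>" 75) where
  "f \<boxtimes> g = Arrow (src f \<otimes>\<^sub>o src g) (mor f \<otimes>\<^sub>m mor g) (trg f \<otimes>\<^sub>o trg g)"

definition "ASS X Y Z = Arrow ((X \<otimes>\<^sub>o Y) \<otimes>\<^sub>o Z) (\<a> X Y Z) (X \<otimes>\<^sub>o (Y \<otimes>\<^sub>o Z))"
definition "ASSI X Y Z = Arrow (X \<otimes>\<^sub>o (Y \<otimes>\<^sub>o Z)) (assoc_inv C X Y Z) ((X \<otimes>\<^sub>o Y) \<otimes>\<^sub>o Z)"
definition "LU X = Arrow (\<I> \<otimes>\<^sub>o X) (\<l> X) X"
definition "LUI X = Arrow X (inverse_mor C (\<I> \<otimes>\<^sub>o X) X (\<l> X)) (\<I> \<otimes>\<^sub>o X)"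
definition "RU X = Arrow (X \<otimes>\<^sub>o \<I>) (\<r> X) X"
definition "RUI X = Arrow X (inverse_mor C (X \<otimes>\<^sub>o \<I>) X (\<r> X)) (X \<otimes>\<^sub>o \<I>)"
definition "SW X Y = Arrow (X \<otimes>\<^sub>o Y) (\<tau> X Y) (Y \<otimes>\<^sub>o X)"

lemma tens_simps [simp]: "src (f \<boxtimes> g) = src f \<otimes>\<^sub>o src g" "trg (f \<boxtimes> g) = trg f \<otimes>\<^sub>o trg g"
    "mor (f \<boxtimes> g) = mor f \<otimes>\<^sub>m mor g"
  by (simp_all add: tens_def)

lemma ar_tens [simp]: "\<lbrakk>ar f; ar g\<rbrakk> \<Longrightarrow> ar (f \<boxtimes> g)"
  by (auto simp: ar_def intro: TensM_closed)

lemma inverses_ASS: "inverses (ASS X Y Z) (ASSI X Y Z)"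
  unfolding ASS_def ASSI_def assoc_inv_def by (intro inverses_inverse_mor Assoc_iso)

lemma inverses_LU: "inverses (LU X) (LUI X)"
  unfolding LU_def LUI_def by (intro inverses_inverse_mor Lunit_iso)

lemma inverses_RU: "inverses (RU X) (RUI X)"
  unfolding RU_def RUI_def by (intro inverses_inverse_mor Runit_iso)

lemma inverses_SW: "inverses (SW X Y) (SW Y X)"
  by (auto simp: SW_def inverses_Arrow is_inverse_def Swap_closed Swap_Swap)

lemma structure_simps [simp]:
  "src (ASS X Y Z) = (X \<otimes>\<^sub>o Y) \<otimes>\<^sub>o Z" "trg (ASS X Y Z) = X \<otimes>\<^sub>o (Y \<otimes>\<^sub>o Z)"
  "src (ASSI X Y Z) = X \<otimes>\<^sub>o (Y \<otimes>\<^sub>o Z)" "trg (ASSI X Y Z) = (X \<otimes>\<^sub>o Y) \<otimes>\<^sub>o Z"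
  "src (LU X) = \<I> \<otimes>\<^sub>o X" "trg (LU X) = X" "src (LUI X) = X" "trg (LUI X) = \<I> \<otimes>\<^sub>o X"
  "src (RU X) = X \<otimes>\<^sub>o \<I>" "trg (RU X) = X" "src (RUI X) = X" "trg (RUI X) = X \<otimes>\<^sub>o \<I>"
  "src (SW X Y) = X \<otimes>\<^sub>o Y" "trg (SW X Y) = Y \<otimes>\<^sub>o X"
  by (simp_all add: ASS_def ASSI_def LU_def LUI_def RU_def RUI_def SW_def)

lemma ar_structure [simp]:
  "ar (ASS X Y Z)" "ar (ASSI X Y Z)" "ar (LU X)" "ar (LUI X)" "ar (RU X)" "ar (RUI X)" "ar (SW X Y)"
  using inverses_ASS inverses_LU inverses_RU inverses_SW by (auto simp: inverses_def)

lemma structure_inverse [simp]: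
  "ASSI X Y Z \<bullet> ASS X Y Z = ID ((X \<otimes>\<^sub>o Y) \<otimes>\<^sub>o Z)" "ASS X Y Z \<bullet> ASSI X Y Z = ID (X \<otimes>\<^sub>o (Y \<otimes>\<^sub>o Z))"
  "LUI X \<bullet> LU X = ID (\<I> \<otimes>\<^sub>o X)" "LU X \<bullet> LUI X = ID X"
  "RUI X \<bullet> RU X = ID (X \<otimes>\<^sub>o \<I>)" "RU X \<bullet> RUI X = ID X"
  "SW Y X \<bullet> SW X Y = ID (X \<otimes>\<^sub>o Y)"
  using inverses_ASS [of X Y Z] inverses_LU [of X] inverses_RU [of X] inverses_SW [of X Y]
  by (auto simp: inverses_def)

lemma structure_inverse_extend [simp]:
  assumes "ar k"
  shows "trg k = (X \<otimes>\<^sub>o Y) \<otimes>\<^sub>o Z \<Longrightarrow> ASSI X Y Z \<bullet> ASS X Y Z \<bullet> k = k"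
  "trg k = X \<otimes>\<^sub>o (Y \<otimes>\<^sub>o Z) \<Longrightarrow> ASS X Y Z \<bullet> ASSI X Y Z \<bullet> k = k"
  "trg k = \<I> \<otimes>\<^sub>o X \<Longrightarrow> LUI X \<bullet> LU X \<bullet> k = k" "trg k = X \<Longrightarrow> LU X \<bullet> LUI X \<bullet> k = k"
  "trg k = X \<otimes>\<^sub>o \<I> \<Longrightarrow> RUI X \<bullet> RU X \<bullet> k = k" "trg k = X \<Longrightarrow> RU X \<bullet> RUI X \<bullet> k = k"
  "trg k = X \<otimes>\<^sub>o Y \<Longrightarrow> SW Y X \<bullet> SW X Y \<bullet> k = k"
  using assms by (simp_all add: cmp_extend [OF structure_inverse(1)] cmp_extend [OF
      structure_inverse(2)]
    cmp_extend [OF structure_inverse(3)] cmp_extend [OF structure_inverse(4)]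
    cmp_extend [OF structure_inverse(5)] cmp_extend [OF structure_inverse(6)]
    cmp_extend [OF structure_inverse(7)])

lemma tens_ID [simp]: "ID X \<boxtimes> ID Y = ID (X \<otimes>\<^sub>o Y)"
  by (simp add: ID_def tens_def TensM_Ident)

lemma tens_cmp:
  "\<lbrakk>ar f; ar g; ar f'; ar g'; trg f = src g; trg f' = src g'\<rbrakk>
    \<Longrightarrow> (g \<bullet> f) \<boxtimes> (g' \<bullet> f') = (g \<boxtimes> g') \<bullet> (f \<boxtimes> f')"
  by (auto simp: ar_def cmp_def tens_def intro: TensM_Comp)

lemma ASS_natural: "\<lbrakk>ar f; ar g; ar h; trg f = X; trg g = Y; trg h = Z\<rbrakk>
    \<Longrightarrow> ASS X Y Z \<bullet> ((f \<boxtimes> g) \<boxtimes> h) = (f \<boxtimes> g \<boxtimes> h) \<bullet> ASS (src f) (src g) (src h)"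
  by (auto simp: ar_def cmp_def tens_def ASS_def intro: Assoc_natural)

lemma LU_natural: "\<lbrakk>ar f; trg f = X\<rbrakk> \<Longrightarrow> LU X \<bullet> (ID \<I> \<boxtimes> f) = f \<bullet> LU (src f)"
  by (auto simp: ar_def cmp_def tens_def LU_def ID_def intro: Lunit_natural)

lemma RU_natural: "\<lbrakk>ar f; trg f = X\<rbrakk> \<Longrightarrow> RU X \<bullet> (f \<boxtimes> ID \<I>) = f \<bullet> RU (src f)"
  by (auto simp: ar_def cmp_def tens_def RU_def ID_def intro: Runit_natural)

lemma SW_natural: "\<lbrakk>ar f; ar g; trg f = X; trg g = Y\<rbrakk>
    \<Longrightarrow> SW X Y \<bullet> (f \<boxtimes> g) = (g \<boxtimes> f) \<bullet> SW (src f) (src g)"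
  by (auto simp: ar_def cmp_def tens_def SW_def intro: Swap_natural)

lemma ASSI_natural: assumes "ar f" "ar g" "ar h" "trg f = X" "trg g = Y" "trg h = Z"
  shows "ASSI X Y Z \<bullet> (f \<boxtimes> g \<boxtimes> h) = ((f \<boxtimes> g) \<boxtimes> h) \<bullet> ASSI (src f) (src g) (src h)"
proof -
  have "ASSI X Y Z \<bullet> (f \<boxtimes> g \<boxtimes> h)
      = ASSI X Y Z \<bullet> ((f \<boxtimes> g \<boxtimes> h) \<bullet> ASS (src f) (src g) (src h)) \<bullet> ASSI (src f) (src g) (src h)"
    using assms by (simp add: cmp_assoc)
  also have "\<dots> = ((f \<boxtimes> g) \<boxtimes> h) \<bullet> ASSI (src f) (src g) (src h)"
    using assms by (simp add: ASS_natural [symmetric] cmp_assoc)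
  finally show ?thesis .
qed

lemma pentagon_arrow: "ASS X Y (Z \<otimes>\<^sub>o W) \<bullet> ASS (X \<otimes>\<^sub>o Y) Z W
    = (ID X \<boxtimes> ASS Y Z W) \<bullet> ASS X (Y \<otimes>\<^sub>o Z) W \<bullet> (ASS X Y Z \<boxtimes> ID W)"
  by (simp add: cmp_def tens_def ASS_def ID_def pentagon)

lemma triangle_arrow: "(ID X \<boxtimes> LU Y) \<bullet> ASS X \<I> Y = RU X \<boxtimes> ID Y"
  by (simp add: cmp_def tens_def ASS_def ID_def LU_def RU_def triangle)

lemma hexagon_arrow: "ASS Y Z X \<bullet> SW X (Y \<otimes>\<^sub>o Z) \<bullet> ASS X Y Z
    = (ID Y \<boxtimes> SW X Z) \<bullet> ASS Y X Z \<bullet> (SW X Y \<boxtimes> ID Z)"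
  by (simp add: cmp_def tens_def ASS_def ID_def SW_def hexagon)

lemma inverses_ID: "inverses (ID X) (ID X)"
  by (simp add: inverses_def)

lemma inverses_tens:
  assumes "inverses f f'" "inverses g g'" shows "inverses (f \<boxtimes> g) (f' \<boxtimes> g')"
  using assms by (simp add: inverses_def tens_cmp [symmetric])

lemma split_epi_tens:
  assumes "split_epi f" "split_epi g" shows "split_epi (f \<boxtimes> g)"
proof -
  obtain k where k: "ar k" "src k = trg f" "trg k = src f" "f \<bullet> k = ID (trg f)" "ar f"
    using assms by (auto simp: split_epi_def)
  obtain l where l: "ar l" "src l = trg g" "trg l = src g" "g \<bullet> l = ID (trg g)" "ar g"
    using assms by (auto simp: split_epi_def)
  show ?thesis unfolding split_epi_def using k l
    by (intro conjI exI [of _ "k \<boxtimes> l"]) (auto simp: tens_cmp [symmetric])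
qed

text \<open>\<open>LU\<close> is a natural isomorphism from tensoring with the unit to the identity
  functor, so tensoring with the unit is faithful. The unit laws below are proved after tensoring
  with the unit on one side.\<close>

lemma tens_ID_I_cancel:
  assumes "ID \<I> \<boxtimes> f = ID \<I> \<boxtimes> g" "ar f" "ar g" "src f = src g" "trg f = trg g"
  shows "f = g"
proof -
  have "f \<bullet> LU (src f) = g \<bullet> LU (src f)"
    using LU_natural [of f "trg f"] LU_natural [of g "trg f"] assms by simp
  then show ?thesis
    by (rule split_epi_cancel [OF _ inverses_split_epi [OF inverses_LU [of "src f"]]]) (use assms in
        simp_all)
qed

lemma tens_I_cancel:
  assumes "f \<boxtimes> ID \<I> = g \<boxtimes> ID \<I>" "ar f" "ar g" "src f = src g" "trg f = trg g"
  shows "f = g"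
proof -
  have "f \<bullet> RU (src f) = g \<bullet> RU (src f)"
    using RU_natural [of f "trg f"] RU_natural [of g "trg f"] assms by simp
  then show ?thesis
    by (rule split_epi_cancel [OF _ inverses_split_epi [OF inverses_RU [of "src f"]]]) (use assms in
        simp_all)
qed

text \<open>Kelly's argument: tensored with \<open>\<I>\<close> on the left and precomposed with
  associators, both sides reduce by the pentagon to the triangle axiom, which speaks only of a unit
  in the middle.\<close>

lemma LU_tens: "LU (X \<otimes>\<^sub>o Y) \<bullet> ASS \<I> X Y = LU X \<boxtimes> ID Y"
proof -
  let ?k = "ASS \<I> (\<I> \<otimes>\<^sub>o X) Y \<bullet> (ASS \<I> \<I> X \<boxtimes> ID Y)"
  have "(ID \<I> \<boxtimes> (LU (X \<otimes>\<^sub>o Y) \<bullet> ASS \<I> X Y)) \<bullet> ?k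
      = (ID \<I> \<boxtimes> LU (X \<otimes>\<^sub>o Y)) \<bullet> (ID \<I> \<boxtimes> ASS \<I> X Y) \<bullet> ?k"
    using tens_cmp [of "ID \<I>" "ID \<I>" "ASS \<I> X Y" "LU (X \<otimes>\<^sub>o Y)"] by (simp add: cmp_assoc)
  also have "\<dots> = (ID \<I> \<boxtimes> LU (X \<otimes>\<^sub>o Y)) \<bullet> ASS \<I> \<I> (X \<otimes>\<^sub>o Y) \<bullet> ASS (\<I> \<otimes>\<^sub>o \<I>) X Y"
    by (simp add: pentagon_arrow)
  also have "\<dots> = (RU \<I> \<boxtimes> ID X \<boxtimes> ID Y) \<bullet> ASS (\<I> \<otimes>\<^sub>o \<I>) X Y"
    using cmp_extend [OF triangle_arrow, of "\<I>" "X \<otimes>\<^sub>o Y" "ASS (\<I> \<otimes>\<^sub>o \<I>) X Y"] by simp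
  also have "\<dots> = ASS \<I> X Y \<bullet> ((RU \<I> \<boxtimes> ID X) \<boxtimes> ID Y)"
    using ASS_natural [of "RU \<I>" "ID X" "ID Y"] by simp
  also have "\<dots> = ASS \<I> X Y \<bullet> (((ID \<I> \<boxtimes> LU X) \<bullet> ASS \<I> \<I> X) \<boxtimes> ID Y)"
    by (simp add: triangle_arrow)
  also have "\<dots> = ASS \<I> X Y \<bullet> ((ID \<I> \<boxtimes> LU X) \<boxtimes> ID Y) \<bullet> (ASS \<I> \<I> X \<boxtimes> ID Y)"
    using tens_cmp [of "ASS \<I> \<I> X" "ID \<I> \<boxtimes> LU X" "ID Y" "ID Y"] by simp
  also have "\<dots> = (ID \<I> \<boxtimes> LU X \<boxtimes> ID Y) \<bullet> ?k"
    using cmp_extend [OF ASS_natural [of "ID \<I>" "LU X" "ID Y"], of _ X Y "ASS \<I> \<I> X \<boxtimes> ID Y"]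
    by (simp add: cmp_assoc)
  finally have *: "(ID \<I> \<boxtimes> (LU (X \<otimes>\<^sub>o Y) \<bullet> ASS \<I> X Y)) \<bullet> ?k = (ID \<I> \<boxtimes> LU X \<boxtimes> ID Y) \<bullet> ?k" .
  have "split_epi ?k"
    by (intro split_epi_cmp inverses_split_epi [OF inverses_ASS] split_epi_tens
        inverses_split_epi [OF inverses_ID]) simp
  from split_epi_cancel [OF * this] have "ID \<I> \<boxtimes> (LU (X \<otimes>\<^sub>o Y) \<bullet> ASS \<I> X Y) = ID \<I> \<boxtimes> LU X \<boxtimes> ID Y"
      by simp
  then show ?thesis
    by (rule tens_ID_I_cancel) auto
qed

text \<open>Compatibility of the symmetry with the unit constraints is not an axiom. It follows from
  the hexagon for \<open>X\<close> and two units, after a common swap is cancelled.\<close>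

lemma LU_SW: "LU X \<bullet> SW X \<I> = RU X"
proof -
  have "SW X \<I> \<bullet> (RU X \<boxtimes> ID \<I>) = SW X \<I> \<bullet> (ID X \<boxtimes> LU \<I>) \<bullet> ASS X \<I> \<I>"
    by (simp add: triangle_arrow)
  also have "\<dots> = (LU \<I> \<boxtimes> ID X) \<bullet> SW X (\<I> \<otimes>\<^sub>o \<I>) \<bullet> ASS X \<I> \<I>"
    using cmp_extend [OF SW_natural [of "ID X" "LU \<I>"], of X \<I> "ASS X \<I> \<I>"] by (simp add: cmp_assoc)
  also have "\<dots> = LU (\<I> \<otimes>\<^sub>o X) \<bullet> ASS \<I> \<I> X \<bullet> SW X (\<I> \<otimes>\<^sub>o \<I>) \<bullet> ASS X \<I> \<I>"
    using cmp_extend [OF LU_tens, of \<I> X "SW X (\<I> \<otimes>\<^sub>o \<I>) \<bullet> ASS X \<I> \<I>"] by (simp add: cmp_assoc)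
  also have "\<dots> = (LU (\<I> \<otimes>\<^sub>o X) \<bullet> (ID \<I> \<boxtimes> SW X \<I>)) \<bullet> ASS \<I> X \<I> \<bullet> (SW X \<I> \<boxtimes> ID \<I>)"
    by (simp add: hexagon_arrow cmp_assoc)
  also have "\<dots> = SW X \<I> \<bullet> (LU (X \<otimes>\<^sub>o \<I>) \<bullet> ASS \<I> X \<I>) \<bullet> (SW X \<I> \<boxtimes> ID \<I>)"
    by (simp add: LU_natural cmp_assoc)
  also have "\<dots> = SW X \<I> \<bullet> ((LU X \<bullet> SW X \<I>) \<boxtimes> ID \<I>)"
    using tens_cmp [of "SW X \<I>" "LU X" "ID \<I>" "ID \<I>"] by (simp add: LU_tens)
  finally have "SW X \<I> \<bullet> (RU X \<boxtimes> ID \<I>) = SW X \<I> \<bullet> ((LU X \<bullet> SW X \<I>) \<boxtimes> ID \<I>)" .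
  from inverses_cancel_left [OF inverses_SW this] have "RU X \<boxtimes> ID \<I> = (LU X \<bullet> SW X \<I>) \<boxtimes> ID \<I>"
    by simp
  then have "RU X = LU X \<bullet> SW X \<I>" by (rule tens_I_cancel) auto
  then show ?thesis by simp
qed

text \<open>Naturality of \<open>LU\<close> at \<open>LU \<I>\<close> gives \<open>ID \<I>
  \<boxtimes> LU \<I> = LU (\<I> \<otimes>\<^sub>o \<I>)\<close>, so the triangles for a unit in the
  middle and for a unit on the left have a side in common.\<close>

lemma LU_I_eq_RU_I: "LU \<I> = RU \<I>"
proof -
  have "LU \<I> \<bullet> (ID \<I> \<boxtimes> LU \<I>) = LU \<I> \<bullet> LU (\<I> \<otimes>\<^sub>o \<I>)" by (simp add: LU_natural)
  then have "ID \<I> \<boxtimes> LU \<I> = LU (\<I> \<otimes>\<^sub>o \<I>)" by (rule inverses_cancel_left [OF inverses_LU]) auto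
  then have "LU \<I> \<boxtimes> ID \<I> = RU \<I> \<boxtimes> ID \<I>"
    using triangle_arrow [of \<I> \<I>] LU_tens [of \<I> \<I>] by simp
  then show ?thesis by (rule tens_I_cancel) auto
qed

lemma SW_I_I: "SW \<I> \<I> = ID (\<I> \<otimes>\<^sub>o \<I>)"
proof -
  have "LU \<I> \<bullet> SW \<I> \<I> = LU \<I> \<bullet> ID (\<I> \<otimes>\<^sub>o \<I>)" using LU_SW [of \<I>] by (simp add: LU_I_eq_RU_I)
  then show ?thesis by (rule inverses_cancel_left [OF inverses_LU]) auto
qed

text \<open>Contexts are sets of positions, not sublists, so that the union of two contexts carries
  no choice of order. The preimage under \<open>Suc\<close> renumbers the positions for the tail.
  Every such product ends in a unit factor, so that the empty context gives
  \<open>\<I>\<close>.\<close>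

primrec T where
  "T [] S = \<I>"
| "T (X # L) S = (if 0 \<in> S then X \<otimes>\<^sub>o T L (Suc -` S) else T L (Suc -` S))"

definition "cross X A B = ASS A X B \<bullet> (SW X A \<boxtimes> ID B) \<bullet> ASSI X A B"

text \<open>The unshuffle \<open>sp L R S : T L (R \<union> S) \<rightarrow> T L R \<otimes> T L S\<close> is defined for disjoint \<open>R\<close> and \<open>S\<close>.\<close>

primrec sp where
  "sp [] R S = LUI \<I>"
| "sp (X # L) R S =
    (if 0 \<in> R then ASSI X (T L (Suc -` R)) (T L (Suc -` S)) \<bullet> (ID X \<boxtimes> sp L (Suc -` R) (Suc -` S))
     else if 0 \<in> S then cross X (T L (Suc -` R)) (T L (Suc -` S)) \<bullet> (ID X \<boxtimes> sp L (Suc -` R) (Suc -`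
         S))
     else sp L (Suc -` R) (Suc -` S))"

lemma cross_simps [simp]: "ar (cross X A B)" "src (cross X A B) = X \<otimes>\<^sub>o (A \<otimes>\<^sub>o B)"
    "trg (cross X A B) = A \<otimes>\<^sub>o (X \<otimes>\<^sub>o B)"
  by (simp_all add: cross_def)

lemma split_epi_cross: "split_epi (cross X A B)"
  unfolding cross_def
  by (intro split_epi_cmp inverses_split_epi [OF inverses_ASS] split_epi_tens
      inverses_split_epi [OF inverses_ID] inverses_split_epi [OF inverses_SW]
      inverses_split_epi [OF inverses_sym [OF inverses_ASS]]) simp_all

lemma sp_wf: "R \<inter> S = {} \<Longrightarrow>
    ar (sp L R S) \<and> src (sp L R S) = T L (R \<union> S) \<and> trg (sp L R S) = T L R \<otimes>\<^sub>o T L S"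
proof (induction L arbitrary: R S)
  case (Cons X L)
  then have "Suc -` R \<inter> Suc -` S = {}" "0 \<in> R \<Longrightarrow> 0 \<notin> S" by auto
  with Cons.IH [of "Suc -` R" "Suc -` S"] show ?case by (simp add: vimage_Un)
qed simp

lemma sp_simps [simp]:
  assumes "R \<inter> S = {}"
  shows "ar (sp L R S)" "src (sp L R S) = T L (R \<union> S)" "trg (sp L R S) = T L R \<otimes>\<^sub>o T L S"
  using sp_wf [OF assms] by auto

lemma split_epi_sp: "R \<inter> S = {} \<Longrightarrow> split_epi (sp L R S)"
proof (induction L arbitrary: R S)
  case Nil
  then show ?case by (simp add: inverses_split_epi [OF inverses_sym [OF inverses_LU]])
next
  case (Cons X L)
  then have "Suc -` R \<inter> Suc -` S = {}" "0 \<in> R \<Longrightarrow> 0 \<notin> S" by auto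
  with Cons.IH [of "Suc -` R" "Suc -` S"] show ?case
    by (auto intro!: split_epi_cmp split_epi_cross split_epi_tens
      inverses_split_epi [OF inverses_ID] inverses_split_epi [OF inverses_sym [OF inverses_ASS]])
qed

lemma T_empty [simp]: "T L {} = \<I>"
  by (induction L) simp_all

lemma tens_ID_cmp:
  "\<lbrakk>ar f; ar g; trg f = src g\<rbrakk> \<Longrightarrow> (ID X \<boxtimes> g) \<bullet> (ID X \<boxtimes> f) = ID X \<boxtimes> (g \<bullet> f)"
  "\<lbrakk>ar f; ar g; trg f = src g\<rbrakk> \<Longrightarrow> (g \<boxtimes> ID X) \<bullet> (f \<boxtimes> ID X) = (g \<bullet> f) \<boxtimes> ID X"
  by (simp_all add: tens_cmp [symmetric])

lemma hexagon_first:
  "SW A (X \<otimes>\<^sub>o B) \<bullet> ASS A X B \<bullet> (SW X A \<boxtimes> ID B) = ASSI X B A \<bullet> (ID X \<boxtimes> SW A B) \<bullet> ASS X A B"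
proof -
  have "SW A (X \<otimes>\<^sub>o B) \<bullet> ASS A X B \<bullet> (SW X A \<boxtimes> ID B)
      = ASSI X B A \<bullet> (ASS X B A \<bullet> SW A (X \<otimes>\<^sub>o B) \<bullet> ASS A X B) \<bullet> (SW X A \<boxtimes> ID B)"
    by (simp add: cmp_assoc)
  also have "\<dots> = ASSI X B A \<bullet> (ID X \<boxtimes> SW A B) \<bullet> ASS X A B \<bullet> ((SW A X \<bullet> SW X A) \<boxtimes> (ID B \<bullet> ID B))"
    unfolding hexagon_arrow by (subst tens_cmp) (simp_all add: cmp_assoc)
  finally show ?thesis by simp
qed

lemma SW_cross: "SW A (X \<otimes>\<^sub>o B) \<bullet> cross X A B = ASSI X B A \<bullet> (ID X \<boxtimes> SW A B)"
  using cmp_extend [OF hexagon_first, where k = "ASSI X A B"]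
  by (simp add: cross_def cmp_assoc)

lemma SW_ASSI: "SW (X \<otimes>\<^sub>o A) B \<bullet> ASSI X A B = cross X B A \<bullet> (ID X \<boxtimes> SW A B)"
proof -
  have "SW (X \<otimes>\<^sub>o A) B \<bullet> ASSI X A B
      = SW (X \<otimes>\<^sub>o A) B \<bullet> (ASSI X A B \<bullet> (ID X \<boxtimes> SW B A)) \<bullet> (ID X \<boxtimes> SW A B)"
    by (simp add: cmp_assoc tens_ID_cmp)
  also have "\<dots> = cross X B A \<bullet> (ID X \<boxtimes> SW A B)"
    by (simp add: SW_cross [symmetric] cmp_assoc)
  finally show ?thesis .
qed

text \<open>Both forms of the hexagon occur: \<open>SW_ASSI\<close> when the head of the list lies
  in \<open>R\<close>, \<open>SW_cross\<close> when it lies in \<open>S\<close>.\<close>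

lemma SW_sp: "R \<inter> S = {} \<Longrightarrow> SW (T L R) (T L S) \<bullet> sp L R S = sp L S R"
proof (induction L arbitrary: R S)
  case Nil
  then show ?case by (simp add: SW_I_I)
next
  case (Cons X L)
  let ?R = "Suc -` R" and ?S = "Suc -` S"
  have d: "?R \<inter> ?S = {}" "?S \<inter> ?R = {}" "0 \<in> R \<Longrightarrow> 0 \<notin> S" using Cons.prems by auto
  have IH: "(ID X \<boxtimes> SW (T L ?R) (T L ?S)) \<bullet> (ID X \<boxtimes> sp L ?R ?S) = ID X \<boxtimes> sp L ?S ?R"
    using Cons.IH [OF d(1)] d by (simp add: tens_ID_cmp)
  show ?case
    using d IH Cons.IH [OF d(1)] cmp_extend [OF SW_ASSI, of X "T L ?R" "T L ?S" "ID X \<boxtimes> sp L ?R ?S"]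
      cmp_extend [OF SW_cross, of "T L ?R" X "T L ?S" "ID X \<boxtimes> sp L ?R ?S"]
    by (auto simp: cmp_assoc)
qed

lemma LU_cross: "LU (X \<otimes>\<^sub>o B) \<bullet> cross X \<I> B = ID X \<boxtimes> LU B"
proof -
  have "LU (X \<otimes>\<^sub>o B) \<bullet> cross X \<I> B = (LU X \<boxtimes> ID B) \<bullet> (SW X \<I> \<boxtimes> ID B) \<bullet> ASSI X \<I> B"
    unfolding cross_def
    using cmp_extend [OF LU_tens, of X B "(SW X \<I> \<boxtimes> ID B) \<bullet> ASSI X \<I> B"] by simp
  also have "\<dots> = (RU X \<boxtimes> ID B) \<bullet> ASSI X \<I> B"
    using tens_ID_cmp(2) [of "SW X \<I>" "LU X" B]
      cmp_extend [of "LU X \<boxtimes> ID B" "SW X \<I> \<boxtimes> ID B" _ "ASSI X \<I> B"] by (simp add: LU_SW)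
  also have "\<dots> = ID X \<boxtimes> LU B"
    by (simp add: triangle_arrow [symmetric] cmp_assoc)
  finally show ?thesis .
qed

lemma LU_sp: "LU (T L S) \<bullet> sp L {} S = ID (T L S)"
proof (induction L arbitrary: S)
  case (Cons X L)
  let ?S = "Suc -` S"
  show ?case
    using Cons.IH [of ?S] cmp_extend [OF LU_cross, of X "T L ?S" "ID X \<boxtimes> sp L {} ?S"]
    by (auto simp: cmp_assoc tens_ID_cmp)
qed simp

text \<open>Coassociativity of \<open>sp\<close>. The case that the first object belongs to the first of the three
  sets is the pentagon; the symmetry reduces the other two cases to it.\<close>

definition coassoc where
  "coassoc L Q R S \<longleftrightarrow> ASS (T L Q) (T L R) (T L S) \<bullet> (sp L Q R \<boxtimes> ID (T L S)) \<bullet> sp L (Q \<union> R) S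
     = (ID (T L Q) \<boxtimes> sp L R S) \<bullet> sp L Q (R \<union> S)"

text \<open>Reversing three factors turns the left bracketing into the right one. By cocommutativity
  it carries each side of the law for \<open>Q\<close>, \<open>R\<close>, \<open>S\<close> to the
  opposite side of the law for \<open>S\<close>, \<open>R\<close>, \<open>Q\<close>.\<close>

lemma coassoc_reverse:
  assumes c: "coassoc L Q R S" and d: "Q \<inter> R = {}" "Q \<inter> S = {}" "R \<inter> S = {}"
  shows "coassoc L S R Q"
proof -
  let ?A = "T L Q" and ?B = "T L R" and ?C = "T L S"
  have d': "R \<inter> Q = {}" "S \<inter> Q = {}" "S \<inter> R = {}" "(Q \<union> R) \<inter> S = {}" "Q \<inter> (R \<union> S) = {}"
    "S \<inter> (R \<union> Q) = {}" "(S \<union> R) \<inter> Q = {}" "R \<union> Q = Q \<union> R" "S \<union> R = R \<union> S"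
    "(Q \<union> R) \<union> S = Q \<union> (R \<union> S)" "S \<inter> (Q \<union> R) = {}" "(R \<union> S) \<inter> Q = {}" "S \<union> (Q \<union> R) = Q \<union> (R \<union> S)"
    "(R \<union> S) \<union> Q = Q \<union> (R \<union> S)" using d by auto
  note D = d d'
  \<comment> \<open>The two ways of reversing three factors by swaps of blocks agree, by the
    hexagon.\<close>
  have h: "ASS ?C ?B ?A \<bullet> SW ?A (?C \<otimes>\<^sub>o ?B) \<bullet> (ID ?A \<boxtimes> SW ?B ?C) \<bullet> ASS ?A ?B ?C
      = (ID ?C \<boxtimes> SW ?A ?B) \<bullet> SW (?A \<otimes>\<^sub>o ?B) ?C"
  proof -
    have "(ID ?C \<boxtimes> SW ?A ?B) \<bullet> SW (?A \<otimes>\<^sub>o ?B) ?C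
        = (ID ?C \<boxtimes> SW ?A ?B) \<bullet> (SW (?A \<otimes>\<^sub>o ?B) ?C \<bullet> ASSI ?A ?B ?C) \<bullet> ASS ?A ?B ?C"
      by (simp add: cmp_assoc)
    also have "\<dots> = ((ID ?C \<boxtimes> SW ?A ?B) \<bullet> ASS ?C ?A ?B \<bullet> (SW ?A ?C \<boxtimes> ID ?B)) \<bullet> ASSI ?A ?C ?B
         \<bullet> (ID ?A \<boxtimes> SW ?B ?C) \<bullet> ASS ?A ?B ?C"
      unfolding SW_ASSI cross_def by (simp add: cmp_assoc)
    also have "\<dots> = ASS ?C ?B ?A \<bullet> SW ?A (?C \<otimes>\<^sub>o ?B) \<bullet> (ID ?A \<boxtimes> SW ?B ?C) \<bullet> ASS ?A ?B ?C"
      unfolding hexagon_arrow [symmetric] by (simp add: cmp_assoc)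
    finally show ?thesis by simp
  qed
  have "ASS ?C ?B ?A \<bullet> (sp L S R \<boxtimes> ID ?A) \<bullet> sp L (S \<union> R) Q
      = ASS ?C ?B ?A \<bullet> (sp L S R \<boxtimes> ID ?A) \<bullet> SW ?A (T L (R \<union> S)) \<bullet> sp L Q (R \<union> S)"
    using D SW_sp [of Q "R \<union> S" L] by simp
  also have "\<dots> = ASS ?C ?B ?A \<bullet> SW ?A (?C \<otimes>\<^sub>o ?B) \<bullet> (ID ?A \<boxtimes> sp L S R) \<bullet> sp L Q (R \<union> S)"
    using D cmp_extend [OF SW_natural [of "ID ?A" "sp L S R"], of ?A "?C \<otimes>\<^sub>o ?B" "sp L Q (R \<union> S)"]
    by (simp add: cmp_assoc)
  also have "\<dots> = ASS ?C ?B ?A \<bullet> SW ?A (?C \<otimes>\<^sub>o ?B) \<bullet> (ID ?A \<boxtimes> SW ?B ?C) \<bullet>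
      (ID ?A \<boxtimes> sp L R S) \<bullet> sp L Q (R \<union> S)"
    using D SW_sp [of R S L] tens_ID_cmp(1) [of "sp L R S" "SW ?B ?C" ?A]
      cmp_extend [of "ID ?A \<boxtimes> SW ?B ?C" "ID ?A \<boxtimes> sp L R S" _ "sp L Q (R \<union> S)"] by simp
  also have "\<dots> = (ASS ?C ?B ?A \<bullet> SW ?A (?C \<otimes>\<^sub>o ?B) \<bullet> (ID ?A \<boxtimes> SW ?B ?C) \<bullet> ASS ?A ?B ?C) \<bullet>
      (sp L Q R \<boxtimes> ID ?C) \<bullet> sp L (Q \<union> R) S"
    using D c [unfolded coassoc_def, symmetric] by (simp add: cmp_assoc)
  also have "\<dots> = (ID ?C \<boxtimes> SW ?A ?B) \<bullet> (ID ?C \<boxtimes> sp L Q R) \<bullet> SW (T L (Q \<union> R)) ?C \<bullet> sp L (Q \<union> R) S"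
    unfolding h using D cmp_extend [OF SW_natural [of "sp L Q R" "ID ?C"], of "?A \<otimes>\<^sub>o ?B" ?C
        "sp L (Q \<union> R) S"]
    by (simp add: cmp_assoc)
  also have "\<dots> = (ID ?C \<boxtimes> sp L R Q) \<bullet> sp L S (R \<union> Q)"
    using D SW_sp [of Q R L] SW_sp [of "Q \<union> R" S L] tens_ID_cmp(1) [of "sp L Q R" "SW ?A ?B" ?C]
      cmp_extend [of "ID ?C \<boxtimes> SW ?A ?B" "ID ?C \<boxtimes> sp L Q R" _ "sp L S (Q \<union> R)"] by simp
  finally show ?thesis by (simp add: coassoc_def)
qed

text \<open>\<open>R\<close> is moved from the middle to the front, where the law for
  \<open>R\<close>, \<open>Q\<close>, \<open>S\<close> applies, then to the end, where that for
  \<open>Q\<close>, \<open>S\<close>, \<open>R\<close> applies, and back to the middle.\<close>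

lemma coassoc_middle:
  assumes c1: "coassoc L R Q S" and c2: "coassoc L Q S R"
    and d: "Q \<inter> R = {}" "Q \<inter> S = {}" "R \<inter> S = {}"
  shows "coassoc L Q R S"
proof -
  let ?A = "T L Q" and ?B = "T L R" and ?C = "T L S"
  have d': "R \<inter> Q = {}" "S \<inter> Q = {}" "S \<inter> R = {}" "(Q \<union> R) \<inter> S = {}" "Q \<inter> (R \<union> S) = {}"
    "S \<inter> (R \<union> Q) = {}" "(S \<union> R) \<inter> Q = {}" "R \<union> Q = Q \<union> R" "S \<union> R = R \<union> S"
    "(Q \<union> R) \<union> S = Q \<union> (R \<union> S)" "S \<inter> (Q \<union> R) = {}" "(R \<union> S) \<inter> Q = {}" "S \<union> (Q \<union> R) = Q \<union> (R \<union> S)"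
    "(R \<union> S) \<union> Q = Q \<union> (R \<union> S)" "R \<inter> (Q \<union> S) = {}" "(Q \<union> S) \<inter> R = {}" "R \<union> (Q \<union> S) = Q \<union> (R \<union> S)"
    "(Q \<union> S) \<union> R = Q \<union> (R \<union> S)"
    using d by auto
  note D = d d'
  have "ASS ?A ?B ?C \<bullet> (sp L Q R \<boxtimes> ID ?C) \<bullet> sp L (Q \<union> R) S
      = ASS ?A ?B ?C \<bullet> (SW ?B ?A \<boxtimes> ID ?C) \<bullet> (sp L R Q \<boxtimes> ID ?C) \<bullet> sp L (Q \<union> R) S"
    using D SW_sp [of R Q L] tens_ID_cmp(2) [of "sp L R Q" "SW ?B ?A" ?C]
      cmp_extend [of "SW ?B ?A \<boxtimes> ID ?C" "sp L R Q \<boxtimes> ID ?C" _ "sp L (Q \<union> R) S"] by simp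
  also have "\<dots> = ASS ?A ?B ?C \<bullet> (SW ?B ?A \<boxtimes> ID ?C) \<bullet> ASSI ?B ?A ?C \<bullet> (ID ?B \<boxtimes> sp L Q S) \<bullet>
      sp L R (Q \<union> S)"
    using D c1 [unfolded coassoc_def, symmetric] by simp
  also have "\<dots> = cross ?B ?A ?C \<bullet> (ID ?B \<boxtimes> sp L Q S) \<bullet> SW (T L (Q \<union> S)) ?B \<bullet> sp L (Q \<union> S) R"
    using D SW_sp [of "Q \<union> S" R L] by (simp add: cross_def cmp_assoc)
  also have "\<dots> = cross ?B ?A ?C \<bullet> SW (?A \<otimes>\<^sub>o ?C) ?B \<bullet> (sp L Q S \<boxtimes> ID ?B) \<bullet> sp L (Q \<union> S) R"
    using D cmp_extend [OF SW_natural [of "sp L Q S" "ID ?B"], of "?A \<otimes>\<^sub>o ?C" ?B "sp L (Q \<union> S) R"]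
    by (simp add: cmp_assoc)
  also have "\<dots> = (ID ?A \<boxtimes> SW ?C ?B) \<bullet> ASS ?A ?C ?B \<bullet> (sp L Q S \<boxtimes> ID ?B) \<bullet> sp L (Q \<union> S) R"
  proof -
    have "cross ?B ?A ?C \<bullet> SW (?A \<otimes>\<^sub>o ?C) ?B = cross ?B ?A ?C \<bullet> (SW (?A \<otimes>\<^sub>o ?C) ?B \<bullet>
        ASSI ?A ?C ?B) \<bullet> ASS ?A ?C ?B"
      by (simp add: cmp_assoc)
    also have "\<dots> = (ASS ?A ?B ?C \<bullet> (SW ?B ?A \<boxtimes> ID ?C) \<bullet> (SW ?A ?B \<boxtimes> ID ?C) \<bullet> ASSI ?A ?B ?C) \<bullet>
        (ID ?A \<boxtimes> SW ?C ?B) \<bullet> ASS ?A ?C ?B"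
      unfolding SW_ASSI by (simp add: cross_def cmp_assoc)
    also have "\<dots> = (ID ?A \<boxtimes> SW ?C ?B) \<bullet> ASS ?A ?C ?B"
      using cmp_extend [OF tens_ID_cmp(2) [of "SW ?A ?B" "SW ?B ?A" ?C], where k = "ASSI ?A ?B ?C"]
          by simp
    finally have *: "cross ?B ?A ?C \<bullet> SW (?A \<otimes>\<^sub>o ?C) ?B = (ID ?A \<boxtimes> SW ?C ?B) \<bullet> ASS ?A ?C ?B" .
    show ?thesis using D cmp_extend [OF *, of "(sp L Q S \<boxtimes> ID ?B) \<bullet> sp L (Q \<union> S) R"]
        by (simp add: cmp_assoc)
  qed
  also have "\<dots> = (ID ?A \<boxtimes> SW ?C ?B) \<bullet> (ID ?A \<boxtimes> sp L S R) \<bullet> sp L Q (R \<union> S)"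
    using D c2 [unfolded coassoc_def] by simp
  also have "\<dots> = (ID ?A \<boxtimes> sp L R S) \<bullet> sp L Q (R \<union> S)"
    using D SW_sp [of S R L] tens_ID_cmp(1) [of "sp L S R" "SW ?C ?B" ?A]
      cmp_extend [of "ID ?A \<boxtimes> SW ?C ?B" "ID ?A \<boxtimes> sp L S R" _ "sp L Q (R \<union> S)"] by simp
  finally show ?thesis by (simp add: coassoc_def)
qed

lemma coassoc_first:
  assumes "coassoc L (Suc -` Q) (Suc -` R) (Suc -` S)" "0 \<in> Q"
    and d: "Q \<inter> R = {}" "Q \<inter> S = {}" "R \<inter> S = {}"
  shows "coassoc (X # L) Q R S"
proof -
  let ?Q = "Suc -` Q" and ?R = "Suc -` R" and ?S = "Suc -` S"
  let ?A = "T L ?Q" and ?B = "T L ?R" and ?C = "T L ?S"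
  have d': "?Q \<inter> ?R = {}" "?Q \<inter> ?S = {}" "?R \<inter> ?S = {}" "0 \<notin> R" "0 \<notin> S"
    "?Q \<inter> (?R \<union> ?S) = {}" "(?Q \<union> ?R) \<inter> ?S = {}" "(?Q \<union> ?R) \<union> ?S = ?Q \<union> (?R \<union> ?S)" using d assms(2)
        by auto
  have P: "ASS (X \<otimes>\<^sub>o ?A) ?B ?C \<bullet> (ASSI X ?A ?B \<boxtimes> ID ?C) \<bullet> ASSI X (?A \<otimes>\<^sub>o ?B) ?C
      = ASSI X ?A (?B \<otimes>\<^sub>o ?C) \<bullet> (ID X \<boxtimes> ASS ?A ?B ?C)"
  proof -
    let ?k = "(ASSI X ?A ?B \<boxtimes> ID ?C) \<bullet> ASSI X (?A \<otimes>\<^sub>o ?B) ?C"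
    have k: "ASS X (?A \<otimes>\<^sub>o ?B) ?C \<bullet> (ASS X ?A ?B \<boxtimes> ID ?C) \<bullet> ?k = ID (X \<otimes>\<^sub>o ((?A \<otimes>\<^sub>o ?B) \<otimes>\<^sub>o ?C))"
      using cmp_extend [OF tens_ID_cmp(2) [of "ASSI X ?A ?B" "ASS X ?A ?B" ?C], where k =
          "ASSI X (?A \<otimes>\<^sub>o ?B) ?C"]
      by simp
    have "ASS (X \<otimes>\<^sub>o ?A) ?B ?C \<bullet> ?k
        = ASSI X ?A (?B \<otimes>\<^sub>o ?C) \<bullet> (ASS X ?A (?B \<otimes>\<^sub>o ?C) \<bullet> ASS (X \<otimes>\<^sub>o ?A) ?B ?C) \<bullet> ?k"
      by (simp add: cmp_assoc)
    also have "\<dots> = ASSI X ?A (?B \<otimes>\<^sub>o ?C) \<bullet> (ID X \<boxtimes> ASS ?A ?B ?C)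
         \<bullet> (ASS X (?A \<otimes>\<^sub>o ?B) ?C \<bullet> (ASS X ?A ?B \<boxtimes> ID ?C) \<bullet> ?k)"
      unfolding pentagon_arrow by (simp add: cmp_assoc)
    finally show ?thesis unfolding k by simp
  qed
  have "ASS (X \<otimes>\<^sub>o ?A) ?B ?C \<bullet> ((ASSI X ?A ?B \<bullet> (ID X \<boxtimes> sp L ?Q ?R)) \<boxtimes> ID ?C) \<bullet>
        ASSI X (T L (?Q \<union> ?R)) ?C \<bullet> (ID X \<boxtimes> sp L (?Q \<union> ?R) ?S)
      = ASS (X \<otimes>\<^sub>o ?A) ?B ?C \<bullet> (ASSI X ?A ?B \<boxtimes> ID ?C) \<bullet>
        ((ID X \<boxtimes> sp L ?Q ?R) \<boxtimes> ID ?C) \<bullet> ASSI X (T L (?Q \<union> ?R)) ?C \<bullet> (ID X \<boxtimes> sp L (?Q \<union> ?R) ?S)"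
    using d' by (simp add: tens_ID_cmp(2) [symmetric] cmp_assoc)
  also have "\<dots> = (ASS (X \<otimes>\<^sub>o ?A) ?B ?C \<bullet> (ASSI X ?A ?B \<boxtimes> ID ?C) \<bullet> ASSI X (?A \<otimes>\<^sub>o ?B) ?C) \<bullet>
        (ID X \<boxtimes> sp L ?Q ?R \<boxtimes> ID ?C) \<bullet> (ID X \<boxtimes> sp L (?Q \<union> ?R) ?S)"
    using d' cmp_extend [OF ASSI_natural [of "ID X" "sp L ?Q ?R" "ID ?C"], of X "?A \<otimes>\<^sub>o ?B" ?C
        "ID X \<boxtimes> sp L (?Q \<union> ?R) ?S"]
    by (simp add: cmp_assoc)
  also have "\<dots> = ASSI X ?A (?B \<otimes>\<^sub>o ?C) \<bullet>
      (ID X \<boxtimes> (ASS ?A ?B ?C \<bullet> (sp L ?Q ?R \<boxtimes> ID ?C) \<bullet> sp L (?Q \<union> ?R) ?S))"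
    unfolding P using d' by (simp add: tens_ID_cmp(1) [symmetric] cmp_assoc)
  also have "\<dots> = ASSI X ?A (?B \<otimes>\<^sub>o ?C) \<bullet> (ID X \<boxtimes> ID ?A \<boxtimes> sp L ?R ?S) \<bullet> (ID X \<boxtimes> sp L ?Q (?R \<union> ?S))"
    using assms(1) d' by (simp add: coassoc_def tens_ID_cmp(1))
  also have "\<dots> = (ID (X \<otimes>\<^sub>o ?A) \<boxtimes> sp L ?R ?S) \<bullet> ASSI X ?A (T L (?R \<union> ?S)) \<bullet>
      (ID X \<boxtimes> sp L ?Q (?R \<union> ?S))"
    using d' cmp_extend [OF ASSI_natural [of "ID X" "ID ?A" "sp L ?R ?S"], of X ?A "?B \<otimes>\<^sub>o ?C"
        "ID X \<boxtimes> sp L ?Q (?R \<union> ?S)"]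
    by (simp add: cmp_assoc)
  finally show ?thesis using d' assms(2) by (simp add: coassoc_def vimage_Un)
qed

lemma coassoc_sp: "\<lbrakk>Q \<inter> R = {}; Q \<inter> S = {}; R \<inter> S = {}\<rbrakk> \<Longrightarrow> coassoc L Q R S"
proof (induction L arbitrary: Q R S)
  case Nil
  \<comment> \<open>On the empty list the law compares the two splittings of the unit into three;
    they agree because \<open>LU \<I> = RU \<I>\<close>.\<close>
  have "ASS \<I> \<I> \<I> \<bullet> (LUI \<I> \<boxtimes> ID \<I>) \<bullet> LUI \<I> = (ID \<I> \<boxtimes> LUI \<I>) \<bullet> LUI \<I>"
  proof -
    have "(ID \<I> \<boxtimes> LU \<I>) \<bullet> ASS \<I> \<I> \<I> \<bullet> (LUI \<I> \<boxtimes> ID \<I>) \<bullet> LUI \<I>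
        = (RU \<I> \<boxtimes> ID \<I>) \<bullet> (LUI \<I> \<boxtimes> ID \<I>) \<bullet> LUI \<I>"
      using cmp_extend [OF triangle_arrow, of \<I> \<I> "(LUI \<I> \<boxtimes> ID \<I>) \<bullet> LUI \<I>"] by simp
    also have "\<dots> = LUI \<I>"
      using cmp_extend [OF tens_ID_cmp(2) [of "LUI \<I>" "LU \<I>" \<I>], where k = "LUI \<I>"]
          by (simp add: LU_I_eq_RU_I [symmetric])
    also have "\<dots> = (ID \<I> \<boxtimes> LU \<I>) \<bullet> (ID \<I> \<boxtimes> LUI \<I>) \<bullet> LUI \<I>"
      using cmp_extend [OF tens_ID_cmp(1) [of "LUI \<I>" "LU \<I>" \<I>], where k = "LUI \<I>"] by simp
    finally show ?thesis
      by (rule inverses_cancel_left [OF inverses_tens [OF inverses_ID inverses_LU]]) auto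
  qed
  then show ?case by (simp add: coassoc_def)
next
  case (Cons X L)
  let ?Q = "Suc -` Q" and ?R = "Suc -` R" and ?S = "Suc -` S"
  have d: "?Q \<inter> ?R = {}" "?Q \<inter> ?S = {}" "?R \<inter> ?S = {}" "0 \<in> Q \<Longrightarrow> 0 \<notin> R \<and> 0 \<notin> S" "0 \<in> R \<Longrightarrow> 0 \<notin> S"
    and D: "Q \<inter> R = {}" "Q \<inter> S = {}" "R \<inter> S = {}" "R \<inter> Q = {}" "S \<inter> Q = {}" "S \<inter> R = {}"
    using Cons.prems by auto
  have IH: "coassoc L ?Q ?R ?S" "coassoc L ?R ?Q ?S" "coassoc L ?S ?R ?Q" "coassoc L ?S ?Q ?R"
    "coassoc L ?Q ?S ?R" "coassoc L ?R ?S ?Q"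
    using d by (auto intro!: Cons.IH)
  consider "0 \<in> Q" | "0 \<in> S" | "0 \<in> R" | "0 \<notin> Q" "0 \<notin> R" "0 \<notin> S" by blast
  then show ?case
  proof cases
    case 1
    then show ?thesis using coassoc_first IH D by blast
  next
    case 2
    then have "coassoc (X # L) S R Q" using coassoc_first IH D by blast
    then show ?thesis by (rule coassoc_reverse) (use D in auto)
  next
    case 3
    then have "coassoc (X # L) R Q S" "coassoc (X # L) R S Q" using coassoc_first IH D by blast+
    moreover from this(2) have "coassoc (X # L) Q S R" by (rule coassoc_reverse) (use D in auto)
    ultimately show ?thesis using coassoc_middle D by blast
  next
    case 4
    then show ?thesis using IH(1) by (simp add: coassoc_def vimage_Un)
  qed
qed

end

section \<open>Elements\<close>

text \<open>List and context are stored with the arrow because its source does not determine them: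
  for the list \<open>[X, X]\<close> the contexts \<open>{0}\<close> and \<open>{1}\<close> give the
  same object.\<close>

datatype ('o, 'm) elt = Elt (base: "'o list") (ctx: "nat set") (arw: "('o, 'm) arrow")

definition obj :: "('o, 'm) elt \<Rightarrow> 'o" where
  "obj x = trg (arw x)"

definition dj :: "('o, 'm) elt \<Rightarrow> ('o, 'm) elt \<Rightarrow> bool" where
  "dj x y \<longleftrightarrow> base x = base y \<and> ctx x \<inter> ctx y = {}"

lemma dj_sym: "dj x y \<Longrightarrow> dj y x"
  by (auto simp: dj_def)

context acu_tensor_category
begin

definition el where
  "el x \<longleftrightarrow> ar (arw x) \<and> src (arw x) = T (base x) (ctx x)"

definition ap where
  "ap f x = Elt (base x) (ctx x) (f \<bullet> arw x)"

definition pair where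
  "pair x y = Elt (base x) (ctx x \<union> ctx y) ((arw x \<boxtimes> arw y) \<bullet> sp (base x) (ctx x) (ctx y))"

text \<open>The element 1 of the unit object. An arrow \<open>c\<close> out of the unit becomes the
  element \<open>ap c (star L)\<close>, which is disjoint from every element over
  \<open>L\<close>.\<close>

definition star :: "'a list \<Rightarrow> ('a, 'b) elt" where
  "star L = Elt L {} (ID \<I>)"

text \<open>Elements of the unit act as scalars. A contraction leaves such a scalar behind, and the
  rules below collect the scalars in front.\<close>

definition smul where
  "smul s x = ap (LU (obj x)) (pair s x)"

lemma ctx_simps [simp]: "ctx (ap f x) = ctx x" "ctx (pair x y) = ctx x \<union> ctx y" "ctx (star L) = {}"
  "ctx (smul s x) = ctx s \<union> ctx x"
  by (simp_all add: ap_def pair_def star_def smul_def)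

lemma obj_simps [simp]: "obj (ap f x) = trg f" "obj (pair x y) = obj x \<otimes>\<^sub>o obj y" "obj (star L) = \<I>"
  "obj (smul s x) = obj x"
  by (simp_all add: obj_def ap_def pair_def star_def smul_def)

lemma base_simps [simp]: "base (ap f x) = base x" "base (pair x y) = base x" "base (star L) = L"
  "base (smul s x) = base s"
  by (simp_all add: ap_def pair_def star_def smul_def)

lemma dj_simps [simp]: "dj (ap f x) y = dj x y" "dj y (ap f x) = dj y x"
  "\<lbrakk>dj x z; dj y z\<rbrakk> \<Longrightarrow> dj (pair x y) z" "\<lbrakk>dj z x; dj z y\<rbrakk> \<Longrightarrow> dj z (pair x y)"
  "dj (star L) x \<longleftrightarrow> base x = L" "dj x (star L) \<longleftrightarrow> base x = L"
  "\<lbrakk>dj s z; dj y z\<rbrakk> \<Longrightarrow> dj (smul s y) z" "\<lbrakk>dj z s; dj z y\<rbrakk> \<Longrightarrow> dj z (smul s y)"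
  by (auto simp: dj_def)

lemma el_ap [simp]: "\<lbrakk>el x; ar f; src f = obj x\<rbrakk> \<Longrightarrow> el (ap f x)"
  by (simp add: el_def ap_def obj_def)

lemma el_pair [simp]: "\<lbrakk>el x; el y; dj x y\<rbrakk> \<Longrightarrow> el (pair x y)"
  by (simp add: el_def pair_def obj_def dj_def)

lemma el_star [simp]: "el (star L)"
  by (simp add: el_def star_def)

lemma el_smul [simp]: "\<lbrakk>el s; el x; dj s x; obj s = \<I>\<rbrakk> \<Longrightarrow> el (smul s x)"
  by (simp add: smul_def)

lemma ap_cmp [simp]:
  "\<lbrakk>ar f; ar g; trg f = src g; el x; src f = obj x\<rbrakk> \<Longrightarrow> ap (g \<bullet> f) x = ap g (ap f x)"
  by (simp add: ap_def cmp_assoc el_def obj_def)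

lemma ap_ID [simp]: "\<lbrakk>el x; obj x = X\<rbrakk> \<Longrightarrow> ap (ID X) x = x"
  by (cases x) (simp add: ap_def el_def obj_def)

lemma ap_tens [simp]:
  "\<lbrakk>ar f; ar g; el x; el y; dj x y; src f = obj x; src g = obj y\<rbrakk>
    \<Longrightarrow> ap (f \<boxtimes> g) (pair x y) = pair (ap f x) (ap g y)"
  by (simp add: ap_def pair_def el_def obj_def dj_def tens_cmp cmp_assoc)

lemma ap_SW [simp]:
  assumes "el x" "el y" "dj x y" "obj x = X" "obj y = Y"
  shows "ap (SW X Y) (pair x y) = pair y x"
proof -
  have "SW X Y \<bullet> (arw x \<boxtimes> arw y) \<bullet> sp (base x) (ctx x) (ctx y)
      = (arw y \<boxtimes> arw x) \<bullet> SW (T (base x) (ctx x)) (T (base x) (ctx y)) \<bullet> sp (base x) (ctx x) (ctx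
          y)"
    using assms cmp_extend [OF SW_natural [of "arw x" "arw y"], of X Y
        "sp (base x) (ctx x) (ctx y)"]
    by (simp add: el_def obj_def dj_def cmp_assoc)
  then show ?thesis
    using assms SW_sp [of "ctx x" "ctx y" "base x"] by (simp add: ap_def pair_def dj_def Un_commute)
qed

lemma ap_ASS [simp]:
  assumes "el x" "el y" "el z" "dj x y" "dj x z" "dj y z" "obj x = X" "obj y = Y" "obj z = Z"
  shows "ap (ASS X Y Z) (pair (pair x y) z) = pair x (pair y z)"
proof -
  let ?Q = "ctx x" and ?R = "ctx y" and ?S = "ctx z"
  have d: "?Q \<inter> ?R = {}" "?Q \<inter> ?S = {}" "?R \<inter> ?S = {}" "(?Q \<union> ?R) \<inter> ?S = {}" "?Q \<inter> (?R \<union> ?S) = {}"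
    "(?Q \<union> ?R) \<union> ?S = ?Q \<union> (?R \<union> ?S)"
    using assms by (auto simp: dj_def)
  have b: "base y = base x" "base z = base x" using assms by (auto simp: dj_def)
  note A = assms [unfolded el_def obj_def b]
  have "ASS X Y Z \<bullet> (((arw x \<boxtimes> arw y) \<bullet> sp (base x) ?Q ?R) \<boxtimes> arw z) \<bullet> sp (base x) (?Q \<union> ?R) ?S
      = ASS X Y Z \<bullet> ((arw x \<boxtimes> arw y) \<boxtimes> arw z) \<bullet> (sp (base x) ?Q ?R \<boxtimes> ID (T (base x) ?S)) \<bullet> sp (base
          x) (?Q \<union> ?R) ?S"
    using A d tens_cmp [of "sp (base x) ?Q ?R" "arw x \<boxtimes> arw y" "ID (T (base x) ?S)" "arw z"]
        by (simp add: cmp_assoc)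
  also have "\<dots> = (arw x \<boxtimes> arw y \<boxtimes> arw z) \<bullet> ASS (T (base x) ?Q) (T (base x) ?R) (T (base x) ?S) \<bullet>
      (sp (base x) ?Q ?R \<boxtimes> ID (T (base x) ?S)) \<bullet> sp (base x) (?Q \<union> ?R) ?S"
    using A d cmp_extend [OF ASS_natural [of "arw x" "arw y" "arw z"],
        of X Y Z "(sp (base x) ?Q ?R \<boxtimes> ID (T (base x) ?S)) \<bullet> sp (base x) (?Q \<union> ?R) ?S"]
            by (simp add: cmp_assoc)
  also have "\<dots> = (arw x \<boxtimes> arw y \<boxtimes> arw z) \<bullet> (ID (T (base x) ?Q) \<boxtimes> sp (base x) ?R ?S) \<bullet>
      sp (base x) ?Q (?R \<union> ?S)"
    using coassoc_sp [OF d(1-3), of "base x"] by (simp add: coassoc_def)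
  also have "\<dots> = (arw x \<boxtimes> ((arw y \<boxtimes> arw z) \<bullet> sp (base x) ?R ?S)) \<bullet> sp (base x) ?Q (?R \<union> ?S)"
    using A d tens_cmp [of "ID (T (base x) ?Q)" "arw x" "sp (base x) ?R ?S" "arw y \<boxtimes> arw z"]
        by (simp add: cmp_assoc)
  finally show ?thesis using d b by (simp add: ap_def pair_def Un_assoc)
qed

lemma ap_inverse:
  assumes "inverses f g" "ap f x = y" "el x" "obj x = src f"
  shows "ap g y = x"
proof -
  have "ap g (ap f x) = ap (g \<bullet> f) x" using assms by (subst ap_cmp) (auto simp: inverses_def)
  also have "\<dots> = x" using assms by (simp add: inverses_def)
  finally show ?thesis using assms by simp
qed

lemma ap_ASSI [simp]:
  assumes "el x" "el y" "el z" "dj x y" "dj x z" "dj y z" "obj x = X" "obj y = Y" "obj z = Z"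
  shows "ap (ASSI X Y Z) (pair x (pair y z)) = pair (pair x y) z"
  by (rule ap_inverse [OF inverses_ASS]) (use assms in auto)

lemma smul_star [simp]:
  assumes "el x" "base x = L" shows "smul (star L) x = x"
proof -
  have "LU (obj x) \<bullet> (ID \<I> \<boxtimes> arw x) \<bullet> sp (base x) {} (ctx x) = arw x \<bullet> LU (T (base x) (ctx x)) \<bullet>
      sp (base x) {} (ctx x)"
    using assms cmp_extend [OF LU_natural [of "arw x"], of "obj x" "sp (base x) {} (ctx x)"]
    by (simp add: el_def obj_def cmp_assoc)
  then show ?thesis using assms
    by (cases x) (simp add: smul_def ap_def pair_def star_def LU_sp el_def)
qed

lemma ap_LU [simp]: "obj x = X \<Longrightarrow> ap (LU X) (pair s x) = smul s x"
  by (simp add: smul_def)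

lemma ap_RU [simp]:
  assumes "el s" "el x" "dj s x" "dj x s" "obj s = \<I>" "obj x = X"
  shows "ap (RU X) (pair x s) = smul s x"
  using assms by (simp add: LU_SW [symmetric])

lemma ap_LUI [simp]: "\<lbrakk>el x; obj x = X\<rbrakk> \<Longrightarrow> ap (LUI X) x = pair (star (base x)) x"
  by (rule ap_inverse [OF inverses_LU]) simp_all

lemma ap_RUI [simp]: "\<lbrakk>el x; obj x = X\<rbrakk> \<Longrightarrow> ap (RUI X) x = pair x (star (base x))"
  by (rule ap_inverse [OF inverses_RU]) simp_all

lemma ap_smul [simp]:
  assumes "el s" "el x" "dj s x" "obj s = \<I>" "ar f" "src f = obj x"
  shows "ap f (smul s x) = smul s (ap f x)"
proof -
  have "ap f (smul s x) = ap (f \<bullet> LU (obj x)) (pair s x)" using assms by simp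
  also have "\<dots> = ap (LU (trg f) \<bullet> (ID \<I> \<boxtimes> f)) (pair s x)" using assms by (simp add: LU_natural)
  also have "\<dots> = smul s (ap f x)" using assms by simp
  finally show ?thesis .
qed

lemma pair_smul_left [simp]:
  assumes "el s" "el x" "el y" "dj s x" "dj s y" "dj x y" "obj s = \<I>"
  shows "pair (smul s x) y = smul s (pair x y)"
proof -
  have "pair (smul s x) y = ap (LU (obj x) \<boxtimes> ID (obj y)) (pair (pair s x) y)" using assms by simp
  also have "\<dots> = ap (LU (obj x \<otimes>\<^sub>o obj y) \<bullet> ASS \<I> (obj x) (obj y)) (pair (pair s x) y)"
    by (simp add: LU_tens)
  also have "\<dots> = smul s (pair x y)" using assms by simp
  finally show ?thesis .
qed

lemma pair_smul_right [simp]: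
  assumes "el s" "el x" "el y" "dj s x" "dj s y" "dj x y" "obj s = \<I>"
  shows "pair x (smul s y) = smul s (pair x y)"
proof -
  have d: "dj x s" "dj y s" "dj y x" using assms by (auto intro: dj_sym)
  have "pair x (smul s y) = ap (SW (obj y) (obj x)) (pair (smul s y) x)"
    using assms d by (simp del: pair_smul_left)
  also have "\<dots> = smul s (pair x y)" using assms d by (simp del: ap_SW) (simp add: d)
  finally show ?thesis .
qed

lemma smul_assoc [simp]:
  assumes "el s" "el t" "el x" "dj s t" "dj s x" "dj t x" "obj s = \<I>" "obj t = \<I>"
  shows "smul (smul s t) x = smul s (smul t x)"
  using assms by (simp add: smul_def [of "smul s t"])

text \<open>Both sides are the value of the single unit constraint \<open>LU \<I> = RU \<I>\<close>
  at \<open>pair t s\<close>.\<close>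

lemma smul_commute:
  assumes "el s" "el t" "dj s t" "dj t s" "obj s = \<I>" "obj t = \<I>"
  shows "smul s t = smul t s"
  using assms ap_RU [of s t \<I>] by (simp add: LU_I_eq_RU_I [symmetric] del: ap_RU)

lemma smul_left_commute:
  assumes "el s" "el t" "el x" "dj s t" "dj t s" "dj s x" "dj t x" "obj s = \<I>" "obj t = \<I>"
  shows "smul s (smul t x) = smul t (smul s x)"
  using assms smul_commute [of s t] smul_assoc [of s t x] smul_assoc [of t s x] by simp

lemmas smul_ac = smul_commute smul_left_commute

text \<open>A generic element is a split epimorphism, hence can be cancelled: two arrows are equal as
  soon as they agree on pure tensors of variables.\<close>

definition var where
  "var L k = Elt L {k} (RU (L ! k))"

lemma T_single: "k < length L \<Longrightarrow> T L {k} = (L ! k) \<otimes>\<^sub>o \<I>"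
proof (induction L arbitrary: k)
  case (Cons X L)
  show ?case
  proof (cases k)
    case 0
    then have "Suc -` {k} = {}" by auto
    with 0 show ?thesis by simp
  next
    case (Suc j)
    then have "Suc -` {k} = {j}" by auto
    with Suc Cons show ?thesis by simp
  qed
qed simp

lemma var_simps [simp]: "base (var L k) = L" "ctx (var L k) = {k}" "obj (var L k) = L ! k"
    "k < length L \<Longrightarrow> el (var L k)"
  "dj (var L k) (var L l) \<longleftrightarrow> k \<noteq> l"
  by (auto simp: var_def obj_def el_def T_single dj_def)

definition generic where
  "generic x \<longleftrightarrow> el x \<and> split_epi (arw x)"

lemma generic_var: "k < length L \<Longrightarrow> generic (var L k)"
  by (simp add: generic_def) (simp add: var_def inverses_split_epi [OF inverses_RU])

lemma generic_pair: "\<lbrakk>generic x; generic y; dj x y\<rbrakk> \<Longrightarrow> generic (pair x y)"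
  by (auto simp: generic_def el_def pair_def dj_def intro!: split_epi_cmp split_epi_tens
      split_epi_sp)

lemma generic_eqI:
  assumes "ap f x = ap g x" "generic x" "ar f" "ar g" "src f = obj x" "src g = obj x"
  shows "f = g"
  by (rule split_epi_cancel [of f "arw x" g]) (use assms in \<open>auto simp: ap_def obj_def generic_def
      el_def\<close>)

text \<open>Disjointness is recorded in both orders, since rules such as \<open>smul_commute\<close>
  ask for both. Unfolding the list hands the simplifier all side conditions on the variables at
  once.\<close>

primrec wires where
  "wires L [] \<longleftrightarrow> True"
| "wires L (p # ps) \<longleftrightarrow> base (fst p) = L \<and> el (fst p) \<and> obj (fst p) = snd p \<and>
     (\<forall>q\<in>set ps. dj (fst p) (fst q) \<and> dj (fst q) (fst p)) \<and> wires L ps"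

text \<open>The test elements are the variables over the list of the factors themselves. Since
  associativity is not strict, each bracketing of a source gets a rule of its own.\<close>

lemma arrow_eqI1:
  assumes "\<And>L x. wires L [(x, X)]
      \<Longrightarrow> ap f x = ap g x"
    and "ar f" "ar g" "src f = X" "src g = X"
  shows "f = g"
proof -
  let ?v = "var [X]"
  show ?thesis
    by (rule generic_eqI [where x = "?v 0"])
      (simp_all add: assms generic_var generic_pair)
qed

lemma arrow_eqI2:
  assumes "\<And>L x y. wires L [(x, X), (y, Y)]
      \<Longrightarrow> ap f (pair x y) = ap g (pair x y)"
    and "ar f" "ar g" "src f = X \<otimes>\<^sub>o Y" "src g = X \<otimes>\<^sub>o Y"
  shows "f = g"
proof -
  let ?v = "var [X, Y]"
  show ?thesis
    by (rule generic_eqI [where x = "pair (?v 0) (?v 1)"])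
      (simp_all add: assms generic_var generic_pair)
qed

lemma arrow_eqI3l:
  assumes "\<And>L x y z. wires L [(x, X), (y, Y), (z, Z)]
      \<Longrightarrow> ap f (pair (pair x y) z) = ap g (pair (pair x y) z)"
    and "ar f" "ar g" "src f = (X \<otimes>\<^sub>o Y) \<otimes>\<^sub>o Z" "src g = (X \<otimes>\<^sub>o Y) \<otimes>\<^sub>o Z"
  shows "f = g"
proof -
  let ?v = "var [X, Y, Z]"
  show ?thesis
    by (rule generic_eqI [where x = "pair (pair (?v 0) (?v 1)) (?v 2)"])
      (simp_all add: assms generic_var generic_pair)
qed

lemma arrow_eqI3r:
  assumes "\<And>L x y z. wires L [(x, X), (y, Y), (z, Z)]
      \<Longrightarrow> ap f (pair x (pair y z)) = ap g (pair x (pair y z))"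
    and "ar f" "ar g" "src f = X \<otimes>\<^sub>o (Y \<otimes>\<^sub>o Z)" "src g = X \<otimes>\<^sub>o (Y \<otimes>\<^sub>o Z)"
  shows "f = g"
proof -
  let ?v = "var [X, Y, Z]"
  show ?thesis
    by (rule generic_eqI [where x = "pair (?v 0) (pair (?v 1) (?v 2))"])
      (simp_all add: assms generic_var generic_pair)
qed

lemma arrow_eqI4:
  assumes "\<And>L x y z w. wires L [(x, X), (y, Y), (z, Z), (w, W)]
      \<Longrightarrow> ap f (pair (pair x y) (pair z w)) = ap g (pair (pair x y) (pair z w))"
    and "ar f" "ar g" "src f = (X \<otimes>\<^sub>o Y) \<otimes>\<^sub>o (Z \<otimes>\<^sub>o W)" "src g = (X \<otimes>\<^sub>o Y) \<otimes>\<^sub>o (Z \<otimes>\<^sub>o W)"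
  shows "f = g"
proof -
  let ?v = "var [X, Y, Z, W]"
  show ?thesis
    by (rule generic_eqI [where x = "pair (pair (?v 0) (?v 1)) (pair (?v 2) (?v 3))"])
      (simp_all add: assms generic_var generic_pair)
qed

lemma arrow_eqI4l:
  assumes "\<And>L x y z w. wires L [(x, X), (y, Y), (z, Z), (w, W)]
      \<Longrightarrow> ap f (pair (pair x (pair y z)) w) = ap g (pair (pair x (pair y z)) w)"
    and "ar f" "ar g" "src f = (X \<otimes>\<^sub>o (Y \<otimes>\<^sub>o Z)) \<otimes>\<^sub>o W" "src g = (X \<otimes>\<^sub>o (Y \<otimes>\<^sub>o Z)) \<otimes>\<^sub>o W"
  shows "f = g"
proof -
  let ?v = "var [X, Y, Z, W]"
  show ?thesis
    by (rule generic_eqI [where x = "pair (pair (?v 0) (pair (?v 1) (?v 2))) (?v 3)"])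
      (simp_all add: assms generic_var generic_pair)
qed

lemma arrow_eqI4m:
  assumes "\<And>L x y z w. wires L [(x, X), (y, Y), (z, Z), (w, W)]
      \<Longrightarrow> ap f (pair x (pair (pair y z) w)) = ap g (pair x (pair (pair y z) w))"
    and "ar f" "ar g" "src f = X \<otimes>\<^sub>o ((Y \<otimes>\<^sub>o Z) \<otimes>\<^sub>o W)" "src g = X \<otimes>\<^sub>o ((Y \<otimes>\<^sub>o Z) \<otimes>\<^sub>o W)"
  shows "f = g"
proof -
  let ?v = "var [X, Y, Z, W]"
  show ?thesis
    by (rule generic_eqI [where x = "pair (?v 0) (pair (pair (?v 1) (?v 2)) (?v 3))"])
      (simp_all add: assms generic_var generic_pair)
qed

lemma arrow_eqI4r:
  assumes "\<And>L x y z w. wires L [(x, X), (y, Y), (z, Z), (w, W)]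
      \<Longrightarrow> ap f (pair x (pair y (pair z w))) = ap g (pair x (pair y (pair z w)))"
    and "ar f" "ar g" "src f = X \<otimes>\<^sub>o (Y \<otimes>\<^sub>o (Z \<otimes>\<^sub>o W))" "src g = X \<otimes>\<^sub>o (Y \<otimes>\<^sub>o (Z \<otimes>\<^sub>o W))"
  shows "f = g"
proof -
  let ?v = "var [X, Y, Z, W]"
  show ?thesis
    by (rule generic_eqI [where x = "pair (?v 0) (pair (?v 1) (pair (?v 2) (?v 3)))"])
      (simp_all add: assms generic_var generic_pair)
qed

lemma arrow_eqI4ll:
  assumes "\<And>L x y z w. wires L [(x, X), (y, Y), (z, Z), (w, W)]
      \<Longrightarrow> ap f (pair (pair (pair x y) z) w) = ap g (pair (pair (pair x y) z) w)"
    and "ar f" "ar g" "src f = ((X \<otimes>\<^sub>o Y) \<otimes>\<^sub>o Z) \<otimes>\<^sub>o W" "src g = ((X \<otimes>\<^sub>o Y) \<otimes>\<^sub>o Z) \<otimes>\<^sub>o W"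
  shows "f = g"
proof -
  let ?v = "var [X, Y, Z, W]"
  show ?thesis
    by (rule generic_eqI [where x = "pair (pair (pair (?v 0) (?v 1)) (?v 2)) (?v 3)"])
      (simp_all add: assms generic_var generic_pair)
qed

lemma arrow_eqI5l:
  assumes "\<And>L x y z w u. wires L [(x, X), (y, Y), (z, Z), (w, W), (u, U)]
      \<Longrightarrow> ap f (pair (pair (pair x y) (pair z w)) u) = ap g (pair (pair (pair x y) (pair z w)) u)"
    and "ar f" "ar g" "src f = ((X \<otimes>\<^sub>o Y) \<otimes>\<^sub>o (Z \<otimes>\<^sub>o W)) \<otimes>\<^sub>o U"
        "src g = ((X \<otimes>\<^sub>o Y) \<otimes>\<^sub>o (Z \<otimes>\<^sub>o W)) \<otimes>\<^sub>o U"
  shows "f = g"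
proof -
  let ?v = "var [X, Y, Z, W, U]"
  show ?thesis
    by (rule generic_eqI [where x = "pair (pair (pair (?v 0) (?v 1)) (pair (?v 2) (?v 3))) (?v 4)"])
      (simp_all add: assms generic_var generic_pair)
qed

lemma arrow_eqI5m:
  assumes "\<And>L x y z w u. wires L [(x, X), (y, Y), (z, Z), (w, W), (u, U)]
      \<Longrightarrow> ap f (pair (pair x y) (pair (pair z w) u)) = ap g (pair (pair x y) (pair (pair z w) u))"
    and "ar f" "ar g" "src f = (X \<otimes>\<^sub>o Y) \<otimes>\<^sub>o ((Z \<otimes>\<^sub>o W) \<otimes>\<^sub>o U)"
        "src g = (X \<otimes>\<^sub>o Y) \<otimes>\<^sub>o ((Z \<otimes>\<^sub>o W) \<otimes>\<^sub>o U)"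
  shows "f = g"
proof -
  let ?v = "var [X, Y, Z, W, U]"
  show ?thesis
    by (rule generic_eqI [where x = "pair (pair (?v 0) (?v 1)) (pair (pair (?v 2) (?v 3)) (?v 4))"])
      (simp_all add: assms generic_var generic_pair)
qed

lemma arrow_eqI6l:
  assumes "\<And>L x y z w u v. wires L [(x, X), (y, Y), (z, Z), (w, W), (u, U), (v, V)]
      \<Longrightarrow> ap f (pair (pair (pair x y) (pair z w)) (pair u v)) = ap g (pair (pair (pair x y) (pair z
          w)) (pair u v))"
    and "ar f" "ar g" "src f = ((X \<otimes>\<^sub>o Y) \<otimes>\<^sub>o (Z \<otimes>\<^sub>o W)) \<otimes>\<^sub>o (U \<otimes>\<^sub>o V)" "src g
        = ((X \<otimes>\<^sub>o Y) \<otimes>\<^sub>o (Z \<otimes>\<^sub>o W)) \<otimes>\<^sub>o (U \<otimes>\<^sub>o V)"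
  shows "f = g"
proof -
  let ?v = "var [X, Y, Z, W, U, V]"
  show ?thesis
    by (rule generic_eqI [where x = "pair (pair (pair (?v 0) (?v 1)) (pair (?v 2) (?v 3)))
        (pair (?v 4) (?v 5))"])
      (simp_all add: assms generic_var generic_pair)
qed

lemma arrow_eqI6r:
  assumes "\<And>L x y z w u v. wires L [(x, X), (y, Y), (z, Z), (w, W), (u, U), (v, V)]
      \<Longrightarrow> ap f (pair (pair u v) (pair (pair x y) (pair z w))) = ap g (pair (pair u v) (pair (pair x y)
          (pair z w)))"
    and "ar f" "ar g" "src f = (U \<otimes>\<^sub>o V) \<otimes>\<^sub>o ((X \<otimes>\<^sub>o Y) \<otimes>\<^sub>o (Z \<otimes>\<^sub>o W))" "src g
        = (U \<otimes>\<^sub>o V) \<otimes>\<^sub>o ((X \<otimes>\<^sub>o Y) \<otimes>\<^sub>o (Z \<otimes>\<^sub>o W))"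
  shows "f = g"
proof -
  let ?v = "var [X, Y, Z, W, U, V]"
  show ?thesis
    by (rule generic_eqI [where x = "pair (pair (?v 4) (?v 5)) (pair (pair (?v 0) (?v 1))
        (pair (?v 2) (?v 3)))"])
      (simp_all add: assms generic_var generic_pair)
qed

lemma arrow_eqI6c:
  assumes "\<And>L x y z w u v. wires L [(x, X), (y, Y), (z, Z), (w, W), (u, U), (v, V)]
      \<Longrightarrow> ap f (pair (pair x (pair y z)) (pair w (pair u v))) = ap g (pair (pair x (pair y z)) (pair w
          (pair u v)))"
    and "ar f" "ar g" "src f = (X \<otimes>\<^sub>o (Y \<otimes>\<^sub>o Z)) \<otimes>\<^sub>o (W \<otimes>\<^sub>o (U \<otimes>\<^sub>o V))" "src g
        = (X \<otimes>\<^sub>o (Y \<otimes>\<^sub>o Z)) \<otimes>\<^sub>o (W \<otimes>\<^sub>o (U \<otimes>\<^sub>o V))"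
  shows "f = g"
proof -
  let ?v = "var [X, Y, Z, W, U, V]"
  show ?thesis
    by (rule generic_eqI [where x = "pair (pair (?v 0) (pair (?v 1) (?v 2))) (pair (?v 3)
        (pair (?v 4) (?v 5)))"])
      (simp_all add: assms generic_var generic_pair)
qed

lemma arrow_eqI6d:
  assumes "\<And>L x y z w u v. wires L [(x, X), (y, Y), (z, Z), (w, W), (u, U), (v, V)]
      \<Longrightarrow> ap f (pair (pair (pair x y) z) (pair (pair w u) v)) = ap g (pair (pair (pair x y) z) (pair
          (pair w u) v))"
    and "ar f" "ar g" "src f = ((X \<otimes>\<^sub>o Y) \<otimes>\<^sub>o Z) \<otimes>\<^sub>o ((W \<otimes>\<^sub>o U) \<otimes>\<^sub>o V)" "src g
        = ((X \<otimes>\<^sub>o Y) \<otimes>\<^sub>o Z) \<otimes>\<^sub>o ((W \<otimes>\<^sub>o U) \<otimes>\<^sub>o V)"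
  shows "f = g"
proof -
  let ?v = "var [X, Y, Z, W, U, V]"
  show ?thesis
    by (rule generic_eqI [where x = "pair (pair (pair (?v 0) (?v 1)) (?v 2)) (pair (pair (?v 3)
        (?v 4)) (?v 5))"])
      (simp_all add: assms generic_var generic_pair)
qed

lemma arrow_eqI6e:
  assumes "\<And>L x y z w u v. wires L [(x, X), (y, Y), (z, Z), (w, W), (u, U), (v, V)]
      \<Longrightarrow> ap f (pair (pair x y) (pair z (pair (pair w u) v))) = ap g (pair (pair x y) (pair z (pair
          (pair w u) v)))"
    and "ar f" "ar g" "src f = (X \<otimes>\<^sub>o Y) \<otimes>\<^sub>o (Z \<otimes>\<^sub>o ((W \<otimes>\<^sub>o U) \<otimes>\<^sub>o V))" "src g
        = (X \<otimes>\<^sub>o Y) \<otimes>\<^sub>o (Z \<otimes>\<^sub>o ((W \<otimes>\<^sub>o U) \<otimes>\<^sub>o V))"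
  shows "f = g"
proof -
  let ?v = "var [X, Y, Z, W, U, V]"
  show ?thesis
    by (rule generic_eqI [where x = "pair (pair (?v 0) (?v 1)) (pair (?v 2) (pair (pair (?v 3)
        (?v 4)) (?v 5)))"])
      (simp_all add: assms generic_var generic_pair)
qed

section \<open>Contractions evaluated on pure tensors\<close>

definition "XCH A B X Y = Arrow ((A \<otimes>\<^sub>o B) \<otimes>\<^sub>o (X \<otimes>\<^sub>o Y)) (interchange C A B X Y) ((A \<otimes>\<^sub>o X) \<otimes>\<^sub>o
    (B \<otimes>\<^sub>o Y))"
definition "CL e A B R = Arrow (A \<otimes>\<^sub>o (B \<otimes>\<^sub>o R)) (contr_left C (mor e) A B R) R"
definition "CR e Y A B = Arrow ((Y \<otimes>\<^sub>o A) \<otimes>\<^sub>o B) (contr_right C (mor e) Y A B) Y"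
definition "C13 e A B X = Arrow ((A \<otimes>\<^sub>o B) \<otimes>\<^sub>o X) (contr13 C (mor e) A B X) B"
definition "C1324 e e' A B X Y =
  Arrow ((A \<otimes>\<^sub>o B) \<otimes>\<^sub>o (X \<otimes>\<^sub>o Y)) (contr13_24 C (mor e) (mor e') A B X Y) \<I>"

definition bil where
  "bil e A B \<longleftrightarrow> ar e \<and> src e = A \<otimes>\<^sub>o B \<and> trg e = \<I>"

lemma bil_simps: "bil e A B \<Longrightarrow> ar e" "bil e A B \<Longrightarrow> src e = A \<otimes>\<^sub>o B" "bil e A B \<Longrightarrow> trg e = \<I>"
  by (simp_all add: bil_def)

lemma contr_simps [simp]:
  "src (XCH A B X Y) = (A \<otimes>\<^sub>o B) \<otimes>\<^sub>o (X \<otimes>\<^sub>o Y)" "trg (XCH A B X Y) = (A \<otimes>\<^sub>o X) \<otimes>\<^sub>o (B \<otimes>\<^sub>o Y)"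
  "src (CL e A B R) = A \<otimes>\<^sub>o (B \<otimes>\<^sub>o R)" "trg (CL e A B R) = R"
  "src (CR e Z A B) = (Z \<otimes>\<^sub>o A) \<otimes>\<^sub>o B" "trg (CR e Z A B) = Z"
  "src (C13 e A B X) = (A \<otimes>\<^sub>o B) \<otimes>\<^sub>o X" "trg (C13 e A B X) = B"
  "src (C1324 e e' A B X Y) = (A \<otimes>\<^sub>o B) \<otimes>\<^sub>o (X \<otimes>\<^sub>o Y)" "trg (C1324 e e' A B X Y) = \<I>"
  by (simp_all add: XCH_def CL_def CR_def C13_def C1324_def)

lemma XCH_eq: "XCH A B X Y = ASSI A X (B \<otimes>\<^sub>o Y) \<bullet>
    (ID A \<boxtimes> (ASS X B Y \<bullet> (SW B X \<boxtimes> ID Y) \<bullet> ASSI B X Y)) \<bullet> ASS A B (X \<otimes>\<^sub>o Y)"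
  by (simp add: XCH_def cmp_def tens_def interchange_def ASS_def ASSI_def SW_def ID_def)

lemma CL_eq: "\<lbrakk>src e = A \<otimes>\<^sub>o B; trg e = \<I>\<rbrakk> \<Longrightarrow> CL e A B R = LU R \<bullet> (e \<boxtimes> ID R) \<bullet> ASSI A B R"
  by (simp add: CL_def cmp_def tens_def contr_left_def ASSI_def LU_def ID_def)

lemma CR_eq: "\<lbrakk>src e = A \<otimes>\<^sub>o B; trg e = \<I>\<rbrakk> \<Longrightarrow> CR e Y A B = RU Y \<bullet> (ID Y \<boxtimes> e) \<bullet> ASS Y A B"
  by (simp add: CR_def cmp_def tens_def contr_right_def ASS_def RU_def ID_def)

lemma C13_eq: "C13 e A B X = CL e A X B \<bullet> (ID A \<boxtimes> SW B X) \<bullet> ASS A B X"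
  by (simp add: C13_def CL_def cmp_def tens_def contr13_def ASS_def SW_def ID_def)

lemma C1324_eq: "\<lbrakk>src e = A \<otimes>\<^sub>o X; trg e = \<I>; src e' = B \<otimes>\<^sub>o Y; trg e' = \<I>\<rbrakk> \<Longrightarrow>
   C1324 e e' A B X Y = LU \<I> \<bullet> (e \<boxtimes> e') \<bullet> XCH A B X Y"
  by (simp add: C1324_def cmp_def tens_def contr13_24_def XCH_def LU_def)

lemma ar_XCH [simp]: "ar (XCH A B X Y)"
  by (simp add: XCH_eq)

lemma ar_contr [simp]:
  "bil e A B \<Longrightarrow> ar (CL e A B R)" "bil e A B \<Longrightarrow> ar (CR e Y A B)" "bil e A X \<Longrightarrow> ar (C13 e A B X)"
  "\<lbrakk>bil e A X; bil e' B Y\<rbrakk> \<Longrightarrow> ar (C1324 e e' A B X Y)"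
  by (simp_all add: bil_def CL_eq CR_eq C13_eq C1324_eq)

lemma bil_C1324 [simp]: "\<lbrakk>bil e A X; bil e' B Y\<rbrakk> \<Longrightarrow> bil (C1324 e e' A B X Y) (A \<otimes>\<^sub>o B) (X \<otimes>\<^sub>o Y)"
  by (simp add: bil_def [of "C1324 e e' A B X Y"])

lemma ap_XCH [simp]:
  assumes "el x" "el y" "el z" "el w" "obj x = X" "obj y = Y" "obj z = Z" "obj w = W"
        "dj x y" "dj x z" "dj x w" "dj y z" "dj y w" "dj z w"
  shows "ap (XCH X Y Z W) (pair (pair x y) (pair z w)) = pair (pair x z) (pair y w)"
  using assms by (simp add: XCH_eq dj_sym [of y z])

lemma ap_CL [simp]:
  assumes "bil e A B" "el a" "el b" "el x" "obj a = A" "obj b = B" "obj x = R"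
    "dj a b" "dj a x" "dj b x"
  shows "ap (CL e A B R) (pair a (pair b x)) = smul (ap e (pair a b)) x"
  using assms by (simp add: bil_def CL_eq)

lemma ap_CR [simp]:
  assumes "bil e A B" "el a" "el b" "el x" "obj a = A" "obj b = B" "obj x = Y"
    "dj a b" "dj x a" "dj x b"
  shows "ap (CR e Y A B) (pair (pair x a) b) = smul (ap e (pair a b)) x"
  using assms by (simp add: bil_def CR_eq dj_sym [of x])

lemma ap_C13 [simp]:
  assumes "bil e A X" "el a" "el b" "el x" "obj a = A" "obj b = B" "obj x = X"
    "dj a b" "dj a x" "dj b x"
  shows "ap (C13 e A B X) (pair (pair a b) x) = smul (ap e (pair a x)) b"
  using assms by (simp add: C13_eq dj_sym [of b])

lemma ap_C1324 [simp]:
  assumes "bil e A X" "bil e' B Y" "el a" "el b" "el x" "el y"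
    "obj a = A" "obj b = B" "obj x = X" "obj y = Y"
    "dj a b" "dj a x" "dj a y" "dj b x" "dj b y" "dj x y"
  shows "ap (C1324 e e' A B X Y) (pair (pair a b) (pair x y))
    = smul (ap e (pair a x)) (ap e' (pair b y))"
  using assms by (simp add: bil_simps C1324_eq dj_sym [of b x])

section \<open>Dual pairs\<close>

definition "EV X Y = Arrow (IHom C X Y \<otimes>\<^sub>o X) (Eval C X Y) Y"

lemma EV_simps [simp]: "src (EV X Y) = IHom C X Y \<otimes>\<^sub>o X" "trg (EV X Y) = Y" "ar (EV X Y)"
  by (simp_all add: EV_def Eval_closed)

definition "TRP Z X Y f = Arrow Z (transp C Z X Y (mor f)) (IHom C X Y)"

lemma transp_eqI:
  assumes "ar h" "ar k" "src h = Z" "src k = Z" "trg h = IHom C X Y" "trg k = IHom C X Y"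
    "EV X Y \<bullet> (h \<boxtimes> ID X) = EV X Y \<bullet> (k \<boxtimes> ID X)"
  shows "h = k"
proof -
  have 1: "mor h \<in> Hom C Z (IHom C X Y)" "mor k \<in> Hom C Z (IHom C X Y)"
    and 2: "Eval C X Y \<cdot> (mor h \<otimes>\<^sub>m \<^bold>1 X) = Eval C X Y \<cdot> (mor k \<otimes>\<^sub>m \<^bold>1 X)"
    using assms by (auto simp: ar_def EV_def cmp_def)
  have "Eval C X Y \<cdot> (mor h \<otimes>\<^sub>m \<^bold>1 X) \<in> Hom C (Z \<otimes>\<^sub>o X) Y"
    using 1 by (intro Comp_closed [OF Eval_closed] TensM_closed Ident_closed)
  then have "mor h = mor k" using Eval_universal 1 2 by metis
  then show ?thesis using assms by (simp add: arrow.expand)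
qed

lemma TRP:
  assumes "ar f" "src f = Z \<otimes>\<^sub>o X" "trg f = Y"
  shows "ar (TRP Z X Y f)" "src (TRP Z X Y f) = Z" "trg (TRP Z X Y f) = IHom C X Y"
    "EV X Y \<bullet> (TRP Z X Y f \<boxtimes> ID X) = f"
proof -
  have "mor f \<in> Hom C (Z \<otimes>\<^sub>o X) Y" using assms by (simp add: ar_def)
  from theI' [OF Eval_universal [OF this]]
  have "transp C Z X Y (mor f) \<in> Hom C Z (IHom C X Y) \<and>
      Eval C X Y \<cdot> (transp C Z X Y (mor f) \<otimes>\<^sub>m \<^bold>1 X) = mor f" by (simp add: transp_def)
  then show "ar (TRP Z X Y f)" "src (TRP Z X Y f) = Z" "trg (TRP Z X Y f) = IHom C X Y"
    "EV X Y \<bullet> (TRP Z X Y f \<boxtimes> ID X) = f"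
    using assms by (auto simp: TRP_def EV_def cmp_def intro!: arrow.expand)
qed

text \<open>The triangle identities are stated for any \<open>D\<close>, not only for
  \<open>IHom C X \<I>\<close>, because \<open>Sym C n V\<^sup>\<or>\<close> has to serve as a dual
  of \<open>Sym C n V\<close> along its own pairing.\<close>

definition dualpair where
  "dualpair D X e c \<longleftrightarrow> bil e D X \<and> ar c \<and> src c = \<I> \<and> trg c = X \<otimes>\<^sub>o D \<and>
     CR e X D X \<bullet> (c \<boxtimes> ID X) = LU X \<and> CL e D X D \<bullet> (ID D \<boxtimes> c) = RU D"

lemma dualpair_simps:
  assumes "dualpair D X e c"
  shows "bil e D X" "ar c" "src c = \<I>" "trg c = X \<otimes>\<^sub>o D"
    "ar e" "src e = D \<otimes>\<^sub>o X" "trg e = \<I>"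
  using assms by (auto simp: dualpair_def bil_def)

text \<open>Since \<open>ap c s\<close> is not a pure tensor, it can be eliminated only in such a
  position. The later proofs therefore establish an equation of arrows whose source contains the
  factor \<open>X \<otimes>\<^sub>o D\<close>, by evaluation on pure tensors, and then apply both
  sides to an element that has \<open>ap c s\<close> in this place.\<close>

lemma ap_CR_coev:
  assumes "dualpair D X e c" "el s" "el x" "obj s = \<I>" "obj x = X" "dj s x"
  shows "ap (CR e X D X) (pair (ap c s) x) = smul s x"
proof -
  have "ap (CR e X D X \<bullet> (c \<boxtimes> ID X)) (pair s x) = ap (LU X) (pair s x)"
    using assms(1) by (simp add: dualpair_def)
  then show ?thesis using assms dualpair_simps [OF assms(1)] by simp
qed

lemma ap_CL_coev:
  assumes "dualpair D X e c" "el s" "el d" "obj s = \<I>" "obj d = D" "dj s d" "dj d s"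
  shows "ap (CL e D X D) (pair d (ap c s)) = smul s d"
proof -
  have "ap (CL e D X D \<bullet> (ID D \<boxtimes> c)) (pair d s) = ap (RU D) (pair d s)"
    using assms(1) by (simp add: dualpair_def)
  then show ?thesis using assms dualpair_simps [OF assms(1)] by simp
qed

text \<open>The arrow \<open>Z \<rightarrow> Y \<otimes> D\<close> that corresponds to \<open>f : Z \<otimes> X \<rightarrow> Y\<close>\<close>

definition "lft D X c Z f = (f \<boxtimes> ID D) \<bullet> ASSI Z X D \<bullet> (ID Z \<boxtimes> c) \<bullet> RUI Z"

lemma lft_simps:
  assumes "dualpair D X e c" "ar f" "src f = Z \<otimes>\<^sub>o X"
  shows "ar (lft D X c Z f)" "src (lft D X c Z f) = Z" "trg (lft D X c Z f) = trg f \<otimes>\<^sub>o D"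
  using assms dualpair_simps [OF assms(1)] by (simp_all add: lft_def)

lemma CR_lft:
  assumes d: "dualpair D X e c" and f: "ar f" "src f = Z \<otimes>\<^sub>o X" "trg f = Y"
  shows "CR e Y D X \<bullet> (lft D X c Z f \<boxtimes> ID X) = f"
proof -
  note s = dualpair_simps [OF d]
  have *: "CR e Y D X \<bullet> (((f \<boxtimes> ID D) \<bullet> ASSI Z X D) \<boxtimes> ID X)
      = f \<bullet> (ID Z \<boxtimes> CR e X D X) \<bullet> ASS Z (X \<otimes>\<^sub>o D) X"
    by (rule arrow_eqI4l) (simp_all add: s f)
  show ?thesis
  proof (rule arrow_eqI2 [where X = Z and Y = X])
    fix L x y assume a: "wires L [(x, Z), (y, X)]"
    let ?u = "ap c (star L)"
    have "ap (CR e Y D X \<bullet> (((f \<boxtimes> ID D) \<bullet> ASSI Z X D) \<boxtimes> ID X)) (pair (pair x ?u) y) =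
      ap (f \<bullet> (ID Z \<boxtimes> CR e X D X) \<bullet> ASS Z (X \<otimes>\<^sub>o D) X) (pair (pair x ?u) y)"
      unfolding * ..
    then show "ap (CR e Y D X \<bullet> (lft D X c Z f \<boxtimes> ID X)) (pair x y) = ap f (pair x y)"
      using a by (simp add: s f lft_def ap_CR_coev [OF d])
  qed (simp_all add: s f lft_simps [OF d])
qed

text \<open>Together with \<open>CR_lft\<close> this makes \<open>lft\<close> a bijection. The
  triangle identity for \<open>X\<close> is used there, the one for \<open>D\<close> here.\<close>

lemma lft_CR:
  assumes d: "dualpair D X e c" and h: "ar h" "src h = Z" "trg h = Y \<otimes>\<^sub>o D"
  shows "lft D X c Z (CR e Y D X \<bullet> (h \<boxtimes> ID X)) = h"
proof -
  note s = dualpair_simps [OF d]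
  have 1: "((CR e Y D X \<bullet> (h \<boxtimes> ID X)) \<boxtimes> ID D) \<bullet> ASSI Z X D
      = (CR e Y D X \<boxtimes> ID D) \<bullet> ASSI (Y \<otimes>\<^sub>o D) X D \<bullet> (h \<boxtimes> ID (X \<otimes>\<^sub>o D))"
    by (rule arrow_eqI3r) (simp_all add: s h)
  have 2: "(CR e Y D X \<boxtimes> ID D) \<bullet> ASSI (Y \<otimes>\<^sub>o D) X D = (ID Y \<boxtimes> CL e D X D) \<bullet> ASS Y D (X \<otimes>\<^sub>o D)"
    by (rule arrow_eqI4) (simp_all add: s)
  have 3: "(ID Y \<boxtimes> CL e D X D) \<bullet> ASS Y D (X \<otimes>\<^sub>o D) \<bullet> (ID (Y \<otimes>\<^sub>o D) \<boxtimes> c) = RU (Y \<otimes>\<^sub>o D)"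
    by (rule arrow_eqI3l) (simp_all add: s ap_CL_coev [OF d])
  show ?thesis
  proof (rule arrow_eqI1 [where X = Z])
    fix L x assume a: "wires L [(x, Z)]"
    let ?u = "ap c (star L)"
    have "ap (lft D X c Z (CR e Y D X \<bullet> (h \<boxtimes> ID X))) x
        = ap (((CR e Y D X \<bullet> (h \<boxtimes> ID X)) \<boxtimes> ID D) \<bullet> ASSI Z X D) (pair x ?u)"
      using a by (simp add: lft_def s h)
    also have "\<dots> = ap ((CR e Y D X \<boxtimes> ID D) \<bullet> ASSI (Y \<otimes>\<^sub>o D) X D) (pair (ap h x) ?u)"
      unfolding 1 using a by (simp add: s h)
    also have "\<dots> = ap ((ID Y \<boxtimes> CL e D X D) \<bullet> ASS Y D (X \<otimes>\<^sub>o D) \<bullet> (ID (Y \<otimes>\<^sub>o D) \<boxtimes> c)) (pair (ap h x)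
        (star L))"
      unfolding 2 using a by (simp add: s h)
    also have "\<dots> = ap h x"
      unfolding 3 using a by (simp add: s h)
    finally show "ap (lft D X c Z (CR e Y D X \<bullet> (h \<boxtimes> ID X))) x = ap h x" .
  qed (simp_all add: s h lft_simps [OF d])
qed

lemma CR_cancel:
  assumes "dualpair D X e c" "ar h" "src h = Z" "trg h = Y \<otimes>\<^sub>o D" "ar k" "src k = Z"
      "trg k = Y \<otimes>\<^sub>o D"
    "CR e Y D X \<bullet> (h \<boxtimes> ID X) = CR e Y D X \<bullet> (k \<boxtimes> ID X)"
  shows "h = k"
  using assms lft_CR [of D X e c] by metis

text \<open>\<open>IHom C X Y\<close> and \<open>Y \<otimes>\<^sub>o D\<close> represent the same
  functor, with universal arrows \<open>EV X Y\<close> and \<open>CR e Y D X\<close>. Comparing the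
  two shows that \<open>alpha\<close> is invertible and that its inverse takes transposes to lifts.
  This removes the internal homs from the Poincare morphisms.\<close>

lemma alpha_inv_transp:
  assumes d: "dualpair D X e c" and f: "ar f" "src f = Z \<otimes>\<^sub>o X" "trg f = Y"
  shows "Arrow Z (alpha_inv C (mor e) D X Y \<cdot> transp C Z X Y (mor f)) (Y \<otimes>\<^sub>o D) = lft D X c Z f"
proof -
  note s = dualpair_simps [OF d]
  let ?A = "TRP (Y \<otimes>\<^sub>o D) X Y (CR e Y D X)" and ?B = "lft D X c (IHom C X Y) (EV X Y)"
    and ?h = "TRP Z X Y f"
  note A = TRP [of "CR e Y D X" "Y \<otimes>\<^sub>o D" X Y, simplified s contr_simps ar_contr, simplified]
  note h = TRP [OF f] and B = lft_simps [OF d, of "EV X Y" "IHom C X Y", simplified]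
    CR_lft [OF d, of "EV X Y" "IHom C X Y" Y, simplified]
  have AB: "?A \<bullet> ?B = ID (IHom C X Y)"
  proof (rule transp_eqI)
    have "EV X Y \<bullet> ((?A \<bullet> ?B) \<boxtimes> ID X) = (EV X Y \<bullet> (?A \<boxtimes> ID X)) \<bullet> (?B \<boxtimes> ID X)"
      using s A(1-3) B(1-3) by (simp add: tens_ID_cmp(2) [symmetric] cmp_assoc)
    then show "EV X Y \<bullet> ((?A \<bullet> ?B) \<boxtimes> ID X) = EV X Y \<bullet> (ID (IHom C X Y) \<boxtimes> ID X)"
      using A B s by simp
  qed (use A B s in simp_all)
  have BA: "?B \<bullet> ?A = ID (Y \<otimes>\<^sub>o D)"
  proof (rule CR_cancel [OF d])
    have "CR e Y D X \<bullet> ((?B \<bullet> ?A) \<boxtimes> ID X) = (CR e Y D X \<bullet> (?B \<boxtimes> ID X)) \<bullet> (?A \<boxtimes> ID X)"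
      using s A(1-3) B(1-3) by (simp add: tens_ID_cmp(2) [symmetric] cmp_assoc)
    then show "CR e Y D X \<bullet> ((?B \<bullet> ?A) \<boxtimes> ID X) = CR e Y D X \<bullet> (ID (Y \<otimes>\<^sub>o D) \<boxtimes> ID X)"
      using A B s by simp
  qed (use A B s in simp_all)
  have "inverses ?A ?B" using AB BA A B s by (simp add: inverses_def)
  then have "alpha_inv C (mor e) D X Y = mor ?B"
    unfolding alpha_inv_def alpha_def TRP_def CR_def arrow.sel by (rule inverse_mor_Arrow)
  then have "Arrow Z (alpha_inv C (mor e) D X Y \<cdot> transp C Z X Y (mor f)) (Y \<otimes>\<^sub>o D) = ?B \<bullet> ?h"
    using B h by (simp add: cmp_def TRP_def)
  also have "\<dots> = lft D X c Z f"
  proof (rule CR_cancel [OF d])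
    have "CR e Y D X \<bullet> ((?B \<bullet> ?h) \<boxtimes> ID X) = (CR e Y D X \<bullet> (?B \<boxtimes> ID X)) \<bullet> (?h \<boxtimes> ID X)"
      using s h(1-3) B(1-3) by (simp add: tens_ID_cmp(2) [symmetric] cmp_assoc)
    then show "CR e Y D X \<bullet> ((?B \<bullet> ?h) \<boxtimes> ID X) = CR e Y D X \<bullet> (lft D X c Z f \<boxtimes> ID X)"
      using h B s f by (simp add: CR_lft [OF d])
  qed (use h B s f in \<open>simp_all add: lft_simps [OF d]\<close>)
  finally show ?thesis .
qed

text \<open>Nondegeneracy: joining a coevaluation to the form that \<open>f\<close> defines recovers
  \<open>f\<close>.\<close>

lemma pairing_cancel_right:
  assumes d: "dualpair D X e c" and f: "ar f" "src f = Z" "trg f = X" "ar g" "src g = Z" "trg g = X"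
    and eq: "e \<bullet> (ID D \<boxtimes> f) = e \<bullet> (ID D \<boxtimes> g)"
  shows "f = g"
proof -
  note s = dualpair_simps [OF d]
  have *: "CR e X D X \<bullet> (ID (X \<otimes>\<^sub>o D) \<boxtimes> h) = RU X \<bullet> (ID X \<boxtimes> (e \<bullet> (ID D \<boxtimes> h))) \<bullet> ASS X D Z"
    if "ar h" "src h = Z" "trg h = X" for h
    by (rule arrow_eqI3l) (simp_all add: s that)
  have **: "CR e X D X \<bullet> (ID (X \<otimes>\<^sub>o D) \<boxtimes> f) = CR e X D X \<bullet> (ID (X \<otimes>\<^sub>o D) \<boxtimes> g)"
    using * f eq by simp
  show ?thesis
  proof (rule arrow_eqI1 [where X = Z])
    fix L x assume a: "wires L [(x, Z)]"
    have "ap (CR e X D X \<bullet> (ID (X \<otimes>\<^sub>o D) \<boxtimes> f)) (pair (ap c (star L)) x)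
        = ap (CR e X D X \<bullet> (ID (X \<otimes>\<^sub>o D) \<boxtimes> g)) (pair (ap c (star L)) x)"
      unfolding ** ..
    then show "ap f x = ap g x" using a by (simp add: s f ap_CR_coev [OF d])
  qed (simp_all add: f)
qed

lemma pairing_cancel_left:
  assumes d: "dualpair D X e c" and f: "ar f" "src f = Z" "trg f = D" "ar g" "src g = Z" "trg g = D"
    and eq: "e \<bullet> (f \<boxtimes> ID X) = e \<bullet> (g \<boxtimes> ID X)"
  shows "f = g"
proof -
  note s = dualpair_simps [OF d]
  have *: "CL e D X D \<bullet> (h \<boxtimes> ID (X \<otimes>\<^sub>o D)) = LU D \<bullet> ((e \<bullet> (h \<boxtimes> ID X)) \<boxtimes> ID D) \<bullet> ASSI Z X D"
    if "ar h" "src h = Z" "trg h = D" for h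
    by (rule arrow_eqI3r) (simp_all add: s that)
  have **: "CL e D X D \<bullet> (f \<boxtimes> ID (X \<otimes>\<^sub>o D)) = CL e D X D \<bullet> (g \<boxtimes> ID (X \<otimes>\<^sub>o D))"
    using * f eq by simp
  show ?thesis
  proof (rule arrow_eqI1 [where X = Z])
    fix L x assume a: "wires L [(x, Z)]"
    have "ap (CL e D X D \<bullet> (f \<boxtimes> ID (X \<otimes>\<^sub>o D))) (pair x (ap c (star L)))
        = ap (CL e D X D \<bullet> (g \<boxtimes> ID (X \<otimes>\<^sub>o D))) (pair x (ap c (star L)))"
      unfolding ** ..
    then show "ap f x = ap g x" using a by (simp add: s f ap_CL_coev [OF d])
  qed (simp_all add: f)
qed

text \<open>\<open>f'\<close> is the transpose of \<open>f\<close> along \<open>e\<close>; stated as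
  a relation, this involves no coevaluation.\<close>

definition adjoint where
  "adjoint e f' f \<longleftrightarrow> ar f \<and> ar f' \<and> e \<bullet> (f' \<boxtimes> ID (src f)) = e \<bullet> (ID (src f') \<boxtimes> f)"

text \<open>Sliding around the cup: closed up with the pairing, both sides become \<open>f\<close>
  on a strand that the zigzag straightens.\<close>

lemma coev_slide:
  assumes d: "dualpair D X e c" and a: "adjoint e f' f"
    and f: "src f = X" "trg f = X" "src f' = D" "trg f' = D"
  shows "(f \<boxtimes> ID D) \<bullet> c = (ID X \<boxtimes> f') \<bullet> c"
proof -
  note s = dualpair_simps [OF d]
  have ff: "ar f" "ar f'" and eq: "e \<bullet> (f' \<boxtimes> ID X) = e \<bullet> (ID D \<boxtimes> f)" using a f
      by (auto simp: adjoint_def)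
  have eq': "ap e (pair (ap f' d) x) = ap e (pair d (ap f x))"
    if "el d" "el x" "obj d = D" "obj x = X" "dj d x" for d x
    using arg_cong [OF eq, of "\<lambda>h. ap h (pair d x)"] that s f ff by simp
  have 1: "CR e X D X \<bullet> ((f \<boxtimes> ID D) \<boxtimes> ID X) = f \<bullet> CR e X D X"
    by (rule arrow_eqI3l) (simp_all add: s f ff)
  have 2: "CR e X D X \<bullet> ((ID X \<boxtimes> f') \<boxtimes> ID X) = CR e X D X \<bullet> (ID (X \<otimes>\<^sub>o D) \<boxtimes> f)"
    by (rule arrow_eqI3l) (simp_all add: s f ff eq')
  show ?thesis
  proof (rule CR_cancel [OF d])
    show "CR e X D X \<bullet> (((f \<boxtimes> ID D) \<bullet> c) \<boxtimes> ID X) = CR e X D X \<bullet> (((ID X \<boxtimes> f') \<bullet> c) \<boxtimes> ID X)" (is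
        "?l = ?r")
    proof (rule arrow_eqI2 [where X = \<I> and Y = X])
      fix L x y assume b: "wires L [(x, \<I>), (y, X)]"
      have "ap (CR e X D X \<bullet> ((f \<boxtimes> ID D) \<boxtimes> ID X)) (pair (ap c x) y)
          = ap (CR e X D X \<bullet> ((ID X \<boxtimes> f') \<boxtimes> ID X)) (pair (ap c x) y)"
        unfolding 1 2 using b by (simp add: s f ff ap_CR_coev [OF d])
      then show "ap ?l (pair x y) =
         ap ?r (pair x y)"
        using b by (simp add: s f ff)
    qed (simp_all add: s f ff)
  qed (simp_all add: s f ff)
qed

definition "tens_coev X D c X' D' c' = XCH X D X' D' \<bullet> (c \<boxtimes> c') \<bullet> LUI \<I>"

lemma dualpair_tens:
  assumes d: "dualpair D X e c" and d': "dualpair D' X' e' c'"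
  shows "dualpair (D \<otimes>\<^sub>o D') (X \<otimes>\<^sub>o X') (C1324 e e' D D' X X') (tens_coev X D c X' D' c')"
proof -
  note s = dualpair_simps [OF d] dualpair_simps [OF d']
  let ?E = "C1324 e e' D D' X X'" and ?c = "tens_coev X D c X' D' c'"
  have c: "ar ?c" "src ?c = \<I>" "trg ?c = (X \<otimes>\<^sub>o X') \<otimes>\<^sub>o (D \<otimes>\<^sub>o D')"
      by (simp_all add: tens_coev_def s)
  have 1: "CR ?E (X \<otimes>\<^sub>o X') (D \<otimes>\<^sub>o D') (X \<otimes>\<^sub>o X') \<bullet> (XCH X D X' D' \<boxtimes> ID (X \<otimes>\<^sub>o X'))
      = (CR e X D X \<boxtimes> CR e' X' D' X') \<bullet> XCH (X \<otimes>\<^sub>o D) (X' \<otimes>\<^sub>o D') X X'"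
    by (rule arrow_eqI6l) (simp_all add: s smul_ac)
  have 2: "CL ?E (D \<otimes>\<^sub>o D') (X \<otimes>\<^sub>o X') (D \<otimes>\<^sub>o D') \<bullet> (ID (D \<otimes>\<^sub>o D') \<boxtimes> XCH X D X' D')
      = (CL e D X D \<boxtimes> CL e' D' X' D') \<bullet> XCH D D' (X \<otimes>\<^sub>o D) (X' \<otimes>\<^sub>o D')"
    by (rule arrow_eqI6r) (simp_all add: s smul_ac)
  have 3: "CR ?E (X \<otimes>\<^sub>o X') (D \<otimes>\<^sub>o D') (X \<otimes>\<^sub>o X') \<bullet> (?c \<boxtimes> ID (X \<otimes>\<^sub>o X')) = LU (X \<otimes>\<^sub>o X')"
  proof (rule arrow_eqI3r [where X = \<I> and Y = X and Z = X'])
    fix L x y z assume a: "wires L [(x, \<I>), (y, X), (z, X')]"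
    have "ap (CR ?E (X \<otimes>\<^sub>o X') (D \<otimes>\<^sub>o D') (X \<otimes>\<^sub>o X') \<bullet> (XCH X D X' D' \<boxtimes> ID (X \<otimes>\<^sub>o X')))
        (pair (pair (ap c (star L)) (ap c' x)) (pair y z)) = smul x (pair y z)"
      unfolding 1 using a by (simp add: s ap_CR_coev [OF d] ap_CR_coev [OF d'])
    then show "ap (CR ?E (X \<otimes>\<^sub>o X') (D \<otimes>\<^sub>o D') (X \<otimes>\<^sub>o X') \<bullet> (?c \<boxtimes> ID (X \<otimes>\<^sub>o X'))) (pair x (pair y
        z))
        = ap (LU (X \<otimes>\<^sub>o X')) (pair x (pair y z))"
      using a by (simp add: s tens_coev_def)
  qed (simp_all add: s c)
  have 4: "CL ?E (D \<otimes>\<^sub>o D') (X \<otimes>\<^sub>o X') (D \<otimes>\<^sub>o D') \<bullet> (ID (D \<otimes>\<^sub>o D') \<boxtimes> ?c) = RU (D \<otimes>\<^sub>o D')"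
  proof (rule arrow_eqI3l [where X = D and Y = D' and Z = \<I>])
    fix L x y z assume a: "wires L [(x, D), (y, D'), (z, \<I>)]"
    have "ap (CL ?E (D \<otimes>\<^sub>o D') (X \<otimes>\<^sub>o X') (D \<otimes>\<^sub>o D') \<bullet> (ID (D \<otimes>\<^sub>o D') \<boxtimes> XCH X D X' D'))
        (pair (pair x y) (pair (ap c (star L)) (ap c' z))) = smul z (pair x y)"
      unfolding 2 using a by (simp add: s ap_CL_coev [OF d] ap_CL_coev [OF d'])
    then show "ap (CL ?E (D \<otimes>\<^sub>o D') (X \<otimes>\<^sub>o X') (D \<otimes>\<^sub>o D') \<bullet> (ID (D \<otimes>\<^sub>o D') \<boxtimes> ?c)) (pair (pair x y)
        z)
        = ap (RU (D \<otimes>\<^sub>o D')) (pair (pair x y) z)"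
      using a by (simp add: s tens_coev_def)
  qed (simp_all add: s c)
  show ?thesis using c 3 4 by (simp add: dualpair_def s)
qed

text \<open>The idempotents \<open>i \<bullet> p\<close> and \<open>i' \<bullet> p'\<close> are
  transposed to each other. Either of them may therefore be moved to the other side of the pairing,
  where it is the identity on the image, and the zigzags of \<open>X\<close> and \<open>D\<close>
  restrict to the retracts.\<close>

lemma dualpair_retract:
  assumes d: "dualpair D X e c" and a: "adjoint e (i' \<bullet> p') (i \<bullet> p)"
    and i: "ar i" "src i = S" "trg i = X" and p: "ar p" "src p = X" "trg p = S" "p \<bullet> i = ID S"
    and i': "ar i'" "src i' = S'" "trg i' = D" and p': "ar p'" "src p' = D" "trg p' = S'"
        "p' \<bullet> i' = ID S'"
  shows "dualpair S' S (e \<bullet> (i' \<boxtimes> i)) ((p \<boxtimes> p') \<bullet> c)"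
proof -
  note s = dualpair_simps [OF d] i(1-3) p(1-3) i'(1-3) p'(1-3)
  let ?e = "e \<bullet> (i' \<boxtimes> i)"
  have e: "bil ?e S' S" by (simp add: bil_def s)
  have pi: "ap p (ap i x) = x" if "el x" "obj x = S" for x
    using arg_cong [OF p(4), of "\<lambda>h. ap h x"] that by (simp add: s)
  have pi': "ap p' (ap i' x) = x" if "el x" "obj x = S'" for x
    using arg_cong [OF p'(4), of "\<lambda>h. ap h x"] that by (simp add: s)
  have eq: "ap e (pair (ap i' (ap p' d)) x) = ap e (pair d (ap i (ap p x)))"
    if "el d" "el x" "obj d = D" "obj x = X" "dj d x" for d x
  proof -
    have "e \<bullet> ((i' \<bullet> p') \<boxtimes> ID X) = e \<bullet> (ID D \<boxtimes> (i \<bullet> p))" using a by (simp add: adjoint_def s)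
    from arg_cong [OF this, of "\<lambda>h. ap h (pair d x)"] show ?thesis using that by (simp add: s)
  qed
  have eq1: "ap e (pair (ap i' (ap p' d)) (ap i x)) = ap e (pair d (ap i x))"
    if "el d" "el x" "obj d = D" "obj x = S" "dj d x" for d x
    using that by (simp add: s eq pi)
  have eq2: "ap e (pair (ap i' d) (ap i (ap p x))) = ap e (pair (ap i' d) x)"
    if "el d" "el x" "obj d = S'" "obj x = X" "dj d x" for d x
    using that by (simp add: s eq [symmetric] pi')
  have 1: "CR ?e S S' S \<bullet> ((p \<boxtimes> p') \<boxtimes> ID S) = p \<bullet> CR e X D X \<bullet> (ID (X \<otimes>\<^sub>o D) \<boxtimes> i)"
    by (rule arrow_eqI3l) (simp_all add: s e eq1)
  have 2: "CL ?e S' S S' \<bullet> (ID S' \<boxtimes> (p \<boxtimes> p')) = p' \<bullet> CL e D X D \<bullet> (i' \<boxtimes> ID (X \<otimes>\<^sub>o D))"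
    by (rule arrow_eqI3r) (simp_all add: s e eq2)
  have 3: "CR ?e S S' S \<bullet> (((p \<boxtimes> p') \<bullet> c) \<boxtimes> ID S) = LU S"
  proof (rule arrow_eqI2 [where X = \<I> and Y = S])
    fix L x y assume b: "wires L [(x, \<I>), (y, S)]"
    have "ap (CR ?e S S' S \<bullet> ((p \<boxtimes> p') \<boxtimes> ID S)) (pair (ap c x) y) = smul x y"
      unfolding 1 using b by (simp add: s ap_CR_coev [OF d] pi)
    then show "ap (CR ?e S S' S \<bullet> (((p \<boxtimes> p') \<bullet> c) \<boxtimes> ID S)) (pair x y) = ap (LU S) (pair x y)"
      using b by (simp add: s e)
  qed (simp_all add: s e)
  have 4: "CL ?e S' S S' \<bullet> (ID S' \<boxtimes> ((p \<boxtimes> p') \<bullet> c)) = RU S'"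
  proof (rule arrow_eqI2 [where X = S' and Y = \<I>])
    fix L x y assume b: "wires L [(x, S'), (y, \<I>)]"
    have "ap (CL ?e S' S S' \<bullet> (ID S' \<boxtimes> (p \<boxtimes> p'))) (pair x (ap c y)) = smul y x"
      unfolding 2 using b by (simp add: s ap_CL_coev [OF d] pi')
    then show "ap (CL ?e S' S S' \<bullet> (ID S' \<boxtimes> ((p \<boxtimes> p') \<bullet> c))) (pair x y) = ap (RU S') (pair x y)"
      using b by (simp add: s e)
  qed (simp_all add: s e)
  show ?thesis using 3 4 e by (simp add: dualpair_def s)
qed

text \<open>For an internal hom the second triangle identity is automatic: by
  \<open>transp_eqI\<close> arrows into \<open>IHom C X \<I>\<close> may be compared after
  evaluation, where the first identity applies.\<close>

lemma dualpair_EVI: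
  assumes c: "ar c" "src c = \<I>" "trg c = X \<otimes>\<^sub>o IHom C X \<I>"
    and z: "CR (EV X \<I>) X (IHom C X \<I>) X \<bullet> (c \<boxtimes> ID X) = LU X"
  shows "dualpair (IHom C X \<I>) X (EV X \<I>) c"
proof -
  let ?D = "IHom C X \<I>" and ?e = "EV X \<I>"
  have e: "bil ?e ?D X" by (simp add: bil_def)
  have *: "?e \<bullet> (CL ?e ?D X ?D \<boxtimes> ID X) = ?e \<bullet> (ID ?D \<boxtimes> CR ?e X ?D X) \<bullet> ASS ?D (X \<otimes>\<^sub>o ?D) X"
    by (rule arrow_eqI4l) (simp_all add: e smul_ac)
  have "CL ?e ?D X ?D \<bullet> (ID ?D \<boxtimes> c) = RU ?D"
  proof (rule transp_eqI)
    show "?e \<bullet> ((CL ?e ?D X ?D \<bullet> (ID ?D \<boxtimes> c)) \<boxtimes> ID X) = ?e \<bullet> (RU ?D \<boxtimes> ID X)" (is "?l = ?r")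
    proof (rule arrow_eqI3l [where X = ?D and Y = \<I> and Z = X])
      fix L x y z assume a: "wires L [(x, ?D), (y, \<I>), (z, X)]"
      have zz: "ap (CR ?e X ?D X) (pair (ap c y) z) = smul y z"
        using arg_cong [OF z, of "\<lambda>h. ap h (pair y z)"] a by (simp add: c e)
      have "ap (?e \<bullet> (CL ?e ?D X ?D \<boxtimes> ID X)) (pair (pair x (ap c y)) z) = smul y (ap ?e (pair x z))"
        unfolding * using a by (simp add: c e zz)
      then show "ap ?l (pair (pair x y) z)
          = ap ?r (pair (pair x y) z)"
        using a by (simp add: c e)
    qed (simp_all add: c e)
  qed (simp_all add: c e)
  then show ?thesis using c z e by (simp add: dualpair_def)
qed

end

section \<open>Coevaluations from rigidity\<close>

context rigid_tensor_category
begin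

text \<open>For the pairs \<open>(\<I>, X)\<close> and \<open>(X, \<I>)\<close> the rigidity
  isomorphism is, up to unit factors, the canonical arrow from \<open>X\<close> tensored with its
  dual to the endomorphism object of \<open>X\<close>. The coevaluation is the preimage of the
  identity.\<close>

lemma ex_coev: "\<exists>c. dualpair (IHom C X \<I>) X (EV X \<I>) c"
proof -
  let ?D = "IHom C X \<I>" and ?e = "EV X \<I>" and ?H = "IHom C \<I> X" and ?f = "EV \<I> X"
  let ?Ps = "[(\<I>, X), (X, \<I>)]"
  let ?A = "?H \<otimes>\<^sub>o (?D \<otimes>\<^sub>o \<I>)" and ?B = "\<I> \<otimes>\<^sub>o (X \<otimes>\<^sub>o \<I>)" and ?Y = "X \<otimes>\<^sub>o (\<I> \<otimes>\<^sub>o \<I>)"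
  let ?F = "(?f \<boxtimes> ((?e \<boxtimes> LU \<I>) \<bullet> XCH ?D \<I> X \<I>)) \<bullet> XCH ?H (?D \<otimes>\<^sub>o \<I>) \<I> (X \<otimes>\<^sub>o \<I>)"
  let ?T = "TRP ?A ?B ?Y ?F"
  note T = TRP [of ?F ?A ?B ?Y, simplified]
  have F: "mor ?F = eval_list C ?Ps" by (simp add: EV_def XCH_def LU_def)
  have "is_iso C ?A (IHom C ?B ?Y) (mor ?T)"
    using tens_hom_mor_iso [of ?Ps] F by (simp add: tens_hom_mor_def TRP_def)
  then obtain k where k: "is_inverse C ?A (IHom C ?B ?Y) (mor ?T) k" by (auto simp: is_iso_def)
  let ?K = "Arrow (IHom C ?B ?Y) k ?A"
  have "inverses (Arrow ?A (mor ?T) (IHom C ?B ?Y)) ?K" using k by (simp add: inverses_Arrow)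
  then have TK: "inverses ?T ?K" by (simp add: TRP_def)
  \<comment> \<open>The identity of \<open>X\<close>, dressed with the unit factors that
    \<open>tens_list\<close> and the two pairs produce.\<close>
  let ?g = "RUI (X \<otimes>\<^sub>o \<I>) \<bullet> LU (X \<otimes>\<^sub>o \<I>) \<bullet> LU ?B"
  let ?g' = "ASS X \<I> \<I> \<bullet> ?g"
  let ?u = "TRP \<I> ?B ?Y ?g'"
  note u = TRP [of ?g' \<I> ?B ?Y, simplified]
  let ?w = "?K \<bullet> ?u"
  have K: "ar ?K" "src ?K = IHom C ?B ?Y" "trg ?K = ?A" using k by (simp_all add: is_inverse_def)
  have w: "ar ?w" "src ?w = \<I>" "trg ?w = ?A" using K u by simp_all
  have "?T \<bullet> ?w = ?u"
  proof -
    have "?T \<bullet> ?w = (?T \<bullet> ?K) \<bullet> ?u" using K u T(1-3) by (simp add: cmp_assoc)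
    also have "\<dots> = ?u" using TK u T(1-3) by (simp add: inverses_def)
    finally show ?thesis .
  qed
  then have Tw: "(?T \<boxtimes> ID ?B) \<bullet> (?w \<boxtimes> ID ?B) = ?u \<boxtimes> ID ?B"
    using w T(1-3) by (subst tens_ID_cmp(2)) simp_all
  have Fw: "?F \<bullet> (?w \<boxtimes> ID ?B) = ?g'"
  proof -
    have "?F \<bullet> (?w \<boxtimes> ID ?B) = (EV ?B ?Y \<bullet> (?T \<boxtimes> ID ?B)) \<bullet> (?w \<boxtimes> ID ?B)" unfolding T(4) ..
    also have "\<dots> = EV ?B ?Y \<bullet> (?T \<boxtimes> ID ?B) \<bullet> (?w \<boxtimes> ID ?B)"
        by (rule cmp_assoc) (use w T(1-3) in simp_all)
    also have "\<dots> = ?g'" unfolding Tw u(4) ..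
    finally show ?thesis .
  qed
  \<comment> \<open>\<open>?f \<bullet> RUI ?H\<close> evaluates an arrow out of the unit at the
    unit and so passes from \<open>IHom C \<I> X\<close> to \<open>X\<close>.\<close>
  let ?c = "((?f \<bullet> RUI ?H) \<boxtimes> RU ?D) \<bullet> ?w"
  have c: "ar ?c" "src ?c = \<I>" "trg ?c = X \<otimes>\<^sub>o ?D" using w by simp_all
  have e: "bil ?e ?D X" by (simp add: bil_def)
  have *: "CR ?e X ?D X \<bullet> (((?f \<bullet> RUI ?H) \<boxtimes> RU ?D) \<boxtimes> ID X)
      = RU X \<bullet> (ID X \<boxtimes> LU \<I>) \<bullet> ?F \<bullet> (ID ?A \<boxtimes> (LUI (X \<otimes>\<^sub>o \<I>) \<bullet> RUI X))"
    by (rule arrow_eqI4l) (simp_all add: e smul_ac)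
  have "CR ?e X ?D X \<bullet> (?c \<boxtimes> ID X) = LU X" (is "?l = _")
  proof (rule arrow_eqI2 [where X = \<I> and Y = X])
    fix L x y assume b: "wires L [(x, \<I>), (y, X)]"
    let ?z = "pair (star L) (pair y (star L))"
    have Fw': "ap ?F (pair (ap ?w x) ?z) = ap ?g' (pair x ?z)"
      using arg_cong [OF Fw, of "\<lambda>h. ap h (pair x ?z)"] b w by simp
    have "ap (CR ?e X ?D X \<bullet> (((?f \<bullet> RUI ?H) \<boxtimes> RU ?D) \<boxtimes> ID X)) (pair (ap ?w x) y) = smul x y"
      unfolding * using b w Fw' by simp
    then show "ap ?l (pair x y) = ap (LU X) (pair x y)"
      using b w by (simp add: e)
  qed (use c e in simp_all)
  from dualpair_EVI [OF c this] show ?thesis by blast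
qed

end

context linear_category
begin

section \<open>The symmetrizer\<close>

lemma rat_ring_simps [simp]: "carrier rat_ring = UNIV" "x \<oplus>\<^bsub>rat_ring\<^esub> y = x + y"
    "x \<otimes>\<^bsub>rat_ring\<^esub> y = x * y" "\<one>\<^bsub>rat_ring\<^esub> = 1" "\<zero>\<^bsub>rat_ring\<^esub> = 0"
  by (simp_all add: rat_ring_def)

lemma Mor_abelian_group: "abelian_group (Mor C X Y)"
  using Mor_module by (rule module.axioms)

lemma Mor_smult_closed: "f \<in> Hom C X Y \<Longrightarrow> q \<odot>\<^bsub>Mor C X Y\<^esub> f \<in> Hom C X Y"
  using module.smult_closed [OF Mor_module] by simp

lemma Mor_add_closed:
  "\<lbrakk>f \<in> Hom C X Y; g \<in> Hom C X Y\<rbrakk> \<Longrightarrow> f \<oplus>\<^bsub>Mor C X Y\<^esub> g \<in> Hom C X Y"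
  by (rule abelian_monoid.a_closed [OF abelian_group.axioms(1) [OF Mor_abelian_group]])

lemma Mor_smult_smult: "f \<in> Hom C X Y \<Longrightarrow> q \<odot>\<^bsub>Mor C X Y\<^esub> (q' \<odot>\<^bsub>Mor C X Y\<^esub> f)
    = (q * q') \<odot>\<^bsub>Mor C X Y\<^esub> f"
  using module.smult_assoc1 [OF Mor_module, of q q' f] by simp

lemma Mor_smult_add: "f \<in> Hom C X Y \<Longrightarrow>
    (q \<odot>\<^bsub>Mor C X Y\<^esub> f) \<oplus>\<^bsub>Mor C X Y\<^esub> (q' \<odot>\<^bsub>Mor C X Y\<^esub> f) = (q + q') \<odot>\<^bsub>Mor C X Y\<^esub> f"
  using module.smult_l_distr [OF Mor_module, of q q' f] by simp

lemma Mor_smult_distrib: "\<lbrakk>f \<in> Hom C X Y; g \<in> Hom C X Y\<rbrakk> \<Longrightarrow>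
    q \<odot>\<^bsub>Mor C X Y\<^esub> (f \<oplus>\<^bsub>Mor C X Y\<^esub> g) = (q \<odot>\<^bsub>Mor C X Y\<^esub> f) \<oplus>\<^bsub>Mor C X Y\<^esub> (q \<odot>\<^bsub>Mor C X Y\<^esub> g)"
  using module.smult_r_distr [OF Mor_module, where a = q and x = f and y = g] by simp

lemma Mor_smult_one: "f \<in> Hom C X Y \<Longrightarrow> 1 \<odot>\<^bsub>Mor C X Y\<^esub> f = f"
  using module.smult_one [OF Mor_module, of f] by simp

lemma Mor_add_ac:
  "\<lbrakk>f \<in> Hom C X Y; g \<in> Hom C X Y; h \<in> Hom C X Y\<rbrakk> \<Longrightarrow>
    (f \<oplus>\<^bsub>Mor C X Y\<^esub> g) \<oplus>\<^bsub>Mor C X Y\<^esub> h = f \<oplus>\<^bsub>Mor C X Y\<^esub> (g \<oplus>\<^bsub>Mor C X Y\<^esub> h)"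
  "\<lbrakk>f \<in> Hom C X Y; g \<in> Hom C X Y\<rbrakk> \<Longrightarrow> f \<oplus>\<^bsub>Mor C X Y\<^esub> g = g \<oplus>\<^bsub>Mor C X Y\<^esub> f"
  "\<lbrakk>f \<in> Hom C X Y; g \<in> Hom C X Y; h \<in> Hom C X Y\<rbrakk> \<Longrightarrow>
    f \<oplus>\<^bsub>Mor C X Y\<^esub> (g \<oplus>\<^bsub>Mor C X Y\<^esub> h) = g \<oplus>\<^bsub>Mor C X Y\<^esub> (f \<oplus>\<^bsub>Mor C X Y\<^esub> h)"
proof -
  interpret abelian_group "Mor C X Y" by (rule Mor_abelian_group)
  show "\<lbrakk>f \<in> Hom C X Y; g \<in> Hom C X Y; h \<in> Hom C X Y\<rbrakk> \<Longrightarrow>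
    (f \<oplus>\<^bsub>Mor C X Y\<^esub> g) \<oplus>\<^bsub>Mor C X Y\<^esub> h = f \<oplus>\<^bsub>Mor C X Y\<^esub> (g \<oplus>\<^bsub>Mor C X Y\<^esub> h)"
  "\<lbrakk>f \<in> Hom C X Y; g \<in> Hom C X Y\<rbrakk> \<Longrightarrow> f \<oplus>\<^bsub>Mor C X Y\<^esub> g = g \<oplus>\<^bsub>Mor C X Y\<^esub> f"
  "\<lbrakk>f \<in> Hom C X Y; g \<in> Hom C X Y; h \<in> Hom C X Y\<rbrakk> \<Longrightarrow>
    f \<oplus>\<^bsub>Mor C X Y\<^esub> (g \<oplus>\<^bsub>Mor C X Y\<^esub> h) = g \<oplus>\<^bsub>Mor C X Y\<^esub> (f \<oplus>\<^bsub>Mor C X Y\<^esub> h)"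
    by (auto simp: a_ac)
qed

lemma Mor_zero_closed: "\<zero>\<^bsub>Mor C X Y\<^esub> \<in> Hom C X Y"
  by (rule abelian_monoid.zero_closed [OF abelian_group.axioms(1) [OF Mor_abelian_group]])

lemma Mor_smult_zero_left: "f \<in> Hom C X Y \<Longrightarrow> 0 \<odot>\<^bsub>Mor C X Y\<^esub> f = \<zero>\<^bsub>Mor C X Y\<^esub>"
  using module.smult_l_null [OF Mor_module, of f] by simp

lemma Mor_smult_zero_right: "q \<odot>\<^bsub>Mor C X Y\<^esub> \<zero>\<^bsub>Mor C X Y\<^esub> = \<zero>\<^bsub>Mor C X Y\<^esub>"
  using module.smult_r_null [OF Mor_module, of q] by simp

lemma Comp_zero_left: assumes "f \<in> Hom C X Y" shows "\<zero>\<^bsub>Mor C Y Z\<^esub> \<cdot> f = \<zero>\<^bsub>Mor C X Z\<^esub>"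
  using Comp_smult_left [OF Mor_zero_closed [of Y Z] assms, of 0] assms
    Comp_closed [OF Mor_zero_closed [of Y Z] assms]
  by (simp add: Mor_smult_zero_left Mor_smult_zero_right)

lemma Comp_zero_right: assumes "f \<in> Hom C Y Z" shows "f \<cdot> \<zero>\<^bsub>Mor C X Y\<^esub> = \<zero>\<^bsub>Mor C X Z\<^esub>"
  using Comp_smult_right [OF assms Mor_zero_closed [of X Y], of 0] assms
    Comp_closed [OF assms Mor_zero_closed [of X Y]]
  by (simp add: Mor_smult_zero_left Mor_smult_zero_right)

lemma finsum_Comp_left:
  assumes "finite A" "h \<in> Hom C X Y" "\<And>a. a \<in> A \<Longrightarrow> f a \<in> Hom C Y Z"
  shows "finsum (Mor C Y Z) f A \<cdot> h = finsum (Mor C X Z) (\<lambda>a. f a \<cdot> h) A"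
proof -
  interpret YZ: abelian_group "Mor C Y Z" by (rule Mor_abelian_group)
  interpret XZ: abelian_group "Mor C X Z" by (rule Mor_abelian_group)
  show ?thesis using assms
  proof (induction rule: finite_induct)
    case (insert a A)
    have c: "f \<in> A \<rightarrow> Hom C Y Z" "f a \<in> Hom C Y Z" "(\<lambda>a. f a \<cdot> h) \<in> A \<rightarrow> Hom C X Z"
        "f a \<cdot> h \<in> Hom C X Z"
      using insert by (auto intro: Comp_closed)
    show ?case using insert c
      by (simp add: YZ.finsum_insert XZ.finsum_insert Comp_add_left [of _ Y Z _ h X]
          YZ.finsum_closed)
  qed (simp add: Comp_zero_left)
qed

lemma finsum_Comp_right:
  assumes "finite A" "h \<in> Hom C Y Z" "\<And>a. a \<in> A \<Longrightarrow> f a \<in> Hom C X Y"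
  shows "h \<cdot> finsum (Mor C X Y) f A = finsum (Mor C X Z) (\<lambda>a. h \<cdot> f a) A"
proof -
  interpret XY: abelian_group "Mor C X Y" by (rule Mor_abelian_group)
  interpret XZ: abelian_group "Mor C X Z" by (rule Mor_abelian_group)
  show ?thesis using assms
  proof (induction rule: finite_induct)
    case (insert a A)
    have c: "f \<in> A \<rightarrow> Hom C X Y" "f a \<in> Hom C X Y" "(\<lambda>a. h \<cdot> f a) \<in> A \<rightarrow> Hom C X Z"
        "h \<cdot> f a \<in> Hom C X Z"
      using insert by (auto intro: Comp_closed)
    show ?case using insert c
      by (simp add: XY.finsum_insert XZ.finsum_insert Comp_add_right [of h Y Z _ X]
          XY.finsum_closed)
  qed (simp add: Comp_zero_right)
qed

text \<open>All later sums are combinations of two arrows, so one rule each suffices for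
  composition, tensor products and partial traces. Finite sums of morphisms occur only on the way to
  the recursion for the symmetrizer.\<close>

definition lin where
  "lin q f q' g = Arrow (src f)
     (q \<odot>\<^bsub>Mor C (src f) (trg f)\<^esub> mor f \<oplus>\<^bsub>Mor C (src f) (trg f)\<^esub> q' \<odot>\<^bsub>Mor C (src f) (trg f)\<^esub> mor g)
         (trg f)"

lemma lin_simps [simp]: "src (lin q f q' g) = src f" "trg (lin q f q' g) = trg f"
  by (simp_all add: lin_def)

lemma ar_lin [simp]: "\<lbrakk>ar f; ar g; src g = src f; trg g = trg f\<rbrakk> \<Longrightarrow> ar (lin q f q' g)"
  by (simp add: ar_def lin_def Mor_add_closed Mor_smult_closed)

lemma lin_cmp:
  "\<lbrakk>ar f; ar g; ar h; src g = src f; trg g = trg f; trg h = src f\<rbrakk> \<Longrightarrow> lin q f q' g \<bullet> h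
      = lin q (f \<bullet> h) q' (g \<bullet> h)"
  by (simp add: ar_def cmp_def lin_def Comp_add_left [where Y = "src f"] Comp_smult_left [where Y =
      "src f"] Mor_smult_closed)

lemma cmp_lin:
  "\<lbrakk>ar f; ar g; ar h; src g = src f; trg g = trg f; trg f = src h\<rbrakk> \<Longrightarrow> h \<bullet> lin q f q' g
      = lin q (h \<bullet> f) q' (h \<bullet> g)"
  by (simp add: ar_def cmp_def lin_def Comp_add_right [where Y = "src h"] Comp_smult_right [where Y
      = "src h"] Mor_smult_closed)

lemma lin_same:
  assumes "ar f" "q + q' = 1" shows "lin q f q' f = f"
  using assms by (cases f) (simp add: ar_def lin_def Mor_smult_add Mor_smult_one)

text \<open>The hypothesis makes the total coefficients of \<open>f\<close> and \<open>g\<close>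
  equal, so the two may trade places. This is how a transposition will be absorbed.\<close>

lemma lin_exchange:
  assumes "ar f" "ar g" "ar h" "src g = src f" "src h = src f" "trg g = trg f" "trg h = trg f"
      "a = a' * c"
  shows "lin a f a' (lin c g c' h) = lin a g a' (lin c f c' h)"
  using assms
  by (simp add: ar_def lin_def Mor_smult_distrib Mor_smult_smult Mor_smult_closed Mor_add_closed)
    (metis Mor_add_ac(3) Mor_smult_closed)

end

section \<open>Adjacent transpositions and moves to the front\<close>

context acu_tensor_category
begin

lemma lin_tens: "\<lbrakk>ar f; ar g; ar h; src g = src f; trg g = trg f\<rbrakk> \<Longrightarrow> lin q f q' g \<boxtimes> h
    = lin q (f \<boxtimes> h) q' (g \<boxtimes> h)"
  by (simp add: ar_def tens_def lin_def TensM_add_left [where X = "src f" and Y = "trg f"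
      and Z = "src h" and W = "trg h"]
      TensM_smult_left [where X = "src f" and Y = "trg f" and Z = "src h"
          and W = "trg h"] Mor_smult_closed)

lemma tens_lin: "\<lbrakk>ar f; ar g; ar h; src g = src f; trg g = trg f\<rbrakk> \<Longrightarrow> h \<boxtimes> lin q f q' g
    = lin q (h \<boxtimes> f) q' (h \<boxtimes> g)"
  by (simp add: ar_def tens_def lin_def TensM_add_right [where X = "src h" and Y = "trg h"
      and Z = "src f" and W = "trg f"]
      TensM_smult_right [where X = "src h" and Y = "trg h" and Z = "src f"
          and W = "trg f"] Mor_smult_closed)

lemma ap_cross [simp]:
  assumes "el x" "el a" "el b" "obj x = X" "obj a = A" "obj b = B" "dj x a" "dj x b" "dj a b"
  shows "ap (cross X A B) (pair x (pair a b)) = pair a (pair x b)"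
  using assms by (simp add: cross_def dj_sym [of x a])

lemma cross_cross: "cross A X B \<bullet> cross X A B = ID (X \<otimes>\<^sub>o (A \<otimes>\<^sub>o B))"
  by (rule arrow_eqI3r) simp_all

lemma cross_natural:
  "\<lbrakk>ar f; src f = A; trg f = B\<rbrakk> \<Longrightarrow> cross X Y B \<bullet> (ID X \<boxtimes> ID Y \<boxtimes> f) = (ID Y \<boxtimes> ID X \<boxtimes> f) \<bullet> cross X Y A"
  by (rule arrow_eqI3r) simp_all

text \<open>With \<open>cross_cross\<close> and the commutation of distant factors contained in
  \<open>cross_natural\<close> these are the Coxeter relations, all that the absorption proof needs
  to know of the symmetric group.\<close>

lemma cross_braid: "cross X X (X \<otimes>\<^sub>o B) \<bullet> (ID X \<boxtimes> cross X X B) \<bullet> cross X X (X \<otimes>\<^sub>o B)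
    = (ID X \<boxtimes> cross X X B) \<bullet> cross X X (X \<otimes>\<^sub>o B) \<bullet> (ID X \<boxtimes> cross X X B)"
  by (rule arrow_eqI4r) simp_all

definition "TF V n k = Arrow (tpow C (Suc n) V) (to_front C V n k) (tpow C (Suc n) V)"

lemma TF_simps [simp]: "src (TF V n k) = tpow C (Suc n) V" "trg (TF V n k) = tpow C (Suc n) V"
  by (simp_all add: TF_def)

lemma TF_0: "TF V n 0 = ID (tpow C (Suc n) V)"
  by (cases n) (simp_all add: TF_def ID_def)

lemma TF_Suc:
  assumes "ar (TF V n k)"
  shows "TF V (Suc n) (Suc k) = cross V V (tpow C n V) \<bullet> (ID V \<boxtimes> TF V n k)"
proof -
  have "TF V (Suc n) (Suc k) = ASS V V (tpow C n V) \<bullet> (SW V V \<boxtimes> ID (tpow C n V)) \<bullet>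
      ASSI V V (tpow C n V) \<bullet> (ID V \<boxtimes> TF V n k)"
    by (simp add: TF_def ASS_def ASSI_def SW_def ID_def tens_def cmp_def)
  also have "\<dots> = cross V V (tpow C n V) \<bullet> (ID V \<boxtimes> TF V n k)"
    using assms by (simp add: cross_def cmp_assoc)
  finally show ?thesis .
qed

lemma ar_TF [simp]: "k \<le> n \<Longrightarrow> ar (TF V n k)"
proof (induction n arbitrary: k)
  case 0
  then show ?case by (simp add: TF_0)
next
  case (Suc n)
  then show ?case by (cases k) (simp_all add: TF_0 TF_Suc)
qed

text \<open>\<open>bavg V n\<close> is the average of \<open>to_front V n k\<close> over \<open>k \<le> n\<close>.\<close>

primrec bavg where
  "bavg V 0 = ID (tpow C (Suc 0) V)"
| "bavg V (Suc n) = lin (1 / (of_nat n + 2)) (ID (tpow C (Suc (Suc n)) V))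
     ((of_nat n + 1) / (of_nat n + 2)) (cross V V (tpow C n V) \<bullet> (ID V \<boxtimes> bavg V n))"

lemma bavg_simps [simp]: "src (bavg V n) = tpow C (Suc n) V" "trg (bavg V n) = tpow C (Suc n) V"
    "ar (bavg V n)"
proof -
  have "src (bavg V n) = tpow C (Suc n) V \<and> trg (bavg V n) = tpow C (Suc n) V \<and> ar (bavg V n)"
    by (induction n) simp_all
  then show "src (bavg V n) = tpow C (Suc n) V" "trg (bavg V n) = tpow C (Suc n) V" "ar (bavg V n)"
      by auto
qed

lemma tensM_ID_closed: "f \<in> Hom C X Y \<Longrightarrow> \<^bold>1 V \<otimes>\<^sub>m f \<in> Hom C (V \<otimes>\<^sub>o X) (V \<otimes>\<^sub>o Y)"
  by (intro TensM_closed Ident_closed)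

lemma TensM_zero_right: "f \<in> Hom C X Y \<Longrightarrow> f \<otimes>\<^sub>m \<zero>\<^bsub>Mor C Z W\<^esub> = \<zero>\<^bsub>Mor C (X \<otimes>\<^sub>o Z) (Y \<otimes>\<^sub>o W)\<^esub>"
  using TensM_smult_right [OF _ Mor_zero_closed [of Z W], of f X Y 0] TensM_closed [OF _
      Mor_zero_closed [of Z W], of f X Y]
  by (simp add: Mor_smult_zero_left Mor_smult_zero_right Mor_zero_closed)

lemma finsum_TensM_right:
  assumes "finite A" "h \<in> Hom C X Y" "\<And>a. a \<in> A \<Longrightarrow> f a \<in> Hom C Z W"
  shows "h \<otimes>\<^sub>m finsum (Mor C Z W) f A = finsum (Mor C (X \<otimes>\<^sub>o Z) (Y \<otimes>\<^sub>o W)) (\<lambda>a. h \<otimes>\<^sub>m f a) A"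
proof -
  interpret ZW: abelian_group "Mor C Z W" by (rule Mor_abelian_group)
  interpret T: abelian_group "Mor C (X \<otimes>\<^sub>o Z) (Y \<otimes>\<^sub>o W)" by (rule Mor_abelian_group)
  show ?thesis using assms
  proof (induction rule: finite_induct)
    case (insert a A)
    have c: "f \<in> A \<rightarrow> Hom C Z W" "f a \<in> Hom C Z W" "(\<lambda>a. h \<otimes>\<^sub>m f a) \<in> A \<rightarrow> Hom C (X \<otimes>\<^sub>o Z) (Y \<otimes>\<^sub>o W)"
      "h \<otimes>\<^sub>m f a \<in> Hom C (X \<otimes>\<^sub>o Z) (Y \<otimes>\<^sub>o W)"
      using insert by (auto intro: TensM_closed)
    show ?case using insert c
      by (simp add: ZW.finsum_insert T.finsum_insert TensM_add_right [of h X Y _ Z W]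
          ZW.finsum_closed)
  qed (simp add: TensM_zero_right)
qed

lemma mor_TF: "mor (TF V n k) = to_front C V n k"
  by (simp add: TF_def)

lemma to_front_closed: "k \<le> n \<Longrightarrow> to_front C V n k \<in> Hom C (tpow C (Suc n) V) (tpow C (Suc n) V)"
  using ar_TF [of k n V] by (simp add: ar_def mor_TF)

text \<open>The term \<open>k = 0\<close> is the identity, and each further move is
  \<open>cross\<close> after a move on one strand fewer. This matches the recursion of
  \<open>bavg\<close>, whose weights undo the normalization.\<close>

lemma sum_to_front: "finsum (Mor C (tpow C (Suc n) V) (tpow C (Suc n) V)) (to_front C V n) {..n}
    = (of_nat n + 1) \<odot>\<^bsub>Mor C (tpow C (Suc n) V) (tpow C (Suc n) V)\<^esub> mor (bavg V n)"
proof (induction n)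
  case 0
  interpret M: abelian_group "Mor C (tpow C (Suc 0) V) (tpow C (Suc 0) V)"
      by (rule Mor_abelian_group)
  show ?case using to_front_closed [of 0 0 V] mor_TF [of V 0 0]
      M.finsum_0 [of "to_front C V 0"] by (simp add: Mor_smult_one TF_0 Pi_def del: M.finsum_0
          atMost_0)
next
  case (Suc n)
  let ?T = "tpow C (Suc (Suc n)) V" and ?S = "tpow C (Suc n) V"
  let ?M = "Mor C ?T ?T" and ?N = "Mor C ?S ?S"
  interpret M: abelian_group ?M by (rule Mor_abelian_group)
  interpret N: abelian_group ?N by (rule Mor_abelian_group)
  let ?X = "cross V V (tpow C n V)"
  have X: "mor ?X \<in> Hom C ?T ?T" using cross_simps(1) [of V V "tpow C n V"] by (simp add: ar_def)
  have b: "mor (bavg V n) \<in> Hom C ?S ?S" using bavg_simps [of V n]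
      by (simp add: ar_def del: bavg_simps)
  have tf: "to_front C V (Suc n) (Suc k) = mor ?X \<cdot> (\<^bold>1 V \<otimes>\<^sub>m to_front C V n k)" if "k \<le> n" for k
    using arg_cong [OF TF_Suc [of V n k], of mor] that by (simp add: mor_TF)
  have cl: "mor ?X \<cdot> (\<^bold>1 V \<otimes>\<^sub>m to_front C V n k) \<in> Hom C ?T ?T" if "k \<le> n" for k
    using to_front_closed [of "Suc k" "Suc n" V] that unfolding tf [OF that] by simp
  have cl1: "\<^bold>1 V \<otimes>\<^sub>m to_front C V n k \<in> Hom C ?T ?T" if "k \<le> n" for k
    using tensM_ID_closed [OF to_front_closed [OF that, of V], of V] by simp
  have t: "\<^bold>1 V \<otimes>\<^sub>m finsum ?N (to_front C V n) {..n}
      = finsum ?M (\<lambda>k. \<^bold>1 V \<otimes>\<^sub>m to_front C V n k) {..n}"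
    using finsum_TensM_right [OF finite_atMost Ident_closed [of V], of n "to_front C V n" ?S ?S]
      to_front_closed [of _ n V] by simp
  have "finsum ?M (to_front C V (Suc n)) {..Suc n}
      = finsum ?M (\<lambda>k. to_front C V (Suc n) (Suc k)) {..n} \<oplus>\<^bsub>?M\<^esub> to_front C V (Suc n) 0"
    by (rule M.finsum_Suc2) (use to_front_closed [of _ "Suc n" V] in auto)
  also have "finsum ?M (\<lambda>k. to_front C V (Suc n) (Suc k)) {..n}
      = finsum ?M (\<lambda>k. mor ?X \<cdot> (\<^bold>1 V \<otimes>\<^sub>m to_front C V n k)) {..n}"
    by (rule M.finsum_cong' [OF refl]) (use cl in \<open>auto simp: tf simp del: to_front.simps
        tpow.simps\<close>)
  also have "\<dots> = mor ?X \<cdot> (\<^bold>1 V \<otimes>\<^sub>m finsum ?N (to_front C V n) {..n})"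
    unfolding t by (rule finsum_Comp_right [OF _ X, symmetric]) (use cl1 in auto)
  also have "\<dots> = (of_nat n + 1) \<odot>\<^bsub>?M\<^esub> mor (?X \<bullet> (ID V \<boxtimes> bavg V n))"
    unfolding Suc.IH using b X
    by (simp add: TensM_smult_right [OF Ident_closed] tensM_ID_closed
        Comp_smult_right [where Y = "V \<otimes>\<^sub>o (V \<otimes>\<^sub>o tpow C n V)"])
  also have "to_front C V (Suc n) 0 = mor (ID ?T)" using mor_TF [of V "Suc n" 0] by (simp add: TF_0)
  finally have "finsum ?M (to_front C V (Suc n)) {..Suc n}
      = ((of_nat n + 1) \<odot>\<^bsub>?M\<^esub> mor (?X \<bullet> (ID V \<boxtimes> bavg V n))) \<oplus>\<^bsub>?M\<^esub> mor (ID ?T)" .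
  moreover have "mor (?X \<bullet> (ID V \<boxtimes> bavg V n)) \<in> Hom C ?T ?T"
    using b X by (auto intro: Comp_closed tensM_ID_closed)
  moreover have q: "(2 + of_nat n :: rat) / (of_nat n + 2) = 1" "(2 + of_nat n :: rat) * (of_nat n +
      1) / (of_nat n + 2) = of_nat n + 1"
    using of_nat_neq_0 [of "Suc n", where 'a = rat] by (simp_all add: add.commute)
  ultimately show ?case
    by (simp add: q lin_def Mor_smult_distrib Mor_smult_smult Mor_smult_closed Mor_add_ac(2)
        Mor_smult_one Ident_closed
        del: cmp_simps tens_simps)
qed

end

text \<open>The permutation with first value \<open>k\<close> that induces \<open>s\<close> in the recursion of \<open>perm_mor\<close>\<close>

definition ins_perm :: "nat \<Rightarrow> (nat \<Rightarrow> nat) \<Rightarrow> nat \<Rightarrow> nat" where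
  "ins_perm k s j = (case j of 0 \<Rightarrow> k | Suc i \<Rightarrow> if s i \<ge> k then Suc (s i) else s i)"

lemma ins_perm_permutes:
  assumes s: "s permutes {..<n}" and k: "k \<le> n"
  shows "ins_perm k s permutes {..<Suc n}"
proof (rule bij_imp_permutes)
  have inj: "inj (ins_perm k s)"
  proof (rule injI)
    fix a b assume "ins_perm k s a = ins_perm k s b"
    then show "a = b" 
      by (cases a; cases b) (auto simp: ins_perm_def inj_eq [OF permutes_inj [OF s]] split:
          if_splits)
  qed
  have into: "ins_perm k s ` {..<Suc n} \<subseteq> {..<Suc n}"
  proof
    fix y assume "y \<in> ins_perm k s ` {..<Suc n}"
    then obtain x where x: "x < Suc n" "y = ins_perm k s x" by auto
    show "y \<in> {..<Suc n}"
    proof (cases x)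
      case 0
      then show ?thesis using x k by (simp add: ins_perm_def)
    next
      case (Suc i)
      then have "s i < n" using x permutes_in_image [OF s, of i] by simp
      then show ?thesis using x Suc by (simp add: ins_perm_def)
    qed
  qed
  show "bij_betw (ins_perm k s) {..<Suc n} {..<Suc n}"
    using inj into by (metis bij_betw_imageI endo_inj_surj finite_lessThan inj_on_subset
        subset_UNIV)
  show "ins_perm k s x = x" if "x \<notin> {..<Suc n}" for x
    using that s k by (auto simp: ins_perm_def permutes_def split: nat.splits)
qed

lemma ins_perm_0: "ins_perm k s 0 = k"
  by (simp add: ins_perm_def)

lemma ins_perm_Suc: "(\<lambda>j. if ins_perm k s (Suc j) > k then ins_perm k s (Suc j) - 1 else ins_perm k
    s (Suc j)) = s"
  by (auto simp: ins_perm_def)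

text \<open>One inclusion and a count: the images for different \<open>k\<close> are disjoint,
  because the value at 0 differs, and each of the n + 1 images has n! elements.\<close>

lemma permutes_Suc_eq: "{s. s permutes {..<Suc n}}
    = (\<Union>k\<in>{..n}. ins_perm k ` {s. s permutes {..<n}})"
proof -
  let ?P = "{s. s permutes {..<n}}"
  have inj: "inj_on (ins_perm k) ?P" for k
    by (rule inj_onI) (metis ins_perm_Suc)
  have fin: "finite ?P" by (simp add: finite_permutations)
  have card: "card ?P = fact n" by (simp add: card_permutations)
  have "card (\<Union>k\<in>{..n}. ins_perm k ` ?P) = (\<Sum>k\<in>{..n}. card (ins_perm k ` ?P))"
    by (rule card_UN_disjoint) (use fin in \<open>auto, metis ins_perm_0\<close>)
  also have "\<dots> = (\<Sum>k\<in>{..n}. fact n)" using inj card by (simp add: card_image)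
  also have "\<dots> = fact (Suc n)" by simp
  finally have "card (\<Union>k\<in>{..n}. ins_perm k ` ?P) = card {s. s permutes {..<Suc n}}"
    by (simp add: card_permutations)
  moreover have "(\<Union>k\<in>{..n}. ins_perm k ` ?P) \<subseteq> {s. s permutes {..<Suc n}}"
    using ins_perm_permutes by auto
  moreover have "finite {s. s permutes {..<Suc n}}" by (simp add: finite_permutations)
  ultimately show ?thesis by (metis card_subset_eq)
qed

section \<open>Recursion and right invariance of the symmetrizer\<close>

context acu_tensor_category
begin

definition "SYM V n = Arrow (tpow C n V) (symmetrizer C V n) (tpow C n V)"

lemma SYM_simps [simp]: "src (SYM V n) = tpow C n V" "trg (SYM V n) = tpow C n V"
  by (simp_all add: SYM_def)

lemma perm_mor_closed: "s permutes {..<n} \<Longrightarrow> perm_mor C V n s \<in> Hom C (tpow C n V) (tpow C n V)"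
proof (induction n arbitrary: s)
  case (Suc n)
  then have "s \<in> (\<Union>k\<in>{..n}. ins_perm k ` {s. s permutes {..<n}})"
      unfolding permutes_Suc_eq [symmetric] by simp
  then obtain k s' where "k \<le> n" "s' permutes {..<n}" "s = ins_perm k s'" by auto
  then show ?case using Suc.IH to_front_closed [of k n V]
    by (auto simp: ins_perm_0 ins_perm_Suc simp del: tpow.simps intro!: Comp_closed)
      (auto intro: tensM_ID_closed)
qed (simp add: Ident_closed)

lemma SYM_0: "SYM V 0 = ID \<I>"
proof -
  interpret M: abelian_group "Mor C \<I> \<I>" by (rule Mor_abelian_group)
  have "finsum (Mor C \<I> \<I>) (\<lambda>s. \<^bold>1 \<I>) {id :: nat \<Rightarrow> nat} = \<^bold>1 \<I>"
    using M.finsum_insert [of "{}" id "\<lambda>s. \<^bold>1 \<I>"] by (simp add: Ident_closed)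
  then show ?thesis by (simp add: SYM_def symmetrizer_def ID_def Mor_smult_one Ident_closed)
qed

text \<open>Permutations are grouped by their value \<open>k\<close> at 0. Each group contributes
  the whole sum for \<open>n\<close> factors after the move of factor \<open>k\<close>, and 1/(n +
  1)! splits into 1/n! and the weight of the average over \<open>k\<close>.\<close>

lemma SYM_Suc: "SYM V (Suc n) = (ID V \<boxtimes> SYM V n) \<bullet> bavg V n"
proof -
  let ?T = "tpow C (Suc n) V" and ?S = "tpow C n V" and ?P = "{s. s permutes {..<n}}"
  let ?M = "Mor C ?T ?T" and ?N = "Mor C ?S ?S"
  let ?A = "finsum ?N (perm_mor C V n) ?P"
  interpret M: abelian_group ?M by (rule Mor_abelian_group)
  interpret N: abelian_group ?N by (rule Mor_abelian_group)
  have fin: "finite ?P" by (simp add: finite_permutations)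
  have cl: "perm_mor C V n s \<in> Hom C ?S ?S" if "s \<in> ?P" for s using that perm_mor_closed by simp
  have A: "?A \<in> Hom C ?S ?S" using cl by (auto intro: N.finsum_closed)
  have tf: "to_front C V n k \<in> Hom C ?T ?T" if "k \<le> n" for k using that by (rule to_front_closed)
  have p: "perm_mor C V (Suc n) (ins_perm k s) = (\<^bold>1 V \<otimes>\<^sub>m perm_mor C V n s) \<cdot> to_front C V n k" for
      k s
    by (simp add: ins_perm_0 ins_perm_Suc)
  have cl': "perm_mor C V (Suc n) (ins_perm k s) \<in> Hom C ?T ?T" if "s \<in> ?P" "k \<le> n" for k s
    using that perm_mor_closed ins_perm_permutes by blast
  have cl1: "\<^bold>1 V \<otimes>\<^sub>m f \<in> Hom C ?T ?T" if "f \<in> Hom C ?S ?S" for f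
    using tensM_ID_closed [OF that] by simp
  have b: "mor (bavg V n) \<in> Hom C ?T ?T" using bavg_simps [of V n]
      by (simp add: ar_def del: bavg_simps)
  have inj: "inj_on (ins_perm k) ?P" for k
    by (rule inj_onI) (metis ins_perm_Suc)
  have k: "finsum ?M (perm_mor C V (Suc n)) (ins_perm k ` ?P) = (\<^bold>1 V \<otimes>\<^sub>m ?A) \<cdot> to_front C V n k"
      if "k \<le> n" for k
  proof -
    have "finsum ?M (perm_mor C V (Suc n)) (ins_perm k ` ?P)
        = finsum ?M (\<lambda>s. perm_mor C V (Suc n) (ins_perm k s)) ?P"
      by (rule M.finsum_reindex [OF _ inj]) (use cl' that in auto)
    also have "\<dots> = finsum ?M (\<lambda>s. \<^bold>1 V \<otimes>\<^sub>m perm_mor C V n s) ?P \<cdot> to_front C V n k"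
      unfolding p by (rule finsum_Comp_left [symmetric, OF fin tf [OF that]]) (use cl cl1 in blast)
    also have "finsum ?M (\<lambda>s. \<^bold>1 V \<otimes>\<^sub>m perm_mor C V n s) ?P = \<^bold>1 V \<otimes>\<^sub>m ?A"
      using finsum_TensM_right [OF fin Ident_closed [of V] cl] by simp
    finally show ?thesis .
  qed
  have "finsum ?M (perm_mor C V (Suc n)) {s. s permutes {..<Suc n}}
      = finsum ?M (\<lambda>k. finsum ?M (perm_mor C V (Suc n)) (ins_perm k ` ?P)) {..n}"
    unfolding permutes_Suc_eq
    by (rule M.add.finprod_UN_disjoint) (use fin cl' in \<open>auto simp: pairwise_def disjnt_def simp
        del: perm_mor.simps, metis ins_perm_0\<close>)
  also have "\<dots> = finsum ?M (\<lambda>k. (\<^bold>1 V \<otimes>\<^sub>m ?A) \<cdot> to_front C V n k) {..n}"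
    by (rule M.finsum_cong') (use k cl1 [OF A] tf in \<open>auto intro!: Comp_closed\<close>)
  also have "\<dots> = (\<^bold>1 V \<otimes>\<^sub>m ?A) \<cdot> finsum ?M (to_front C V n) {..n}"
    by (rule finsum_Comp_right [symmetric]) (use tf cl1 [OF A] in auto)
  also have "\<dots> = (of_nat n + 1) \<odot>\<^bsub>?M\<^esub> ((\<^bold>1 V \<otimes>\<^sub>m ?A) \<cdot> mor (bavg V n))"
    unfolding sum_to_front by (rule Comp_smult_right [OF cl1 [OF A] b])
  finally have "symmetrizer C V (Suc n) = (1 / fact (Suc n)) \<odot>\<^bsub>?M\<^esub> ((of_nat n + 1) \<odot>\<^bsub>?M\<^esub> ((\<^bold>1 V \<otimes>\<^sub>m
      ?A) \<cdot> mor (bavg V n)))"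
    unfolding symmetrizer_def by simp
  also have "\<dots> = (1 / fact n) \<odot>\<^bsub>?M\<^esub> ((\<^bold>1 V \<otimes>\<^sub>m ?A) \<cdot> mor (bavg V n))"
  proof -
    have "1 / fact (Suc n) * (of_nat n + 1 :: rat) = 1 / fact n"
      using of_nat_neq_0 [of n, where 'a = rat] by (simp add: add.commute)
    then show ?thesis using Comp_closed [OF cl1 [OF A] b] by (simp only: Mor_smult_smult)
  qed
  also have "\<dots> = ((1 / fact n) \<odot>\<^bsub>?M\<^esub> (\<^bold>1 V \<otimes>\<^sub>m ?A)) \<cdot> mor (bavg V n)"
    by (rule Comp_smult_left [symmetric, OF cl1 [OF A] b])
  also have "(1 / fact n) \<odot>\<^bsub>?M\<^esub> (\<^bold>1 V \<otimes>\<^sub>m ?A) = \<^bold>1 V \<otimes>\<^sub>m symmetrizer C V n"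
    unfolding symmetrizer_def using TensM_smult_right [OF Ident_closed [of V] A] by simp
  finally show ?thesis by (simp add: SYM_def cmp_def tens_def ID_def)
qed

lemma ar_SYM [simp]: "ar (SYM V n)"
proof (induction n)
  case 0
  show ?case by (simp add: SYM_0)
next
  case (Suc n)
  then show ?case by (simp add: SYM_Suc)
qed

text \<open>The affine span of the monoid generated by the adjacent transpositions, to which the recursion
  for the symmetrizer gives access without computing in the symmetric group.\<close>

inductive span :: "'a \<Rightarrow> nat \<Rightarrow> ('a, 'b) arrow \<Rightarrow> bool" for V where
  span_ID: "span V n (ID (tpow C n V))"
| span_cross: "span V (Suc (Suc n)) (cross V V (tpow C n V))"
| span_tens: "span V n f \<Longrightarrow> span V (Suc n) (ID V \<boxtimes> f)"
| span_cmp: "span V n f \<Longrightarrow> span V n g \<Longrightarrow> span V n (g \<bullet> f)"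
| span_lin: "span V n f \<Longrightarrow> span V n g \<Longrightarrow> q + q' = 1 \<Longrightarrow> span V n (lin q f q' g)"

lemma span_wf: "span V n f \<Longrightarrow> ar f \<and> src f = tpow C n V \<and> trg f = tpow C n V"
  by (induction rule: span.induct) simp_all

lemma span_simps: assumes "span V n f" shows "ar f" "src f = tpow C n V" "trg f = tpow C n V"
  using span_wf [OF assms] by auto

lemma coeff_sum: "(1 / (of_nat n + 2) :: rat) + (of_nat n + 1) / (of_nat n + 2) = 1"
proof -
  have "(of_nat n + 2 :: rat) \<noteq> 0" by (metis add_2_eq_Suc' of_nat_Suc of_nat_add of_nat_neq_0
      of_nat_numeral)
  then show ?thesis by (simp add: field_simps)
qed

lemma span_bavg: "span V (Suc n) (bavg V n)"
proof (induction n)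
  case 0
  show ?case using span_ID [of V "Suc 0"] by simp
next
  case (Suc n)
  show ?case unfolding bavg.simps by (intro span_lin span_ID span_cmp span_tens Suc.IH span_cross
      coeff_sum)
qed

lemma span_SYM: "span V n (SYM V n)"
proof (induction n)
  case 0
  show ?case using span_ID [of V 0] by (simp add: SYM_0)
next
  case (Suc n)
  show ?case unfolding SYM_Suc by (intro span_cmp span_bavg span_tens Suc.IH)
qed

text \<open>A factor \<open>ID V \<boxtimes> ID V \<boxtimes> SYM V k\<close> may be inserted at no
  cost: it commutes with \<open>cross\<close>, which touches only the two factors in front, and is
  absorbed by \<open>ID V \<boxtimes> SYM V (Suc k)\<close>. Placed before \<open>bavg\<close> it
  completes the smaller symmetrizer.\<close>

lemma SYM_Suc_Suc:
  assumes IH: "\<And>h. span V (Suc k) h \<Longrightarrow> SYM V (Suc k) \<bullet> h = SYM V (Suc k)"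
  shows "(ID V \<boxtimes> SYM V (Suc k)) \<bullet> cross V V (tpow C k V) \<bullet> (ID V \<boxtimes> bavg V k)
      = (ID V \<boxtimes> SYM V (Suc k)) \<bullet> cross V V (tpow C k V) \<bullet> (ID V \<boxtimes> SYM V (Suc k))"
proof -
  let ?S = "SYM V (Suc k)" and ?X = "cross V V (tpow C k V)"
  have S: "?S \<bullet> (ID V \<boxtimes> SYM V k) = ?S" by (intro IH span_tens span_SYM)
  have "(ID V \<boxtimes> ?S) \<bullet> ?X \<bullet> (ID V \<boxtimes> ?S)
      = (ID V \<boxtimes> ?S) \<bullet> (?X \<bullet> (ID V \<boxtimes> ID V \<boxtimes> SYM V k)) \<bullet> (ID V \<boxtimes> bavg V k)"
    by (simp add: SYM_Suc [of V k] tens_ID_cmp(1) [symmetric] cmp_assoc)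
  also have "\<dots> = ((ID V \<boxtimes> ?S) \<bullet> (ID V \<boxtimes> ID V \<boxtimes> SYM V k)) \<bullet> ?X \<bullet> (ID V \<boxtimes> bavg V k)"
    by (simp add: cross_natural [of "SYM V k"] cmp_assoc del: tens_ID)
  also have "(ID V \<boxtimes> ?S) \<bullet> (ID V \<boxtimes> ID V \<boxtimes> SYM V k) = ID V \<boxtimes> ?S"
    using S by (simp add: tens_ID_cmp)
  finally show ?thesis by simp
qed

text \<open>Only the generators need an argument. For \<open>ID V \<boxtimes> f\<close> the
  symmetrizer is rewritten so that both terms end in \<open>ID V \<boxtimes> SYM V m\<close>, which
  absorbs by hypothesis. For the crossing of the first two factors the recursion is expanded
  twice.\<close>

lemma SYM_absorb_aux:
  assumes "span V n f" "\<And>m h. m < n \<Longrightarrow> span V m h \<Longrightarrow> SYM V m \<bullet> h = SYM V m"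
  shows "SYM V n \<bullet> f = SYM V n"
  using assms
proof (induction rule: span.induct)
  case (span_cross k)
  let ?S = "SYM V (Suc k)" and ?X = "cross V V (tpow C k V)" and ?I = "ID (tpow C (Suc (Suc k)) V)"
  let ?a = "1 / (of_nat k + 2) :: rat" and ?a' = "(of_nat k + 1) / (of_nat k + 2) :: rat"
  have IH: "?S \<bullet> h = ?S" if "span V (Suc k) h" for h by (rule span_cross) (use that in auto)
  have E: "SYM V (Suc (Suc k)) = lin ?a (ID V \<boxtimes> ?S) ?a' ((ID V \<boxtimes> ?S) \<bullet> ?X \<bullet> (ID V \<boxtimes> bavg V k))"
    by (simp add: SYM_Suc [of V "Suc k"] cmp_lin)
  have EX: "SYM V (Suc (Suc k)) \<bullet> ?X
      = lin ?a ((ID V \<boxtimes> ?S) \<bullet> ?X) ?a' ((ID V \<boxtimes> ?S) \<bullet> ?X \<bullet> (ID V \<boxtimes> bavg V k) \<bullet> ?X)"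
    unfolding E by (simp add: lin_cmp cmp_assoc)
  show ?case
  proof (cases k)
    case 0
    have S1: "?S = ID (tpow C (Suc 0) V)" by (simp add: 0 SYM_Suc SYM_0)
    have "SYM V (Suc (Suc k)) \<bullet> ?X = lin ?a ?X ?a' ?I" and "SYM V (Suc (Suc k)) = lin ?a ?I ?a' ?X"
      unfolding EX unfolding E unfolding S1 by (simp_all add: 0 cross_cross)
    then show ?thesis using 0 lin_exchange
      by (simp add: lin_def) (metis Ident_closed Mor_add_ac(2) Mor_smult_closed ar_def cross_simps)
  next
    case (Suc j)
    let ?X1 = "ID V \<boxtimes> cross V V (tpow C j V)" and ?b = "ID V \<boxtimes> ID V \<boxtimes> bavg V j"
    let ?c = "1 / (of_nat j + 2) :: rat" and ?c' = "(of_nat j + 1) / (of_nat j + 2) :: rat"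
    have bk: "ID V \<boxtimes> bavg V k = lin ?c ?I ?c' (?X1 \<bullet> ?b)"
      by (simp add: Suc tens_lin tens_ID_cmp)
    have SX1: "(ID V \<boxtimes> ?S) \<bullet> ?X1 = ID V \<boxtimes> ?S"
      using IH [of "cross V V (tpow C j V)"] span.span_cross [of V j] by (simp add: Suc tens_ID_cmp)
    \<comment> \<open>Expanded twice, the symmetrizer has three terms:
      \<open>ID V \<boxtimes> ?S\<close>, its product with \<open>?X\<close>, and \<open>?W\<close>.
      Composition with \<open>?X\<close> on the right exchanges the first two, which both have
      coefficient 1/(k + 2). It fixes \<open>?W\<close> by the braid relation, since
      \<open>ID V \<boxtimes> ?S\<close> absorbs \<open>?X1\<close>.\<close>
    let ?W = "(ID V \<boxtimes> ?S) \<bullet> ?X \<bullet> ?X1 \<bullet> ?b"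
    have bX: "?b \<bullet> ?X = ?X \<bullet> ?b" using cross_natural [of "bavg V j"] by (simp add: Suc)
    have 1: "(ID V \<boxtimes> ?S) \<bullet> ?X \<bullet> (ID V \<boxtimes> bavg V k) = lin ?c ((ID V \<boxtimes> ?S) \<bullet> ?X) ?c' ?W"
      unfolding bk by (simp add: Suc cmp_lin)
    have 2: "(ID V \<boxtimes> ?S) \<bullet> ?X \<bullet> (ID V \<boxtimes> bavg V k) \<bullet> ?X
        = lin ?c ((ID V \<boxtimes> ?S) \<bullet> ?X \<bullet> ?X) ?c' ((ID V \<boxtimes> ?S) \<bullet> (?X \<bullet> ?X1 \<bullet> ?X) \<bullet> ?b)"
      unfolding bk by (simp add: Suc cmp_lin lin_cmp cmp_assoc bX [unfolded Suc tpow.simps])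
    have "(?X \<bullet> ?X1 \<bullet> ?X) = ?X1 \<bullet> ?X \<bullet> ?X1"
      using cross_braid [of V "tpow C j V"] by (simp add: Suc)
    then have "(ID V \<boxtimes> ?S) \<bullet> (?X \<bullet> ?X1 \<bullet> ?X) \<bullet> ?b = ((ID V \<boxtimes> ?S) \<bullet> ?X1) \<bullet> ?X \<bullet> ?X1 \<bullet> ?b"
      by (simp add: Suc cmp_assoc)
    then have 3: "(ID V \<boxtimes> ?S) \<bullet> ?X \<bullet> (ID V \<boxtimes> bavg V k) \<bullet> ?X = lin ?c (ID V \<boxtimes> ?S) ?c' ?W"
      unfolding 2 SX1 by (simp add: cross_cross)
    have nz: "(of_nat j + 2 :: rat) \<noteq> 0"
        by (metis add_2_eq_Suc' of_nat_Suc of_nat_add of_nat_neq_0 of_nat_numeral)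
    have "?a = ?a' * ?c" using nz by (simp add: Suc field_simps)
    then show ?thesis unfolding EX unfolding E unfolding 1 3
      by (intro lin_exchange) (simp_all add: Suc)
  qed
next
  case (span_tens m f)
  have IH: "SYM V m \<bullet> h = SYM V m" if "span V m h" for h by (rule span_tens) (use that in auto)
  show ?case
  proof (cases m)
    case 0
    \<comment> \<open>Since the symmetrizer in degree 0 is the identity, absorption of
      \<open>f\<close> already says that \<open>f\<close> is the identity. This is where
      coefficients of sum 1 matter.\<close>
    then have "f = ID \<I>" using IH [OF span_tens(1)] span_simps [OF span_tens(1)]
        by (simp add: SYM_0)
    then show ?thesis by (simp add: 0)
  next
    case (Suc k)
    let ?X = "cross V V (tpow C k V)" and ?S = "SYM V m"
    note f = span_simps [OF span_tens(1)]
    have E: "SYM V (Suc m) = lin (1 / (of_nat k + 2)) (ID V \<boxtimes> ?S) ((of_nat k + 1) / (of_nat k + 2))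
        ((ID V \<boxtimes> ?S) \<bullet> ?X \<bullet> (ID V \<boxtimes> ?S))"
      unfolding SYM_Suc [of V m] using SYM_Suc_Suc [of V k] IH by (simp add: Suc cmp_lin)
    show ?thesis unfolding E using f IH [OF span_tens(1)]
      by (simp add: lin_cmp cmp_assoc Suc tens_ID_cmp)
  qed
next
  case (span_cmp n f g)
  have "SYM V n \<bullet> (g \<bullet> f) = (SYM V n \<bullet> g) \<bullet> f"
    using span_simps [OF span_cmp(1)] span_simps [OF span_cmp(2)] by (simp add: cmp_assoc)
  then show ?case using span_cmp by simp
next
  case (span_lin n f g q q')
  then show ?case using span_simps [OF span_lin(1)] span_simps [OF span_lin(2)]
      by (simp add: cmp_lin lin_same)
qed simp

lemma SYM_absorb: "span V n f \<Longrightarrow> SYM V n \<bullet> f = SYM V n"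
proof (induction n arbitrary: f rule: less_induct)
  case (less n)
  show ?case by (rule SYM_absorb_aux [OF less.prems less.IH])
qed

section \<open>Transposition along the pairings of tensor powers\<close>

lemma bil_LU [simp]: "bil (LU \<I>) \<I> \<I>"
  by (simp add: bil_def)

lemma smul_star_right [simp]: "\<lbrakk>el x; obj x = \<I>; base x = L\<rbrakk> \<Longrightarrow> smul x (star L) = x"
  using smul_commute [of x "star L"] by simp

lemma adjointD:
  assumes "adjoint e f' f" "bil e D X" "src f = X" "trg f = X" "src f' = D" "trg f' = D"
    "el d" "el x" "obj d = D" "obj x = X" "dj d x"
  shows "ap e (pair (ap f' d) x) = ap e (pair d (ap f x))"
proof -
  have a: "e \<bullet> (f' \<boxtimes> ID X) = e \<bullet> (ID D \<boxtimes> f)" "ar f" "ar f'" using assms by (auto simp: adjoint_def)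
  from arg_cong [OF a(1), of "\<lambda>h. ap h (pair d x)"] show ?thesis
    using assms a(2-) bil_simps [OF assms(2)] by simp
qed

lemma adjoint_ID: "\<lbrakk>bil e D X\<rbrakk> \<Longrightarrow> adjoint e (ID D) (ID X)"
  by (simp add: adjoint_def bil_simps)

lemma adjoint_cmp:
  assumes e: "bil e D X"
    and f: "adjoint e f' f" "src f = X" "trg f = X" "src f' = D" "trg f' = D"
    and g: "adjoint e g' g" "src g = X" "trg g = X" "src g' = D" "trg g' = D"
  shows "adjoint e (f' \<bullet> g') (g \<bullet> f)"
proof -
  have a: "ar f" "ar f'" "ar g" "ar g'" using f(1) g(1) by (auto simp: adjoint_def)
  have "e \<bullet> ((f' \<bullet> g') \<boxtimes> ID X) = e \<bullet> (ID D \<boxtimes> (g \<bullet> f))"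
    by (rule arrow_eqI2) (use a f g bil_simps [OF e] in \<open>simp_all add: adjointD [OF f(1) e] adjointD
        [OF g(1) e]\<close>)
  then show ?thesis using a f g by (simp add: adjoint_def)
qed

lemma adjoint_lin:
  assumes e: "bil e D X"
    and f: "adjoint e f' f" "src f = X" "trg f = X" "src f' = D" "trg f' = D"
    and g: "adjoint e g' g" "src g = X" "trg g = X" "src g' = D" "trg g' = D"
  shows "adjoint e (lin q f' q' g') (lin q f q' g)"
  using assms by (simp add: adjoint_def lin_tens tens_lin cmp_lin bil_simps)

lemma adjoint_tens:
  assumes e: "bil e D X" "bil e' D' X'"
    and f: "adjoint e f' f" "src f = X" "trg f = X" "src f' = D" "trg f' = D"
    and g: "adjoint e' g' g" "src g = X'" "trg g = X'" "src g' = D'" "trg g' = D'"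
  shows "adjoint (C1324 e e' D D' X X') (f' \<boxtimes> g') (f \<boxtimes> g)"
proof -
  have a: "ar f" "ar f'" "ar g" "ar g'" using f(1) g(1) by (auto simp: adjoint_def)
  have "C1324 e e' D D' X X' \<bullet> ((f' \<boxtimes> g') \<boxtimes> ID (X \<otimes>\<^sub>o X')) = C1324 e e' D D' X X' \<bullet>
      (ID (D \<otimes>\<^sub>o D') \<boxtimes> (f \<boxtimes> g))"
    by (rule arrow_eqI4) (use a e f g bil_simps [OF e(1)] bil_simps [OF e(2)]
      in \<open>simp_all add: adjointD [OF f(1) e(1)] adjointD [OF g(1) e(2)]\<close>)
  then show ?thesis using a f g by (simp add: adjoint_def)
qed

lemma adjoint_cross:
  assumes e: "bil e D X" "bil e' D' X'"
  shows "adjoint (C1324 e (C1324 e e' D D' X X') D (D \<otimes>\<^sub>o D') X (X \<otimes>\<^sub>o X')) (cross D D D') (cross X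
      X X')"
proof -
  let ?E = "C1324 e (C1324 e e' D D' X X') D (D \<otimes>\<^sub>o D') X (X \<otimes>\<^sub>o X')"
  have "?E \<bullet> (cross D D D' \<boxtimes> ID (X \<otimes>\<^sub>o (X \<otimes>\<^sub>o X'))) = ?E \<bullet> (ID (D \<otimes>\<^sub>o (D \<otimes>\<^sub>o D')) \<boxtimes> cross X X X')"
    by (rule arrow_eqI6c) (use e bil_simps [OF e(1)] bil_simps [OF e(2)] in \<open>simp_all add: smul_ac\<close>)
  then show ?thesis by (simp add: adjoint_def)
qed

definition "evA V = Arrow (V\<^sup>\<or> \<otimes>\<^sub>o V) (ev C V) \<I>"
definition "EP n V = Arrow (tpow C n V\<^sup>\<or> \<otimes>\<^sub>o tpow C n V) (ev_pow C n V) \<I>"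

lemma evA_eq: "evA V = EV V \<I>"
  by (simp add: evA_def EV_def dual_def ev_def)

lemma bil_evA [simp]: "bil (evA V) V\<^sup>\<or> V"
  by (simp add: evA_eq bil_def dual_def)

lemma EP_0: "EP 0 V = LU \<I>"
  by (simp add: EP_def LU_def)

lemma EP_Suc: "EP (Suc n) V = C1324 (evA V) (EP n V) V\<^sup>\<or> (tpow C n V\<^sup>\<or>) V (tpow C n V)"
  by (simp add: EP_def C1324_def evA_def)

lemma bil_EP [simp]: "bil (EP n V) (tpow C n V\<^sup>\<or>) (tpow C n V)"
  by (induction n) (simp_all add: EP_0 EP_Suc)

lemma EP_simps [simp]: "ar (EP n V)" "src (EP n V) = tpow C n V\<^sup>\<or> \<otimes>\<^sub>o tpow C n V" "trg (EP n V) = \<I>"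
  using bil_EP [of n V] by (auto simp: bil_def)

text \<open>Transposition preserves the span and reverses composition. It will turn absorption on
  the right for \<open>V\<^sup>\<or>\<close> into absorption on the left for
  \<open>V\<close>.\<close>

lemma span_adjoint:
  "span V n f \<Longrightarrow> \<exists>f'. span V\<^sup>\<or> n f' \<and> adjoint (EP n V) f' f"
proof (induction rule: span.induct)
  case (span_ID n)
  show ?case using span.span_ID adjoint_ID [OF bil_EP] by blast
next
  case (span_cross n)
  show ?case unfolding EP_Suc tpow.simps using span.span_cross adjoint_cross [OF bil_evA bil_EP]
      by blast
next
  case (span_tens n f)
  then obtain f' where f': "span V\<^sup>\<or> n f'" "adjoint (EP n V) f' f" by blast
  have "adjoint (EP (Suc n) V) (ID V\<^sup>\<or> \<boxtimes> f') (ID V \<boxtimes> f)" unfolding EP_Suc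
    by (rule adjoint_tens [OF bil_evA bil_EP adjoint_ID [OF bil_evA] _ _ _ _ f'(2)])
      (use span_simps [OF f'(1)] span_simps [OF span_tens(1)] in simp_all)
  then show ?case using span.span_tens [OF f'(1)] by blast
next
  case (span_cmp n f g)
  then obtain f' g' where f': "span V\<^sup>\<or> n f'" "adjoint (EP n V) f' f"
    and g': "span V\<^sup>\<or> n g'" "adjoint (EP n V) g' g" by blast
  note s = span_simps [OF f'(1)] span_simps [OF g'(1)] span_simps [OF span_cmp(1)] span_simps [OF
      span_cmp(2)]
  have "adjoint (EP n V) (f' \<bullet> g') (g \<bullet> f)"
    by (rule adjoint_cmp [OF bil_EP f'(2) _ _ _ _ g'(2)]) (use s in simp_all)
  then show ?case using span.span_cmp [OF g'(1) f'(1)] by blast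
next
  case (span_lin n f g q q')
  then obtain f' g' where f': "span V\<^sup>\<or> n f'" "adjoint (EP n V) f' f"
    and g': "span V\<^sup>\<or> n g'" "adjoint (EP n V) g' g" by blast
  note s = span_simps [OF f'(1)] span_simps [OF g'(1)] span_simps [OF span_lin(1)] span_simps [OF
      span_lin(2)]
  have "adjoint (EP n V) (lin q f' q' g') (lin q f q' g)"
    by (rule adjoint_lin [OF bil_EP f'(2) _ _ _ _ g'(2)]) (use s in simp_all)
  then show ?case using span.span_lin [OF f'(1) g'(1) span_lin(3)] by blast
qed

lemma span_adjoint':
  "span W n f' \<Longrightarrow> W = V\<^sup>\<or> \<Longrightarrow> \<exists>f. span V n f \<and> adjoint (EP n V) f' f"
proof (induction rule: span.induct)
  case (span_ID n)
  then show ?case using span.span_ID adjoint_ID [OF bil_EP] by blast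
next
  case (span_cross n)
  then show ?case unfolding EP_Suc tpow.simps
      using span.span_cross adjoint_cross [OF bil_evA bil_EP] by blast
next
  case (span_tens n f')
  then obtain f where f: "span V n f" "adjoint (EP n V) f' f" by blast
  have "adjoint (EP (Suc n) V) (ID V\<^sup>\<or> \<boxtimes> f') (ID V \<boxtimes> f)" unfolding EP_Suc
    by (rule adjoint_tens [OF bil_evA bil_EP adjoint_ID [OF bil_evA] _ _ _ _ f(2)])
      (use span_simps [OF f(1)] span_simps [OF span_tens(1)] span_tens.prems in simp_all)
  then show ?case using span.span_tens [OF f(1)] span_tens.prems by blast
next
  case (span_cmp n f' g')
  then obtain f g where f: "span V n f" "adjoint (EP n V) f' f"
    and g: "span V n g" "adjoint (EP n V) g' g" by blast
  note s = span_simps [OF f(1)] span_simps [OF g(1)] span_simps [OF span_cmp(1)] span_simps [OF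
      span_cmp(2)]
  have "adjoint (EP n V) (g' \<bullet> f') (f \<bullet> g)"
    by (rule adjoint_cmp [OF bil_EP g(2) _ _ _ _ f(2)]) (use s span_cmp.prems in simp_all)
  then show ?case using span.span_cmp [OF g(1) f(1)] by blast
next
  case (span_lin n f' g' q q')
  then obtain f g where f: "span V n f" "adjoint (EP n V) f' f"
    and g: "span V n g" "adjoint (EP n V) g' g" by blast
  note s = span_simps [OF f(1)] span_simps [OF g(1)] span_simps [OF span_lin(1)] span_simps [OF
      span_lin(2)]
  have "adjoint (EP n V) (lin q f' q' g') (lin q f q' g)"
    by (rule adjoint_lin [OF bil_EP f(2) _ _ _ _ g(2)]) (use s span_lin.prems in simp_all)
  then show ?case using span.span_lin [OF f(1) g(1) span_lin(3)] by blast
qed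

section \<open>Concatenation of tensor powers\<close>

definition "JN V m n = Arrow (tpow C m V \<otimes>\<^sub>o tpow C n V) (join C V m n) (tpow C (m + n) V)"
definition "CT V m n = Arrow (tpow C (m + n) V) (cut C V m n) (tpow C m V \<otimes>\<^sub>o tpow C n V)"

lemma JN_0: "JN V 0 n = LU (tpow C n V)"
  by (simp add: JN_def LU_def)

lemma JN_Suc: "JN V (Suc m) n = (ID V \<boxtimes> JN V m n) \<bullet> ASS V (tpow C m V) (tpow C n V)"
  by (simp add: JN_def ASS_def ID_def tens_def cmp_def)

lemma JN_simps [simp]: "src (JN V m n) = tpow C m V \<otimes>\<^sub>o tpow C n V"
    "trg (JN V m n) = tpow C (m + n) V"
    "src (CT V m n) = tpow C (m + n) V" "trg (CT V m n) = tpow C m V \<otimes>\<^sub>o tpow C n V"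
  by (simp_all add: JN_def CT_def)

lemma ar_JN [simp]: "ar (JN V m n)"
  by (induction m) (simp_all add: JN_0 JN_Suc)

lemma inverses_JN: "inverses (JN V m n) (CT V m n)"
proof -
  have "\<exists>g. inverses (JN V m n) g"
  proof (induction m)
    case 0
    then show ?case using inverses_LU by (auto simp: JN_0)
  next
    case (Suc m)
    then obtain g where "inverses (JN V m n) g" by blast
    then show ?case unfolding JN_Suc
      using inverses_cmp [OF inverses_ASS inverses_tens [OF inverses_ID]]
          by (metis JN_simps(1) ID_simps(1) structure_simps(2) tens_simps(1))
  qed
  then obtain g where g: "inverses (JN V m n) g" by blast
  then have "cut C V m n = mor g" unfolding cut_def JN_def by (rule inverse_mor_Arrow)
  with g have "CT V m n = g" by (cases g) (auto simp: CT_def inverses_def)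
  with g show ?thesis by simp
qed

lemma ar_CT [simp]: "ar (CT V m n)"
  using inverses_JN [of V m n] by (simp add: inverses_def)

lemma JN_CT [simp]: "JN V m n \<bullet> CT V m n = ID (tpow C (m + n) V)" "CT V m n \<bullet> JN V m n
    = ID (tpow C m V \<otimes>\<^sub>o tpow C n V)"
  using inverses_JN [of V m n] by (simp_all add: inverses_def)

lemma ap_CT_JN [simp]: "\<lbrakk>el w; obj w = tpow C m V \<otimes>\<^sub>o tpow C n V\<rbrakk> \<Longrightarrow> ap (CT V m n) (ap (JN V m n) w)
    = w"
  by (rule ap_inverse [OF inverses_JN]) simp_all

lemma ap_JN_CT [simp]: "\<lbrakk>el w; obj w = tpow C (m + n) V\<rbrakk> \<Longrightarrow> ap (JN V m n) (ap (CT V m n) w) = w"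
  by (rule ap_inverse [OF inverses_sym [OF inverses_JN]]) simp_all

lemma ap_JN_0 [simp]: "obj t = tpow C n V \<Longrightarrow> ap (JN V 0 n) (pair s t) = smul s t"
  by (simp add: JN_0)

lemma ap_JN_Suc [simp]:
  "\<lbrakk>el x; el t; el u; obj x = V; obj t = tpow C m V; obj u = tpow C n V; dj x t; dj x u; dj t u\<rbrakk>
    \<Longrightarrow> ap (JN V (Suc m) n) (pair (pair x t) u) = pair x (ap (JN V m n) (pair t u))"
  by (simp add: JN_Suc)

text \<open>No formula for \<open>h\<close> is needed: membership in the span already lets the
  symmetrizer on \<open>m + n\<close> factors absorb it. The same holds for the other statements on
  blocks below.\<close>

lemma span_block_left:
  "span V m f \<Longrightarrow> \<exists>h. span V (m + n) h \<and> h \<bullet> JN V m n = JN V m n \<bullet> (f \<boxtimes> ID (tpow C n V))"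
proof (induction rule: span.induct)
  case (span_ID m)
  show ?case using span.span_ID [of V "m + n"] by (intro exI [of _ "ID (tpow C (m + n) V)"]) simp
next
  case (span_cross m)
  have "cross V V (tpow C (m + n) V) \<bullet> JN V (Suc (Suc m)) n
      = JN V (Suc (Suc m)) n \<bullet> (cross V V (tpow C m V) \<boxtimes> ID (tpow C n V))"
    by (rule arrow_eqI4l) simp_all
  then show ?case using span.span_cross [of V "m + n"] by auto
next
  case (span_tens m f)
  then obtain h where h: "span V (m + n) h" "h \<bullet> JN V m n = JN V m n \<bullet> (f \<boxtimes> ID (tpow C n V))"
      by blast
  note s = span_simps [OF h(1)] span_simps [OF span_tens(1)]
  have hJ: "ap h (ap (JN V m n) (pair t u)) = ap (JN V m n) (pair (ap f t) u)"
    if "el t" "el u" "obj t = tpow C m V" "obj u = tpow C n V" "dj t u" for t u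
    using arg_cong [OF h(2), of "\<lambda>k. ap k (pair t u)"] that s by simp
  have "(ID V \<boxtimes> h) \<bullet> JN V (Suc m) n = JN V (Suc m) n \<bullet> ((ID V \<boxtimes> f) \<boxtimes> ID (tpow C n V))"
    by (rule arrow_eqI3l) (simp_all add: s hJ)
  then show ?case using span.span_tens [OF h(1)] by auto
next
  case (span_cmp m f g)
  then obtain h k where h: "span V (m + n) h" "h \<bullet> JN V m n = JN V m n \<bullet> (f \<boxtimes> ID (tpow C n V))"
    and k: "span V (m + n) k" "k \<bullet> JN V m n = JN V m n \<bullet> (g \<boxtimes> ID (tpow C n V))" by blast
  note s = span_simps [OF h(1)] span_simps [OF k(1)] span_simps [OF span_cmp(1)] span_simps [OF
      span_cmp(2)]
  have "(k \<bullet> h) \<bullet> JN V m n = (k \<bullet> JN V m n) \<bullet> (f \<boxtimes> ID (tpow C n V))"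
    using s h(2) by (simp add: cmp_assoc)
  also have "\<dots> = JN V m n \<bullet> ((g \<bullet> f) \<boxtimes> ID (tpow C n V))"
    unfolding k(2) using s by (simp add: cmp_assoc tens_ID_cmp)
  finally show ?case using span.span_cmp [OF h(1) k(1)] by blast
next
  case (span_lin m f g q q')
  then obtain h k where h: "span V (m + n) h" "h \<bullet> JN V m n = JN V m n \<bullet> (f \<boxtimes> ID (tpow C n V))"
    and k: "span V (m + n) k" "k \<bullet> JN V m n = JN V m n \<bullet> (g \<boxtimes> ID (tpow C n V))" by blast
  note s = span_simps [OF h(1)] span_simps [OF k(1)] span_simps [OF span_lin(1)] span_simps [OF
      span_lin(2)]
  have "lin q h q' k \<bullet> JN V m n = JN V m n \<bullet> (lin q f q' g \<boxtimes> ID (tpow C n V))"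
    using s by (simp add: lin_cmp cmp_lin lin_tens h(2) k(2))
  then show ?case using span.span_lin [OF h(1) k(1) span_lin(3)] by blast
qed

lemma span_block_right:
  assumes f: "span V n f"
  shows "\<exists>h. span V (m + n) h \<and> h \<bullet> JN V m n = JN V m n \<bullet> (ID (tpow C m V) \<boxtimes> f)"
proof (induction m)
  case 0
  show ?case using f span_simps [OF f] LU_natural [of f "tpow C n V"] by (auto simp: JN_0)
next
  case (Suc m)
  then obtain h where h: "span V (m + n) h" "h \<bullet> JN V m n = JN V m n \<bullet> (ID (tpow C m V) \<boxtimes> f)"
      by blast
  note s = span_simps [OF h(1)] span_simps [OF f]
  have hJ: "ap h (ap (JN V m n) (pair t u)) = ap (JN V m n) (pair t (ap f u))"
    if "el t" "el u" "obj t = tpow C m V" "obj u = tpow C n V" "dj t u" for t u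
    using arg_cong [OF h(2), of "\<lambda>k. ap k (pair t u)"] that s by simp
  have "(ID V \<boxtimes> h) \<bullet> JN V (Suc m) n = JN V (Suc m) n \<bullet> (ID (tpow C (Suc m) V) \<boxtimes> f)"
    unfolding tpow.simps by (rule arrow_eqI3l) (simp_all add: s hJ)
  then show ?case using span.span_tens [OF h(1)] by auto
qed

lemma span_move:
  "\<exists>h. span V (Suc (n + m)) h \<and> h \<bullet> (ID V \<boxtimes> JN V n m) = JN V n (Suc m) \<bullet>
      cross V (tpow C n V) (tpow C m V)"
proof (induction n)
  case 0
  have "ID (tpow C (Suc m) V) \<bullet> (ID V \<boxtimes> JN V 0 m) = JN V 0 (Suc m) \<bullet>
      cross V (tpow C 0 V) (tpow C m V)"
    unfolding tpow.simps by (rule arrow_eqI3r) (simp_all add: dj_sym)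
  then show ?case using span_ID [of V "Suc m"] by auto
next
  case (Suc n)
  then obtain h where h: "span V (Suc (n + m)) h"
    "h \<bullet> (ID V \<boxtimes> JN V n m) = JN V n (Suc m) \<bullet> cross V (tpow C n V) (tpow C m V)" by blast
  note s = span_simps [OF h(1)]
  have hJ: "ap h (pair x (ap (JN V n m) (pair t u))) = ap (JN V n (Suc m)) (pair t (pair x u))"
    if "el x" "el t" "el u" "obj x = V" "obj t = tpow C n V" "obj u = tpow C m V" "dj x t" "dj t u"
        "dj x u" for x t u
    using arg_cong [OF h(2), of "\<lambda>k. ap k (pair x (pair t u))"] that s by simp
  have "((ID V \<boxtimes> h) \<bullet> cross V V (tpow C (n + m) V)) \<bullet> (ID V \<boxtimes> JN V (Suc n) m)
      = JN V (Suc n) (Suc m) \<bullet> cross V (tpow C (Suc n) V) (tpow C m V)"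
    unfolding tpow.simps by (rule arrow_eqI4m) (simp_all add: s hJ)
  moreover have "span V (Suc (Suc n + m)) ((ID V \<boxtimes> h) \<bullet> cross V V (tpow C (n + m) V))"
    using span_cmp [OF span_cross span_tens [OF h(1)]] by simp
  ultimately show ?case by blast
qed

lemma JN_0_right: "JN V n 0 = RU (tpow C n V)"
proof (induction n)
  case 0
  show ?case by (simp add: JN_0 LU_I_eq_RU_I)
next
  case (Suc n)
  have "(ID V \<boxtimes> RU (tpow C n V)) \<bullet> ASS V (tpow C n V) \<I> = RU (V \<otimes>\<^sub>o tpow C n V)"
    by (rule arrow_eqI3l) (simp_all add: dj_sym)
  with Suc show ?case by (simp add: JN_Suc)
qed

text \<open>Induction on the length of the first block: its tail is exchanged with the second block,
  then its first factor is moved past that block by \<open>span_move\<close>.\<close>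

lemma span_block_swap:
  "\<exists>h. span V (m + n) h \<and> h \<bullet> JN V m n = JN V n m \<bullet> SW (tpow C m V) (tpow C n V)"
proof (induction m)
  case 0
  have "ID (tpow C n V) \<bullet> JN V 0 n = JN V n 0 \<bullet> SW (tpow C 0 V) (tpow C n V)"
    using LU_SW [of "tpow C n V"] by (simp add: JN_0 JN_0_right LU_SW [symmetric] cmp_assoc)
  then show ?case using span_ID [of V n] by auto
next
  case (Suc m)
  then obtain h where h: "span V (m + n) h" "h \<bullet> JN V m n = JN V n m \<bullet> SW (tpow C m V) (tpow C n V)"
      by blast
  obtain k where k: "span V (Suc (n + m)) k"
    "k \<bullet> (ID V \<boxtimes> JN V n m) = JN V n (Suc m) \<bullet> cross V (tpow C n V) (tpow C m V)" using span_move
        by blast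
  note s = span_simps [OF h(1)] span_simps [OF k(1)]
  have hJ: "ap h (ap (JN V m n) (pair t u)) = ap (JN V n m) (pair u t)"
    if "el t" "el u" "obj t = tpow C m V" "obj u = tpow C n V" "dj t u" for t u
    using arg_cong [OF h(2), of "\<lambda>k. ap k (pair t u)"] that s by simp
  have kJ: "ap k (pair x (ap (JN V n m) (pair t u))) = ap (JN V n (Suc m)) (pair t (pair x u))"
    if "el x" "el t" "el u" "obj x = V" "obj t = tpow C n V" "obj u = tpow C m V" "dj x t" "dj t u"
        "dj x u" for x t u
    using arg_cong [OF k(2), of "\<lambda>k. ap k (pair x (pair t u))"] that s by simp
  have "(k \<bullet> (ID V \<boxtimes> h)) \<bullet> JN V (Suc m) n = JN V n (Suc m) \<bullet> SW (tpow C (Suc m) V) (tpow C n V)"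
    unfolding tpow.simps by (rule arrow_eqI3l) (simp_all add: s hJ kJ add.commute)
  moreover have "span V (Suc m + n) (k \<bullet> (ID V \<boxtimes> h))"
    using span_cmp [OF span_tens [OF h(1)], of k] k(1) by (simp add: add.commute)
  ultimately show ?case by blast
qed

lemma ap_EP_JN:
  "EP (m + n) V \<bullet> (JN V\<^sup>\<or> m n \<boxtimes> JN V m n) =
   C1324 (EP m V) (EP n V) (tpow C m V\<^sup>\<or>) (tpow C n V\<^sup>\<or>) (tpow C m V) (tpow C n V)"
proof (induction m)
  case 0
  show ?case unfolding tpow.simps by (rule arrow_eqI4) (simp_all add: EP_0 smul_ac)
next
  case (Suc m)
  have IH: "ap (EP (m + n) V) (pair (ap (JN V\<^sup>\<or> m n) (pair a b)) (ap (JN V m n) (pair x y)))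
      = smul (ap (EP m V) (pair a x)) (ap (EP n V) (pair b y))"
    if "el a" "el b" "el x" "el y" "obj a = tpow C m V\<^sup>\<or>" "obj b = tpow C n V\<^sup>\<or>"
        "obj x = tpow C m V" "obj y = tpow C n V"
      "dj a b" "dj a x" "dj a y" "dj b x" "dj b y" "dj x y" for a b x y
    using arg_cong [OF Suc, of "\<lambda>k. ap k (pair (pair a b) (pair x y))"] that by simp
  show ?case unfolding tpow.simps add_Suc EP_Suc
    by (rule arrow_eqI6d) (simp_all add: IH EP_Suc bil_simps [OF bil_evA] smul_ac)
qed

end

section \<open>Duality of tensor powers and left invariance of the symmetrizer\<close>

context rigid_tensor_category
begin

definition "coevA V = Arrow \<I> (coev C V) (V \<otimes>\<^sub>o V\<^sup>\<or>)"

text \<open>The defined coevaluation is the lift of \<open>LU V\<close> along any coevaluation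
  \<open>c\<close>. By the triangle identity for \<open>V\<close> the arrow \<open>LU V\<close>
  comes from \<open>c\<close> itself, and lifting gives back \<open>c\<close>.\<close>

lemma dualpair_coev: "dualpair V\<^sup>\<or> V (evA V) (coevA V)"
proof -
  obtain c where c: "dualpair V\<^sup>\<or> V (evA V) c" using ex_coev [of V] by (auto simp: evA_eq dual_def)
  note s = dualpair_simps [OF c]
  have "Arrow \<I> (alpha_inv C (mor (evA V)) V\<^sup>\<or> V V \<cdot> transp C \<I> V V (mor (LU V))) (V \<otimes>\<^sub>o V\<^sup>\<or>)
      = lft V\<^sup>\<or> V c \<I> (LU V)"
    by (rule alpha_inv_transp [OF c]) simp_all
  then have "coevA V = lft V\<^sup>\<or> V c \<I> (LU V)"
    by (simp add: coevA_def coev_def evA_def LU_def)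
  also have "LU V = CR (evA V) V V\<^sup>\<or> V \<bullet> (c \<boxtimes> ID V)" using c by (simp add: dualpair_def)
  also have "lft V\<^sup>\<or> V c \<I> \<dots> = c" by (rule lft_CR [OF c]) (use s in simp_all)
  finally show ?thesis using c by simp
qed

primrec CP where
  "CP 0 V = LUI \<I>"
| "CP (Suc n) V = tens_coev V V\<^sup>\<or> (coevA V) (tpow C n V) (tpow C n V\<^sup>\<or>) (CP n V)"

lemma dualpair_unit: "dualpair \<I> \<I> (LU \<I>) (LUI \<I>)"
proof -
  have "CR (LU \<I>) \<I> \<I> \<I> \<bullet> (LUI \<I> \<boxtimes> ID \<I>) = LU \<I>"
    by (rule arrow_eqI2) (simp_all add: smul_commute)
  moreover have "CL (LU \<I>) \<I> \<I> \<I> \<bullet> (ID \<I> \<boxtimes> LUI \<I>) = RU \<I>"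
    by (rule arrow_eqI2) (simp_all add: smul_commute)
  ultimately show ?thesis by (simp add: dualpair_def)
qed

lemma dualpair_tpow: "dualpair (tpow C n V\<^sup>\<or>) (tpow C n V) (EP n V) (CP n V)"
  by (induction n) (simp_all add: EP_0 EP_Suc dualpair_unit dualpair_tens dualpair_coev)

text \<open>The transpose \<open>a\<close> of the symmetrizer of \<open>V\<^sup>\<or>\<close> lies
  in the span of \<open>V\<close> and is fixed by composition on the left with the whole span. Hence
  \<open>SYM V n \<bullet> a\<close> equals \<open>a\<close>, and by absorption on the right it also
  equals \<open>SYM V n\<close>. Both claims follow from \<open>a = SYM V n\<close>.\<close>

lemma SYM_adjoint: "adjoint (EP n V) (SYM V\<^sup>\<or> n) (SYM V n)"
  and SYM_absorb_left: "span V n f \<Longrightarrow> f \<bullet> SYM V n = SYM V n"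
proof -
  let ?S' = "SYM V\<^sup>\<or> n" and ?S = "SYM V n" and ?e = "EP n V"
  obtain a where a: "span V n a" "adjoint ?e ?S' a" using span_adjoint' [OF span_SYM refl] by blast
  note s = span_simps [OF a(1)]
  have fa: "f \<bullet> a = a" if f: "span V n f" for f
  proof -
    obtain f' where f': "span V\<^sup>\<or> n f'" "adjoint ?e f' f" using span_adjoint [OF f] by blast
    note t = span_simps [OF f] span_simps [OF f'(1)]
    have S': "ap ?S' (ap f' d) = ap ?S' d" if "el d" "obj d = tpow C n V\<^sup>\<or>" for d
      using arg_cong [OF SYM_absorb [OF f'(1)], of "\<lambda>h. ap h d"] that t by simp
    show ?thesis
    proof (rule pairing_cancel_right [OF dualpair_tpow])
      show "?e \<bullet> (ID (tpow C n V\<^sup>\<or>) \<boxtimes> (f \<bullet> a)) = ?e \<bullet> (ID (tpow C n V\<^sup>\<or>) \<boxtimes> a)"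
        by (rule arrow_eqI2) (use s t in \<open>simp_all add: adjointD [OF f'(2) bil_EP, symmetric]
          adjointD [OF a(2) bil_EP, symmetric] S'\<close>)
    qed (use s t in simp_all)
  qed
  have "a = ?S" using fa [OF span_SYM] SYM_absorb [OF a(1)] by simp
  with a fa show "adjoint ?e ?S' ?S" "span V n f \<Longrightarrow> f \<bullet> ?S = ?S" by auto
qed

text \<open>Through \<open>JN\<close> the operators on the two blocks become a single element of the
  span, which the symmetrizer absorbs from either side.\<close>

lemma SYM_JN_block:
  assumes "span V m f" "span V n g"
  shows "SYM V (m + n) \<bullet> JN V m n \<bullet> (f \<boxtimes> g) = SYM V (m + n) \<bullet> JN V m n"
    and "(f \<boxtimes> g) \<bullet> CT V m n \<bullet> SYM V (m + n) = CT V m n \<bullet> SYM V (m + n)"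
proof -
  note s = span_simps [OF assms(1)] span_simps [OF assms(2)]
  obtain h where h: "span V (m + n) h" "h \<bullet> JN V m n = JN V m n \<bullet> (f \<boxtimes> ID (tpow C n V))"
    using span_block_left [OF assms(1)] by blast
  obtain k where k: "span V (m + n) k" "k \<bullet> JN V m n = JN V m n \<bullet> (ID (tpow C m V) \<boxtimes> g)"
    using span_block_right [OF assms(2)] by blast
  note t = span_simps [OF h(1)] span_simps [OF k(1)]
  let ?hk = "h \<bullet> k"
  have hk: "span V (m + n) ?hk" using h k by (intro span_cmp)
  have "?hk \<bullet> JN V m n = (h \<bullet> JN V m n) \<bullet> (ID (tpow C m V) \<boxtimes> g)" using s t k(2)
      by (simp add: cmp_assoc)
  also have "\<dots> = JN V m n \<bullet> (f \<boxtimes> g)" unfolding h(2) using s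
      by (simp add: cmp_assoc tens_cmp [symmetric])
  finally have J: "?hk \<bullet> JN V m n = JN V m n \<bullet> (f \<boxtimes> g)" .
  show "SYM V (m + n) \<bullet> JN V m n \<bullet> (f \<boxtimes> g) = SYM V (m + n) \<bullet> JN V m n"
    using t cmp_extend [OF SYM_absorb [OF hk], of "JN V m n"] by (simp add: J [symmetric] cmp_assoc)
  have "(f \<boxtimes> g) \<bullet> CT V m n = CT V m n \<bullet> (JN V m n \<bullet> (f \<boxtimes> g)) \<bullet> CT V m n"
    using s cmp_extend [OF JN_CT(2), where k = "(f \<boxtimes> g) \<bullet> CT V m n"] by (simp add: cmp_assoc)
  also have "\<dots> = CT V m n \<bullet> ?hk" unfolding J [symmetric] using t by (simp add: cmp_assoc)
  finally have "(f \<boxtimes> g) \<bullet> CT V m n = CT V m n \<bullet> ?hk" .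
  from cmp_extend [OF this, of "SYM V (m + n)"]
  show "(f \<boxtimes> g) \<bullet> CT V m n \<bullet> SYM V (m + n) = CT V m n \<bullet> SYM V (m + n)"
    using s t SYM_absorb_left [OF hk] by (simp add: cmp_assoc)
qed

lemma SYM_JN_swap:
  shows "SYM V (m + n) \<bullet> JN V n m \<bullet> SW (tpow C m V) (tpow C n V) = SYM V (m + n) \<bullet> JN V m n"
    and "SW (tpow C m V) (tpow C n V) \<bullet> CT V m n \<bullet> SYM V (m + n) = CT V n m \<bullet> SYM V (m + n)"
proof -
  obtain h where h: "span V (m + n) h" "h \<bullet> JN V m n = JN V n m \<bullet> SW (tpow C m V) (tpow C n V)"
    using span_block_swap by blast
  note s = span_simps [OF h(1)]
  have c: "n + m = m + n" by simp
  show "SYM V (m + n) \<bullet> JN V n m \<bullet> SW (tpow C m V) (tpow C n V) = SYM V (m + n) \<bullet> JN V m n"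
    using s cmp_extend [OF SYM_absorb [OF h(1)], of "JN V m n"] by (simp add: h(2) [symmetric])
  have "SW (tpow C m V) (tpow C n V) \<bullet> CT V m n = CT V n m \<bullet> (JN V n m \<bullet>
      SW (tpow C m V) (tpow C n V)) \<bullet> CT V m n"
    using cmp_extend [OF JN_CT(2), of V n m "SW (tpow C m V) (tpow C n V) \<bullet> CT V m n"]
        by (simp add: cmp_assoc c)
  also have "\<dots> = CT V n m \<bullet> h" unfolding h(2) [symmetric] using s by (simp add: cmp_assoc c)
  finally have "SW (tpow C m V) (tpow C n V) \<bullet> CT V m n = CT V n m \<bullet> h" .
  from cmp_extend [OF this, of "SYM V (m + n)"]
  show "SW (tpow C m V) (tpow C n V) \<bullet> CT V m n \<bullet> SYM V (m + n) = CT V n m \<bullet> SYM V (m + n)"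
    using s SYM_absorb_left [OF h(1)] by (simp add: cmp_assoc c)
qed

end

context acu_tensor_category
begin

section \<open>Partial traces\<close>

definition "SC c f = LU (trg f) \<bullet> (c \<boxtimes> f) \<bullet> LUI (src f)"

definition scalar where
  "scalar c \<longleftrightarrow> ar c \<and> src c = \<I> \<and> trg c = \<I>"

lemma scalar_simps: "scalar c \<Longrightarrow> ar c" "scalar c \<Longrightarrow> src c = \<I>" "scalar c \<Longrightarrow> trg c = \<I>"
  by (simp_all add: scalar_def)

lemma SC_simps [simp]: "\<lbrakk>scalar c; ar f\<rbrakk> \<Longrightarrow> ar (SC c f)" "src (SC c f) = src f"
    "trg (SC c f) = trg f"
  by (simp_all add: SC_def scalar_def)

lemma ap_SC [simp]:
  "\<lbrakk>scalar c; ar f; el x; obj x = src f; base x = L\<rbrakk> \<Longrightarrow> ap (SC c f) x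
      = smul (ap c (star (base x))) (ap f x)"
  by (simp add: SC_def scalar_def)

lemma SC_lin: "\<lbrakk>scalar c; scalar c'; ar f\<rbrakk> \<Longrightarrow> SC (lin q c q' c') f = lin q (SC c f) q' (SC c' f)"
  by (simp add: SC_def scalar_def lin_tens cmp_lin lin_cmp)

lemma SC_ID: assumes "ar f" shows "SC (ID \<I>) f = f"
proof -
  have "SC (ID \<I>) f = (LU (trg f) \<bullet> (ID \<I> \<boxtimes> f)) \<bullet> LUI (src f)"
    using assms by (simp add: SC_def cmp_assoc)
  also have "\<dots> = f" unfolding LU_natural [OF assms refl] using assms by (simp add: cmp_assoc)
  finally show ?thesis .
qed

text \<open>Arrows are linear over scalars, and \<open>s\<close> is \<open>s\<close> times the
  element 1. This reduces a coevaluation at an arbitrary scalar to its value at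
  \<open>star\<close>.\<close>

lemma ap_from_unit:
  assumes "ar c" "src c = \<I>" "el s" "obj s = \<I>"
  shows "ap c s = smul s (ap c (star (base s)))"
proof -
  have "ap c s = ap c (smul s (star (base s)))" using assms by simp
  also have "\<dots> = smul s (ap c (star (base s)))" using assms by (simp del: smul_star_right)
  finally show ?thesis .
qed

lemma ap_scalar_cmp:
  assumes c: "scalar c" and s: "el s" "obj s = \<I>"
  shows "ap c s = smul (ap c (star (base s))) s"
proof -
  have "ap c s = smul s (ap c (star (base s)))" using s scalar_simps [OF c] by (intro ap_from_unit)
  also have "\<dots> = smul (ap c (star (base s))) s" using s scalar_simps [OF c]
      by (simp add: smul_commute)
  finally show ?thesis .
qed

lemma SC_SC: assumes "scalar c" "scalar c'" "ar f" shows "SC c (SC c' f) = SC (c \<bullet> c') f" (is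
    "?l = ?r")
proof (rule arrow_eqI1)
  fix L x assume a: "wires L [(x, src f)]"
  have "ap c (ap c' (star L)) = smul (ap c (star L)) (ap c' (star L))"
    using ap_scalar_cmp [OF assms(1), of "ap c' (star L)"] scalar_simps [OF assms(2)] by simp
  then show "ap ?l x = ap ?r x"
    using a assms scalar_simps [OF assms(1)] scalar_simps [OF assms(2)] by (simp add: scalar_def)
qed (use assms scalar_simps [OF assms(1)] scalar_simps [OF assms(2)] in \<open>simp_all add: scalar_def\<close>)

lemma cmp_SC: "\<lbrakk>scalar c; ar f; ar g; trg f = src g\<rbrakk> \<Longrightarrow> g \<bullet> SC c f = SC c (g \<bullet> f)"
  by (rule arrow_eqI1 [where X = "src f"]) (simp_all add: scalar_simps)

lemma SC_cmp: "\<lbrakk>scalar c; ar f; ar g; trg f = src g\<rbrakk> \<Longrightarrow> SC c g \<bullet> f = SC c (g \<bullet> f)"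
  by (rule arrow_eqI1 [where X = "src f"]) (simp_all add: scalar_simps)

text \<open>The partial trace is built in two stages. \<open>ptr_body\<close> still has the strands
  \<open>U\<close> and \<open>D\<close> as inputs and can be computed on pure tensors;
  \<open>ptr\<close> then feeds the coevaluation into them.\<close>

definition "ptr_body e D U X Y f = CL e D U Y \<bullet> (ID D \<boxtimes> f) \<bullet> ASS D U X \<bullet> (SW U D \<boxtimes> ID X)"
definition "ptr e c D U X Y f = ptr_body e D U X Y f \<bullet> (c \<boxtimes> ID X) \<bullet> LUI X"

lemma ptr_simps:
  assumes "dualpair D U e c" "ar f" "src f = U \<otimes>\<^sub>o X" "trg f = U \<otimes>\<^sub>o Y"
  shows "ar (ptr_body e D U X Y f)" "src (ptr_body e D U X Y f) = (U \<otimes>\<^sub>o D) \<otimes>\<^sub>o X"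
      "trg (ptr_body e D U X Y f) = Y"
    "ar (ptr e c D U X Y f)" "src (ptr e c D U X Y f) = X" "trg (ptr e c D U X Y f) = Y"
  using assms(2-) dualpair_simps [OF assms(1)] by (simp_all add: ptr_body_def ptr_def)

lemma ap_ptr_body:
  assumes "dualpair D U e c" "ar f" "src f = U \<otimes>\<^sub>o X" "trg f = U \<otimes>\<^sub>o Y"
    "el u" "el d" "el x" "obj u = U" "obj d = D" "obj x = X" "dj u d" "dj u x" "dj d x"
  shows "ap (ptr_body e D U X Y f) (pair (pair u d) x) = ap (CL e D U Y) (pair d (ap f (pair u x)))"
  using assms(2-) dualpair_simps [OF assms(1)] by (simp add: ptr_body_def dj_sym [of u d])

lemma ap_ptr:
  assumes "dualpair D U e c" "ar f" "src f = U \<otimes>\<^sub>o X" "trg f = U \<otimes>\<^sub>o Y" "el x" "obj x = X"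
  shows "ap (ptr e c D U X Y f) x = ap (ptr_body e D U X Y f) (pair (ap c (star (base x))) x)"
  using assms(2-) dualpair_simps [OF assms(1)] by (simp add: ptr_def ptr_simps [OF assms(1)])

lemma CL_natural:
  assumes e: "bil e D U" and g: "ar g" "src g = Y" "trg g = Y'"
      and w: "el w" "obj w = U \<otimes>\<^sub>o Y" "el d" "obj d = D" "dj d w"
  shows "ap (CL e D U Y') (pair d (ap (ID U \<boxtimes> g) w)) = ap g (ap (CL e D U Y) (pair d w))"
proof -
  have "CL e D U Y' \<bullet> (ID D \<boxtimes> ID U \<boxtimes> g) = g \<bullet> CL e D U Y"
    by (rule arrow_eqI3r) (simp_all add: e g bil_simps [OF e])
  from arg_cong [OF this, of "\<lambda>h. ap h (pair d w)"] show ?thesis using w g e by (simp del: tens_ID)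
qed

lemma ptr_post:
  assumes d: "dualpair D U e c" and f: "ar f" "src f = U \<otimes>\<^sub>o X" "trg f = U \<otimes>\<^sub>o Y"
    and g: "ar g" "src g = Y" "trg g = Y'"
  shows "ptr e c D U X Y' ((ID U \<boxtimes> g) \<bullet> f) = g \<bullet> ptr e c D U X Y f"
proof -
  note s = dualpair_simps [OF d]
  have "ptr_body e D U X Y' ((ID U \<boxtimes> g) \<bullet> f) = g \<bullet> ptr_body e D U X Y f"
    by (rule arrow_eqI3l) (simp_all add: f g s ptr_simps [OF d] ap_ptr_body [OF d] CL_natural [where
        Y = Y])
  then show ?thesis using f g s ptr_simps [OF d f] by (simp add: ptr_def cmp_assoc)
qed

lemma ptr_pre:
  assumes d: "dualpair D U e c" and f: "ar f" "src f = U \<otimes>\<^sub>o X" "trg f = U \<otimes>\<^sub>o Y"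
    and g: "ar g" "src g = X'" "trg g = X"
  shows "ptr e c D U X' Y (f \<bullet> (ID U \<boxtimes> g)) = ptr e c D U X Y f \<bullet> g"
proof -
  note s = dualpair_simps [OF d]
  have b: "ptr_body e D U X' Y (f \<bullet> (ID U \<boxtimes> g)) = ptr_body e D U X Y f \<bullet> (ID (U \<otimes>\<^sub>o D) \<boxtimes> g)"
    by (rule arrow_eqI3l) (simp_all add: f g s ptr_simps [OF d] ap_ptr_body [OF d])
  show ?thesis
    by (rule arrow_eqI1 [where X = X']) (simp_all add: f g s ptr_simps [OF d] ap_ptr [OF d] b)
qed

lemma ptr_lin:
  assumes d: "dualpair D U e c" and f: "ar f" "src f = U \<otimes>\<^sub>o X" "trg f = U \<otimes>\<^sub>o Y"
    and g: "ar g" "src g = U \<otimes>\<^sub>o X" "trg g = U \<otimes>\<^sub>o Y"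
  shows "ptr e c D U X Y (lin q f q' g) = lin q (ptr e c D U X Y f) q' (ptr e c D U X Y g)"
  using f g dualpair_simps [OF d] by (simp add: ptr_def ptr_body_def lin_cmp cmp_lin tens_lin)

lemma ptr_SC:
  assumes d: "dualpair D U e c" and f: "ar f" "src f = U \<otimes>\<^sub>o X" "trg f = U \<otimes>\<^sub>o Y" and c: "scalar k"
  shows "ptr e c D U X Y (SC k f) = SC k (ptr e c D U X Y f)"
proof -
  note s = dualpair_simps [OF d]
  have b: "ptr_body e D U X Y (SC k f) = SC k (ptr_body e D U X Y f)"
    by (rule arrow_eqI3l) (simp_all add: f s c scalar_simps [OF c] ptr_simps [OF d] ap_ptr_body [OF
        d])
  show ?thesis
    by (rule arrow_eqI1 [where X = X]) (simp_all add: f s c ptr_simps [OF d] ap_ptr [OF d] b)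
qed

lemma ptr_ID:
  assumes d: "dualpair D U e c"
  shows "ptr e c D U X X (ID (U \<otimes>\<^sub>o X)) = SC (e \<bullet> SW U D \<bullet> c) (ID X)"
proof -
  note s = dualpair_simps [OF d]
  have b: "ptr_body e D U X X (ID (U \<otimes>\<^sub>o X)) = LU X \<bullet> ((e \<bullet> SW U D) \<boxtimes> ID X)"
    by (rule arrow_eqI3l) (simp_all add: s ptr_simps [OF d] ap_ptr_body [OF d])
  have r: "scalar (e \<bullet> SW U D \<bullet> c)" by (simp add: scalar_def s)
  show ?thesis
    by (rule arrow_eqI1 [where X = X]) (simp_all add: r s ptr_simps [OF d] ap_ptr [OF d] b)
qed

text \<open>The strand that runs through the crossing and back around the loop can be pulled
  straight, by the first triangle identity.\<close>

lemma ptr_cross: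
  assumes d: "dualpair D U e c"
  shows "ptr e c D U (U \<otimes>\<^sub>o X) (U \<otimes>\<^sub>o X) (cross U U X) = ID (U \<otimes>\<^sub>o X)"
proof -
  note s = dualpair_simps [OF d]
  have b: "ptr_body e D U (U \<otimes>\<^sub>o X) (U \<otimes>\<^sub>o X) (cross U U X) = (CR e U D U \<boxtimes> ID X) \<bullet>
      ASSI (U \<otimes>\<^sub>o D) U X"
    by (rule arrow_eqI4) (simp_all add: s ptr_simps [OF d] ap_ptr_body [OF d])
  show ?thesis
    by (rule arrow_eqI2 [where X = U and Y = X]) (simp_all add: s ptr_simps [OF d] ap_ptr [OF d] b
        ap_CR_coev [OF d])
qed

text \<open>Closing a product of strands closes first \<open>U\<close> and then \<open>U'\<close>.
  This allows an induction on the number of closed strands.\<close>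

lemma ptr_tens:
  assumes d: "dualpair D U e c" and d': "dualpair D' U' e' c'"
    and f: "ar f" "src f = (U \<otimes>\<^sub>o U') \<otimes>\<^sub>o X" "trg f = (U \<otimes>\<^sub>o U') \<otimes>\<^sub>o Y"
  shows "ptr (C1324 e e' D D' U U') (tens_coev U D c U' D' c') (D \<otimes>\<^sub>o D') (U \<otimes>\<^sub>o U') X Y f
    = ptr e' c' D' U' X Y (ptr e c D U (U' \<otimes>\<^sub>o X) (U' \<otimes>\<^sub>o Y) (ASS U U' Y \<bullet> f \<bullet> ASSI U U' X))"
proof -
  note s = dualpair_simps [OF d] dualpair_simps [OF d']
  note dd = dualpair_tens [OF d d']
  let ?E = "C1324 e e' D D' U U'" and ?f = "ASS U U' Y \<bullet> f \<bullet> ASSI U U' X"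
  have f': "ar ?f" "src ?f = U \<otimes>\<^sub>o (U' \<otimes>\<^sub>o X)" "trg ?f = U \<otimes>\<^sub>o (U' \<otimes>\<^sub>o Y)" using f by simp_all
  have CC: "CL ?E (D \<otimes>\<^sub>o D') (U \<otimes>\<^sub>o U') Y = CL e' D' U' Y \<bullet> (ID D' \<boxtimes> (CL e D U (U' \<otimes>\<^sub>o Y) \<bullet>
      (ID D \<boxtimes> ASS U U' Y)))
       \<bullet> ASS D' D ((U \<otimes>\<^sub>o U') \<otimes>\<^sub>o Y) \<bullet> (SW D D' \<boxtimes> ID ((U \<otimes>\<^sub>o U') \<otimes>\<^sub>o Y))"
    by (rule arrow_eqI5m) (simp_all add: s smul_ac)
  have CC': "ap (CL ?E (D \<otimes>\<^sub>o D') (U \<otimes>\<^sub>o U') Y) (pair (pair a b) w)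
      = ap (CL e' D' U' Y) (pair b (ap (CL e D U (U' \<otimes>\<^sub>o Y)) (pair a (ap (ASS U U' Y) w))))"
    if "el a" "el b" "el w" "obj a = D" "obj b = D'" "obj w = (U \<otimes>\<^sub>o U') \<otimes>\<^sub>o Y" "dj a b" "dj b a"
        "dj a w" "dj b w" for a b w
    unfolding CC using that by (simp add: s)
  let ?B = "ptr_body e D U (U' \<otimes>\<^sub>o X) (U' \<otimes>\<^sub>o Y) ?f"
  note B = ptr_simps [OF d f']
  have 1: "ptr_body ?E (D \<otimes>\<^sub>o D') (U \<otimes>\<^sub>o U') X Y f \<bullet> (XCH U D U' D' \<boxtimes> ID X)
      = CL e' D' U' Y \<bullet> (ID D' \<boxtimes> ?B) \<bullet> ASS D' (U \<otimes>\<^sub>o D) (U' \<otimes>\<^sub>o X) \<bullet> (SW (U \<otimes>\<^sub>o D) D' \<boxtimes> ID (U' \<otimes>\<^sub>o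
          X))
        \<bullet> ASSI (U \<otimes>\<^sub>o D) D' (U' \<otimes>\<^sub>o X) \<bullet> (ID (U \<otimes>\<^sub>o D) \<boxtimes> (ASS D' U' X \<bullet> (SW U' D' \<boxtimes> ID X))) \<bullet> ASS (U
            \<otimes>\<^sub>o D) (U' \<otimes>\<^sub>o D') X"
    by (rule arrow_eqI5l) (simp_all add: s f f' B CC' ptr_simps [OF dd] ap_ptr_body [OF dd]
        ap_ptr_body [OF d f'])
  let ?P = "ptr e c D U (U' \<otimes>\<^sub>o X) (U' \<otimes>\<^sub>o Y) ?f"
  have 2: "CL e' D' U' Y \<bullet> (ID D' \<boxtimes> ?B) \<bullet> ASS D' (U \<otimes>\<^sub>o D) (U' \<otimes>\<^sub>o X) \<bullet>
      (SW (U \<otimes>\<^sub>o D) D' \<boxtimes> ID (U' \<otimes>\<^sub>o X))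
        \<bullet> ASSI (U \<otimes>\<^sub>o D) D' (U' \<otimes>\<^sub>o X) \<bullet> (ID (U \<otimes>\<^sub>o D) \<boxtimes> (ASS D' U' X \<bullet> (SW U' D' \<boxtimes> ID X))) \<bullet> (c \<boxtimes>
            ID ((U' \<otimes>\<^sub>o D') \<otimes>\<^sub>o X))
      = ptr_body e' D' U' X Y ?P \<bullet> LU ((U' \<otimes>\<^sub>o D') \<otimes>\<^sub>o X)"
  proof (rule arrow_eqI4m [where X = \<I> and Y = U' and Z = D' and W = X])
    fix L x y z w assume a: "wires L [(x, \<I>), (y, U'), (z, D'), (w, X)]"
    \<comment> \<open>The inner trace is expressed through \<open>ap c (star L)\<close>, so the unit
      variable \<open>x\<close> has to be split off as a scalar.\<close>
    have "ap c x = smul x (ap c (star L))" using ap_from_unit [of c x] a s by simp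
    then show "ap (CL e' D' U' Y \<bullet> (ID D' \<boxtimes> ?B) \<bullet> ASS D' (U \<otimes>\<^sub>o D) (U' \<otimes>\<^sub>o X) \<bullet>
        (SW (U \<otimes>\<^sub>o D) D' \<boxtimes> ID (U' \<otimes>\<^sub>o X))
        \<bullet> ASSI (U \<otimes>\<^sub>o D) D' (U' \<otimes>\<^sub>o X) \<bullet> (ID (U \<otimes>\<^sub>o D) \<boxtimes> (ASS D' U' X \<bullet> (SW U' D' \<boxtimes> ID X))) \<bullet> (c \<boxtimes>
            ID ((U' \<otimes>\<^sub>o D') \<otimes>\<^sub>o X)))
        (pair x (pair (pair y z) w)) = ap (ptr_body e' D' U' X Y ?P \<bullet> LU ((U' \<otimes>\<^sub>o D') \<otimes>\<^sub>o X)) (pair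
            x (pair (pair y z) w))"
      using a by (simp add: s f f' B ap_ptr [OF d f'] ptr_simps [OF d'] ap_ptr_body [OF d'])
  qed (simp_all add: s f f' B ptr_simps [OF d'])
  show ?thesis
  proof (rule arrow_eqI1 [where X = X])
    fix L x assume a: "wires L [(x, X)]"
    let ?u = "ap c (star L)" and ?u' = "ap c' (star L)"
    have tc: "ap (tens_coev U D c U' D' c') (star L) = ap (XCH U D U' D') (pair ?u ?u')"
      by (simp add: tens_coev_def s)
    have "ap (ptr_body ?E (D \<otimes>\<^sub>o D') (U \<otimes>\<^sub>o U') X Y f \<bullet> (XCH U D U' D' \<boxtimes> ID X)) (pair (pair ?u ?u')
        x)
        = ap (ptr_body e' D' U' X Y ?P \<bullet> LU ((U' \<otimes>\<^sub>o D') \<otimes>\<^sub>o X)) (pair (star L) (pair ?u' x))"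
      unfolding 1 unfolding 2 [symmetric] using a by (simp add: s B)
    then show "ap (ptr ?E (tens_coev U D c U' D' c') (D \<otimes>\<^sub>o D') (U \<otimes>\<^sub>o U') X Y f) x
        = ap (ptr e' c' D' U' X Y ?P) x"
      using a by (simp add: s B f f' ap_ptr [OF dd] ap_ptr [OF d'] ptr_simps [OF dd] ptr_simps [OF
          d'] tc)
  qed (use f B in \<open>simp_all add: ptr_simps [OF dd] ptr_simps [OF d']\<close>)
qed

end

section \<open>Partial traces of the symmetrizer\<close>

context rigid_tensor_category
begin

definition "RK V = Arrow \<I> (rank C V) \<I>"

lemma RK_eq: "RK V = evA V \<bullet> SW V V\<^sup>\<or> \<bullet> coevA V"
  by (simp add: RK_def rank_def evA_def SW_def coevA_def cmp_def)

lemma scalar_RK [simp]: "scalar (RK V)"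
  using dualpair_simps [OF dualpair_coev [of V]] by (simp add: RK_eq scalar_def)

text \<open>This is (r + n)/(n + 1), written with the two weights that occur in
  \<open>bavg V n\<close>: the identity closes to the rank, and the remaining term to an average
  that is absorbed.\<close>

definition "ratio V n = lin (1 / (of_nat n + 1)) (RK V) (of_nat n / (of_nat n + 1)) (ID \<I>)"

lemma scalar_ratio [simp]: "scalar (ratio V n)"
  using scalar_simps [OF scalar_RK [of V]] by (simp add: ratio_def scalar_def)

lemma Mor_add_zero: "f \<in> Hom C X Y \<Longrightarrow> f \<oplus>\<^bsub>Mor C X Y\<^esub> \<zero>\<^bsub>Mor C X Y\<^esub> = f"
  by (rule abelian_monoid.r_zero [OF abelian_group.axioms(1) [OF Mor_abelian_group]])

lemma lin_1_0: "\<lbrakk>ar f; ar g; src g = src f; trg g = trg f\<rbrakk> \<Longrightarrow> lin 1 f 0 g = f"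
  by (cases f) (auto simp: lin_def ar_def Mor_smult_one Mor_smult_zero_left Mor_add_zero)

abbreviation "ptrV V X Y f \<equiv> ptr (evA V) (coevA V) V\<^sup>\<or> V X Y f"

lemma ptr_SYM: "ptrV V (tpow C n V) (tpow C n V) (SYM V (Suc n)) = SC (ratio V n) (SYM V n)"
proof -
  note d = dualpair_coev [of V]
  note i = ptr_ID [OF d, folded RK_eq]
  have "ptrV V (tpow C n V) (tpow C n V) (SYM V (Suc n))
      = SYM V n \<bullet> ptrV V (tpow C n V) (tpow C n V) (bavg V n)"
    unfolding SYM_Suc by (rule ptr_post [OF d]) simp_all
  also have "\<dots> = SC (ratio V n) (SYM V n)"
  proof (cases n)
    case 0
    have r: "ratio V 0 = RK V"
      using scalar_simps [OF scalar_RK [of V]] by (simp add: ratio_def lin_1_0)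
    show ?thesis by (simp add: 0 i r cmp_SC)
  next
    case (Suc m)
    let ?a = "1 / (of_nat m + 2) :: rat" and ?a' = "(of_nat m + 1) / (of_nat m + 2) :: rat"
    have "ptrV V (tpow C n V) (tpow C n V) (cross V V (tpow C m V) \<bullet> (ID V \<boxtimes> bavg V m))
        = ptrV V (tpow C n V) (tpow C n V) (cross V V (tpow C m V)) \<bullet> bavg V m"
      unfolding Suc by (rule ptr_pre [OF d]) simp_all
    also have "\<dots> = bavg V m" by (simp add: Suc ptr_cross [OF d])
    finally have "ptrV V (tpow C n V) (tpow C n V) (bavg V n)
        = lin ?a (SC (RK V) (ID (tpow C n V))) ?a' (bavg V m)"
      unfolding Suc bavg.simps by (subst ptr_lin [OF d]) (simp_all add: i)
    then have "SYM V n \<bullet> ptrV V (tpow C n V) (tpow C n V) (bavg V n)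
        = lin ?a (SC (RK V) (SYM V n)) ?a' (SYM V n)"
      using SYM_absorb [OF span_bavg, of V m] by (simp add: Suc cmp_lin cmp_SC)
    also have "\<dots> = SC (lin ?a (RK V) ?a' (ID \<I>)) (SYM V n)"
      by (subst SC_lin) (simp_all add: SC_ID scalar_def [of "ID \<I>"])
    also have "lin ?a (RK V) ?a' (ID \<I>) = ratio V n" by (simp add: ratio_def Suc add.commute)
    finally show ?thesis .
  qed
  finally show ?thesis .
qed

text \<open>The product of (r + n)/(n + 1) over all n with i \<le> n < k + i: what remains of
  closing \<open>k\<close> strands of the symmetrizer on \<open>k + i\<close> factors.\<close>

primrec ratios where
  "ratios V 0 i = ID \<I>"
| "ratios V (Suc k) i = ratio V (k + i) \<bullet> ratios V k i"

lemma scalar_ratios [simp]: "scalar (ratios V k i)"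
  by (induction k) (use scalar_simps [OF scalar_ratio [of V]] in \<open>auto simp: scalar_def\<close>)

lemma CT_Suc: "CT V (Suc k) i = ASSI V (tpow C k V) (tpow C i V) \<bullet> (ID V \<boxtimes> CT V k i)"
proof (rule inverses_cancel_left [OF inverses_JN])
  have "JN V (Suc k) i \<bullet> ASSI V (tpow C k V) (tpow C i V) \<bullet> (ID V \<boxtimes> CT V k i)
      = ID (tpow C (Suc k + i) V)"
    by (simp add: JN_Suc cmp_assoc tens_ID_cmp)
  then show "JN V (Suc k) i \<bullet> CT V (Suc k) i = JN V (Suc k) i \<bullet> ASSI V (tpow C k V) (tpow C i V) \<bullet>
      (ID V \<boxtimes> CT V k i)"
    by simp
qed simp_all

text \<open>The symmetrizer seen on a block of \<open>k\<close> strands, which will be closed, and a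
  block of \<open>i\<close> strands, which stay open.\<close>

definition "SYMB V k i = CT V k i \<bullet> SYM V (k + i) \<bullet> JN V k i"

lemma SYMB_simps [simp]: "ar (SYMB V k i)" "src (SYMB V k i) = tpow C k V \<otimes>\<^sub>o tpow C i V"
    "trg (SYMB V k i) = tpow C k V \<otimes>\<^sub>o tpow C i V"
  by (simp_all add: SYMB_def)

text \<open>Strands are closed one by one from the front. Closing the first of \<open>Suc k\<close>
  leaves the symmetrizer with one factor fewer, multiplied by
  \<open>ratio V (k + i)\<close>.\<close>

lemma ptr_SYMB:
  "ptr (EP k V) (CP k V) (tpow C k V\<^sup>\<or>) (tpow C k V) (tpow C i V) (tpow C i V) (SYMB V k i)
      = SC (ratios V k i) (SYM V i)"
proof (induction k)
  case 0
  note d = dualpair_unit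
  have b: "ptr_body (LU \<I>) \<I> \<I> (tpow C i V) (tpow C i V) (SYMB V 0 i) = LU (tpow C i V) \<bullet>
      (LU \<I> \<boxtimes> SYM V i)"
  proof (rule arrow_eqI3l)
    fix L x y z assume a: "wires L [(x, \<I>), (y, \<I>), (z, tpow C i V)]"
    have c: "ap (CT V 0 i) w = pair (star (base w)) w" if "el w" "obj w = tpow C i V" for w
      using ap_CT_JN [of "pair (star (base w)) w" 0 V i] that by simp
    show "ap (ptr_body (LU \<I>) \<I> \<I> (tpow C i V) (tpow C i V) (SYMB V 0 i)) (pair (pair x y) z)
        = ap (LU (tpow C i V) \<bullet> (LU \<I> \<boxtimes> SYM V i)) (pair (pair x y) z)"
      using a by (simp add: ap_ptr_body [OF d] SYMB_def c smul_ac)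
  qed (simp_all add: ptr_simps [OF d])
  have "ptr (LU \<I>) (LUI \<I>) \<I> \<I> (tpow C i V) (tpow C i V) (SYMB V 0 i) = SYM V i"
    by (rule arrow_eqI1 [where X = "tpow C i V"]) (simp_all add: ap_ptr [OF d] ptr_simps [OF d] b)
  then show ?case by (simp add: EP_0 SC_ID)
next
  case (Suc k)
  let ?T = "tpow C i V" and ?S = "tpow C k V"
  note d = dualpair_coev [of V] and d' = dualpair_tpow [of k V]
  have "ASS V ?S ?T \<bullet> SYMB V (Suc k) i \<bullet> ASSI V ?S ?T = (ID V \<boxtimes> CT V k i) \<bullet> SYM V (Suc (k + i)) \<bullet>
      (ID V \<boxtimes> JN V k i)"
    by (simp add: SYMB_def CT_Suc JN_Suc cmp_assoc)
  moreover have "ptrV V (?S \<otimes>\<^sub>o ?T) (?S \<otimes>\<^sub>o ?T) \<dots>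
      = CT V k i \<bullet> ptrV V (tpow C (k + i) V) (tpow C (k + i) V) (SYM V (Suc (k + i))) \<bullet> JN V k i"
    by (subst ptr_post [OF d, where Y = "tpow C (k + i) V"], simp_all)
      (subst ptr_pre [OF d, where X = "tpow C (k + i) V"], simp_all)
  moreover have "\<dots> = SC (ratio V (k + i)) (SYMB V k i)"
    by (simp add: ptr_SYM SYMB_def cmp_SC SC_cmp)
  ultimately have *: "ptrV V (?S \<otimes>\<^sub>o ?T) (?S \<otimes>\<^sub>o ?T) (ASS V ?S ?T \<bullet> SYMB V (Suc k) i \<bullet> ASSI V ?S ?T)
      = SC (ratio V (k + i)) (SYMB V k i)" by simp
  have "ptr (EP (Suc k) V) (CP (Suc k) V) (tpow C (Suc k) V\<^sup>\<or>) (tpow C (Suc k) V) ?T ?T (SYMB V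
      (Suc k) i)
      = ptr (EP k V) (CP k V) (tpow C k V\<^sup>\<or>) ?S ?T ?T (SC (ratio V (k + i)) (SYMB V k i))"
    unfolding EP_Suc CP.simps tpow.simps by (subst ptr_tens [OF d d']) (simp_all add: *)
  also have "\<dots> = SC (ratio V (k + i)) (SC (ratios V k i) (SYM V i))"
    by (subst ptr_SC [OF d']) (simp_all add: Suc)
  also have "\<dots> = SC (ratios V (Suc k) i) (SYM V i)" by (simp add: SC_SC)
  finally show ?case .
qed

section \<open>The coefficient as a binomial\<close>

lemma mor_SC: "mor (SC c f) = act C (src f) (trg f) (mor c) (mor f)"
  by (simp add: SC_def act_def LU_def LUI_def)

abbreviation "EI \<equiv> Mor C \<I> \<I>"

definition "shifted V q = rank C V \<oplus>\<^bsub>EI\<^esub> q \<odot>\<^bsub>EI\<^esub> \<^bold>1 \<I>"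

lemma rank_closed: "rank C V \<in> Hom C \<I> \<I>"
  using scalar_simps [OF scalar_RK [of V]] by (simp add: ar_def RK_def)

lemma shifted_closed: "shifted V q \<in> Hom C \<I> \<I>"
  by (simp add: shifted_def rank_closed Mor_add_closed Mor_smult_closed Ident_closed)

lemma shifted_add: "shifted V q \<oplus>\<^bsub>EI\<^esub> q' \<odot>\<^bsub>EI\<^esub> \<^bold>1 \<I> = shifted V (q + q')"
  by (simp add: shifted_def Mor_add_ac(1) Mor_smult_add Mor_smult_closed rank_closed Ident_closed)

lemma falling_closed: "falling C (shifted V q) k \<in> Hom C \<I> \<I>"
  by (induction k) (auto simp: shifted_add shifted_closed Ident_closed intro: Comp_closed)

text \<open>\<open>falling\<close> appends its smallest factor, whereas the recursion of
  \<open>ratios\<close> contributes the largest one, r + k + i. The product therefore has to be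
  unrolled from the other end.\<close>

lemma falling_rec: "falling C (shifted V q) (Suc k) = shifted V q \<cdot> falling C (shifted V (q - 1)) k"
proof (induction k)
  case 0
  show ?case using shifted_closed [of V q]
    by (simp add: Comp_Ident_left Comp_Ident_right Mor_smult_zero_left Ident_closed shifted_add
        Mor_add_zero)
next
  case (Suc k)
  have e: "q + - of_nat (Suc k) = q - 1 + - of_nat k" by simp
  have "falling C (shifted V q) (Suc (Suc k)) = falling C (shifted V q) (Suc k) \<cdot> shifted V (q - 1 +
      - of_nat k)"
    by (simp only: falling.simps(2) [of _ _ "Suc k"] shifted_add e)
  also have "\<dots> = shifted V q \<cdot> (falling C (shifted V (q - 1)) k \<cdot> shifted V (q - 1 + - of_nat k))"
    unfolding Suc by (rule Comp_assoc [OF shifted_closed falling_closed shifted_closed])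
  also have "falling C (shifted V (q - 1)) k \<cdot> shifted V (q - 1 + - of_nat k)
      = falling C (shifted V (q - 1)) (Suc k)"
    by (simp only: falling.simps(2) shifted_add)
  finally show ?case .
qed

lemma mor_ratio: "mor (ratio V n) = (1 / (of_nat n + 1)) \<odot>\<^bsub>EI\<^esub> shifted V (of_nat n)"
  by (simp add: ratio_def RK_def lin_def shifted_def Mor_smult_distrib Mor_smult_smult rank_closed
      Ident_closed Mor_smult_closed)

lemma mor_ratios: "mor (ratios V k i) = (fact i / fact (k + i)) \<odot>\<^bsub>EI\<^esub> falling C (shifted V (of_nat
    (k + i) - 1)) k"
proof (induction k)
  case 0
  show ?case by (simp add: Mor_smult_one Ident_closed)
next
  case (Suc k)
  let ?F = "falling C (shifted V (of_nat (k + i) - 1)) k" and ?t = "shifted V (of_nat (k + i))"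
  have nz: "(of_nat k + of_nat i + 1 :: rat) \<noteq> 0" using of_nat_neq_0 [of "k + i", where 'a = rat]
      by (simp add: add.commute add.left_commute)
  have "mor (ratios V (Suc k) i) = ((1 / (of_nat (k + i) + 1)) \<odot>\<^bsub>EI\<^esub> ?t) \<cdot> ((fact i / fact (k + i))
      \<odot>\<^bsub>EI\<^esub> ?F)"
    by (simp add: Suc mor_ratio)
  also have "\<dots> = (fact i / fact (Suc k + i)) \<odot>\<^bsub>EI\<^esub> (?t \<cdot> ?F)"
    using shifted_closed [of V] falling_closed [of V]
    by (simp add: Comp_smult_left [where X = \<I> and Y = \<I> and Z = \<I>] Comp_smult_right [where X = \<I>
        and Y = \<I> and Z = \<I>]
      Mor_smult_closed Mor_smult_smult Comp_closed [where X = \<I> and Y = \<I>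
          and Z = \<I>]) (simp add: algebra_simps)
  also have "?t \<cdot> ?F = falling C (shifted V (of_nat (Suc k + i) - 1)) (Suc k)"
    unfolding falling_rec by simp
  finally show ?case .
qed

text \<open>With g = k + i both sides are i!/g! times the product (r + g - 1) ... (r + i).\<close>

lemma mor_ratios_coeff: "mor (ratios V k i) = coeff C V (k + i) k"
proof -
  have "fact (k + i) = fact k * fact i * (of_nat ((k + i) choose k) :: rat)"
    using binomial_fact_lemma [of k "k + i"]
        by (metis add_diff_cancel_left' le_add1 of_nat_fact of_nat_mult)
  then have "1 / of_nat ((k + i) choose k) * (1 / fact k) = (fact i / fact (k + i) :: rat)" by simp
  then show ?thesis unfolding mor_ratios coeff_def binom_def shifted_def [symmetric]
    by (simp add: Mor_smult_smult falling_closed)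
qed

end

context pseudo_abelian_rigid_tensor_category_with_Sym
begin

section \<open>Symmetric powers\<close>

definition "SI n V = Arrow (Sym C n V) (Sym_inj C n V) (tpow C n V)"
definition "SP n V = Arrow (tpow C n V) (Sym_prj C n V) (Sym C n V)"

lemma SI_simps [simp]: "src (SI n V) = Sym C n V" "trg (SI n V) = tpow C n V" "ar (SI n V)"
    "src (SP n V) = tpow C n V" "trg (SP n V) = Sym C n V" "ar (SP n V)"
  using Sym_splitting [of n V] by (simp_all add: SI_def SP_def is_splitting_def)

lemma SP_SI: "SP n V \<bullet> SI n V = ID (Sym C n V)" and SI_SP: "SI n V \<bullet> SP n V = SYM V n"
  using Sym_splitting [of n V] by (simp_all add: SI_def SP_def SYM_def ID_def cmp_def
      is_splitting_def)

lemma SYM_SI: "SYM V n \<bullet> SI n V = SI n V"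
  unfolding SI_SP [symmetric] by (simp add: cmp_assoc SP_SI)

lemma SP_SYM: "SP n V \<bullet> SYM V n = SP n V"
proof -
  have "SP n V \<bullet> SI n V \<bullet> SP n V = SP n V" by (simp add: cmp_extend [OF SP_SI])
  then show ?thesis by (simp add: SI_SP)
qed

lemma ap_SP_SI [simp]: "\<lbrakk>el x; obj x = Sym C n V\<rbrakk> \<Longrightarrow> ap (SP n V) (ap (SI n V) x) = x"
  using arg_cong [OF SP_SI [of n V], of "\<lambda>h. ap h x"] by simp

lemma ap_SI_SP: "\<lbrakk>el x; obj x = tpow C n V\<rbrakk> \<Longrightarrow> ap (SI n V) (ap (SP n V) x) = ap (SYM V n) x"
  using arg_cong [OF SI_SP [of n V], of "\<lambda>h. ap h x"] by simp

lemma ap_SYM_SI [simp]: "\<lbrakk>el x; obj x = Sym C n V\<rbrakk> \<Longrightarrow> ap (SYM V n) (ap (SI n V) x) = ap (SI n V) x"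
  using arg_cong [OF SYM_SI [of V n], of "\<lambda>h. ap h x"] by simp

lemma ap_SP_SYM [simp]: "\<lbrakk>el x; obj x = tpow C n V\<rbrakk> \<Longrightarrow> ap (SP n V) (ap (SYM V n) x) = ap (SP n V) x"
  using arg_cong [OF SP_SYM [of n V], of "\<lambda>h. ap h x"] by simp

lemma EP_SYM:
  "\<lbrakk>el d; el x; obj d = tpow C n V\<^sup>\<or>; obj x = tpow C n V; dj d x\<rbrakk>
    \<Longrightarrow> ap (EP n V) (pair (ap (SYM V\<^sup>\<or> n) d) x) = ap (EP n V) (pair d (ap (SYM V n) x))"
  by (rule adjointD [OF SYM_adjoint bil_EP]) simp_all

definition "ES n V = Arrow (Sym C n V\<^sup>\<or> \<otimes>\<^sub>o Sym C n V) (ev_Sym C n V) \<I>"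
definition "EST n V = Arrow (Sym C n V \<otimes>\<^sub>o Sym C n V\<^sup>\<or>) (ev_Sym_tau C n V) \<I>"
definition "MU i j V = Arrow (Sym C i V \<otimes>\<^sub>o Sym C j V) (Sym_mult C i j V) (Sym C (i + j) V)"

lemma ES_eq: "ES n V = EP n V \<bullet> (SI n V\<^sup>\<or> \<boxtimes> SI n V)"
  by (simp add: ES_def EP_def SI_def cmp_def tens_def ev_Sym_def)

lemma EST_eq: "EST n V = ES n V \<bullet> SW (Sym C n V) (Sym C n V\<^sup>\<or>)"
  by (simp add: EST_def ES_def SW_def cmp_def ev_Sym_tau_def)

lemma MU_eq: "MU i j V = SP (i + j) V \<bullet> JN V i j \<bullet> (SI i V \<boxtimes> SI j V)"
  by (simp add: MU_def SI_def SP_def JN_def cmp_def tens_def Sym_mult_def)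

lemma bil_ES [simp]: "bil (ES n V) (Sym C n V\<^sup>\<or>) (Sym C n V)"
    and bil_EST [simp]: "bil (EST n V) (Sym C n V) (Sym C n V\<^sup>\<or>)"
  by (simp_all add: bil_def ES_eq EST_eq)

lemma ES_simps [simp]: "src (ES n V) = Sym C n V\<^sup>\<or> \<otimes>\<^sub>o Sym C n V" "trg (ES n V) = \<I>" "ar (ES n V)"
    "src (EST n V) = Sym C n V \<otimes>\<^sub>o Sym C n V\<^sup>\<or>" "trg (EST n V) = \<I>" "ar (EST n V)"
    "src (MU i j V) = Sym C i V \<otimes>\<^sub>o Sym C j V" "trg (MU i j V) = Sym C (i + j) V" "ar (MU i j V)"
  by (simp_all add: ES_eq EST_eq MU_eq)

lemma ap_EST [simp]: "\<lbrakk>el x; el d; obj x = Sym C n V; obj d = Sym C n V\<^sup>\<or>; dj x d; dj d x\<rbrakk>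
    \<Longrightarrow> ap (EST n V) (pair x d) = ap (ES n V) (pair d x)"
  by (simp add: EST_eq)

lemma ap_ES: "\<lbrakk>el d; el x; obj x = Sym C n V; obj d = Sym C n V\<^sup>\<or>; dj d x\<rbrakk>
    \<Longrightarrow> ap (ES n V) (pair d x) = ap (EP n V) (pair (ap (SI n V\<^sup>\<or>) d) (ap (SI n V) x))"
  by (simp add: ES_eq)

lemma ap_MU: "\<lbrakk>el x; el y; obj x = Sym C i V; obj y = Sym C j V; dj x y\<rbrakk>
    \<Longrightarrow> ap (MU i j V) (pair x y) = ap (SP (i + j) V) (ap (JN V i j) (pair (ap (SI i V) x) (ap (SI j V)
        y)))"
  by (simp add: MU_eq)

text \<open>The symmetrizer absorbs the exchange of the two blocks.\<close>

lemma MU_commute: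
  assumes "el x" "el y" "obj x = Sym C i V" "obj y = Sym C j V" "dj x y" "dj y x"
  shows "ap (MU i j V) (pair x y) = ap (MU j i V) (pair y x)"
proof -
  let ?x = "ap (SI i V) x" and ?y = "ap (SI j V) y"
  have "ap (SYM V (i + j)) (ap (JN V j i) (pair ?y ?x))
      = ap (SYM V (i + j)) (ap (JN V i j) (pair ?x ?y))"
    using arg_cong [OF SYM_JN_swap(1) [of V i j], of "\<lambda>h. ap h (pair ?x ?y)"] assms
        by (simp add: add.commute)
  from arg_cong [OF this, of "ap (SP (i + j) V)"] show ?thesis
    using assms by (simp add: ap_MU add.commute)
qed

text \<open>\<open>\<or>\<^sup>k\<^sup>+\<^sup>iV\<close> is a retract of \<open>\<otimes>\<^sup>kV \<otimes> \<otimes>\<^sup>iV\<close>, compatibly with the pairings.\<close>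

definition "QQ k i V = SP (k + i) V \<bullet> JN V k i"
definition "JJ k i V = CT V k i \<bullet> SI (k + i) V"
abbreviation "EPP k i V \<equiv> C1324 (EP k V) (EP i V) (tpow C k V\<^sup>\<or>) (tpow C i V\<^sup>\<or>) (tpow C k V) (tpow C
    i V)"
abbreviation "CPP k i V \<equiv> tens_coev (tpow C k V) (tpow C k V\<^sup>\<or>) (CP k V) (tpow C i V) (tpow C i V\<^sup>\<or>)
    (CP i V)"

lemma QQ_simps [simp]: "ar (QQ k i V)" "src (QQ k i V) = tpow C k V \<otimes>\<^sub>o tpow C i V"
    "trg (QQ k i V) = Sym C (k + i) V"
  "ar (JJ k i V)" "trg (JJ k i V) = tpow C k V \<otimes>\<^sub>o tpow C i V" "src (JJ k i V) = Sym C (k + i) V"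
  by (simp_all add: QQ_def JJ_def)

lemma JJ_QQ: "JJ k i V \<bullet> QQ k i V = SYMB V k i"
  using cmp_extend [OF SI_SP, of "k + i" V "JN V k i"]
      by (simp add: JJ_def QQ_def SYMB_def cmp_assoc)

lemma QQ_JJ: "QQ k i V \<bullet> JJ k i V = ID (Sym C (k + i) V)"
  using cmp_extend [OF JN_CT(1), of V k i "SI (k + i) V"]
      by (simp add: JJ_def QQ_def cmp_assoc SP_SI)

lemma ap_JJ_QQ: "\<lbrakk>el w; obj w = tpow C k V \<otimes>\<^sub>o tpow C i V\<rbrakk> \<Longrightarrow> ap (JJ k i V) (ap (QQ k i V) w)
    = ap (SYMB V k i) w"
  using arg_cong [OF JJ_QQ [of k i V], of "\<lambda>h. ap h w"] by simp

lemma SYMB_SYMB: "SYMB V k i \<bullet> SYMB V k i = SYMB V k i"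
proof -
  have "SYMB V k i \<bullet> SYMB V k i = JJ k i V \<bullet> (QQ k i V \<bullet> JJ k i V) \<bullet> QQ k i V"
    unfolding JJ_QQ [symmetric] by (simp add: cmp_assoc)
  then show ?thesis unfolding QQ_JJ by (simp add: JJ_QQ)
qed

lemma ap_SYMB_SYMB: "\<lbrakk>el w; obj w = tpow C k V \<otimes>\<^sub>o tpow C i V\<rbrakk> \<Longrightarrow> ap (SYMB V k i) (ap (SYMB V k i) w)
    = ap (SYMB V k i) w"
  using arg_cong [OF SYMB_SYMB [of V k i], of "\<lambda>h. ap h w"] by simp

lemma ap_EPP: "\<lbrakk>el a; el w; obj a = tpow C k V\<^sup>\<or> \<otimes>\<^sub>o tpow C i V\<^sup>\<or>; obj w
    = tpow C k V \<otimes>\<^sub>o tpow C i V; dj a w\<rbrakk>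
   \<Longrightarrow> ap (EPP k i V) (pair a w) = ap (EP (k + i) V) (pair (ap (JN V\<^sup>\<or> k i) a) (ap (JN V k i) w))"
  unfolding ap_EP_JN [symmetric] by simp

lemma ap_JN_SYMB: "\<lbrakk>el w; obj w = tpow C k V \<otimes>\<^sub>o tpow C i V\<rbrakk> \<Longrightarrow> ap (JN V k i) (ap (SYMB V k i) w)
    = ap (SYM V (k + i)) (ap (JN V k i) w)"
  by (simp add: SYMB_def)

text \<open>Through \<open>JN\<close> the product of the pairings of the blocks is the pairing of
  the full tensor powers, along which the symmetrizers are transposed to each other.\<close>

lemma SYMB_adjoint: "adjoint (EPP k i V) (SYMB V\<^sup>\<or> k i) (SYMB V k i)"
proof -
  have "EPP k i V \<bullet> (SYMB V\<^sup>\<or> k i \<boxtimes> ID (tpow C k V \<otimes>\<^sub>o tpow C i V))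
      = EPP k i V \<bullet> (ID (tpow C k V\<^sup>\<or> \<otimes>\<^sub>o tpow C i V\<^sup>\<or>) \<boxtimes> SYMB V k i)"
    by (rule arrow_eqI2) (simp_all add: ap_EPP ap_JN_SYMB EP_SYM)
  then show ?thesis by (simp add: adjoint_def)
qed

lemma dualpair_EPP: "dualpair (tpow C k V\<^sup>\<or> \<otimes>\<^sub>o tpow C i V\<^sup>\<or>) (tpow C k V \<otimes>\<^sub>o tpow C i V) (EPP k i
    V) (CPP k i V)"
  by (rule dualpair_tens [OF dualpair_tpow dualpair_tpow])

lemma ap_EPP_JJ:
  assumes "el d" "el x" "obj d = Sym C (k + i) V\<^sup>\<or>" "obj x = Sym C (k + i) V" "dj d x"
  shows "ap (EPP k i V) (pair (ap (JJ k i V\<^sup>\<or>) d) (ap (JJ k i V) x)) = ap (ES (k + i) V) (pair d x)"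
  using assms by (simp add: ap_EPP ap_ES JJ_def)

lemma EPP_JJ: "EPP k i V \<bullet> (JJ k i V\<^sup>\<or> \<boxtimes> JJ k i V) = ES (k + i) V"
  by (rule arrow_eqI2) (simp_all add: ap_EPP_JJ)

text \<open>The coevaluation comes in block form, so that a trace over the symmetric power unfolds
  into loops through the two blocks separately.\<close>

lemma dualpair_Sym_block:
  "dualpair (Sym C (k + i) V\<^sup>\<or>) (Sym C (k + i) V) (ES (k + i) V) ((QQ k i V \<boxtimes> QQ k i V\<^sup>\<or>) \<bullet>
      CPP k i V)"
  using dualpair_retract [OF dualpair_EPP [of k V i], where i' = "JJ k i V\<^sup>\<or>" and p' = "QQ k i V\<^sup>\<or>"
      and i = "JJ k i V" and p = "QQ k i V"]
  by (simp add: JJ_QQ QQ_JJ SYMB_adjoint EPP_JJ)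

text \<open>Existence is enough for most purposes: \<open>DD_lft\<close> and \<open>DU_lft\<close>
  express the Poincare morphisms through any coevaluation for the pairing.\<close>

lemma dualpair_Sym: "\<exists>c. dualpair (Sym C n V\<^sup>\<or>) (Sym C n V) (ES n V) c"
  using dualpair_Sym_block [of 0 n V] by auto

section \<open>Internal multiplication and traces\<close>

text \<open>The arrow from which \<open>int_mult\<close> arises by adjunction. The degree of the
  result is an argument \<open>k\<close> with \<open>i + k = g\<close>, so that no truncated
  subtraction occurs.\<close>

definition "KK e A B i k g = SP k B \<bullet> CL e (tpow C i A) (tpow C i B) (tpow C k B) \<bullet>
    (SI i A \<boxtimes> (CT B i k \<bullet> SI g B))"
abbreviation "KD i k g V \<equiv> KK (EP i V) V\<^sup>\<or> V i k g"
abbreviation "EPT i V \<equiv> EP i V \<bullet> SW (tpow C i V) (tpow C i V\<^sup>\<or>)"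
abbreviation "KU i k g V \<equiv> KK (EPT i V) V V\<^sup>\<or> i k g"

lemma bil_EPT [simp]: "bil (EPT i V) (tpow C i V) (tpow C i V\<^sup>\<or>)"
  by (simp add: bil_def)

lemma KK_simps [simp]:
  assumes "bil e (tpow C i A) (tpow C i B)" "i + k = g"
  shows "ar (KK e A B i k g)" "src (KK e A B i k g) = Sym C i A \<otimes>\<^sub>o Sym C g B"
      "trg (KK e A B i k g) = Sym C k B"
  using assms by (simp_all add: KK_def)

lemma ap_KK:
  assumes "bil e (tpow C i A) (tpow C i B)" "i + k = g" "el y" "el z" "obj y = Sym C i A"
      "obj z = Sym C g B" "dj y z"
  shows "ap (KK e A B i k g) (pair y z) = ap (SP k B) (ap (CL e (tpow C i A) (tpow C i B) (tpow C k
      B))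
    (pair (ap (SI i A) y) (ap (CT B i k) (ap (SI g B) z))))"
  using assms by (simp add: KK_def)

lemma EP_JN_CL:
  assumes "el a" "el b" "el v" "obj a = tpow C i V\<^sup>\<or>" "obj b = tpow C k V\<^sup>\<or>"
      "obj v = tpow C i V \<otimes>\<^sub>o tpow C k V"
    "dj a b" "dj b a" "dj a v" "dj b v"
  shows "ap (EP (i + k) V) (pair (ap (JN V\<^sup>\<or> i k) (pair a b)) (ap (JN V i k) v))
    = ap (EP k V) (pair b (ap (CL (EP i V) (tpow C i V\<^sup>\<or>) (tpow C i V) (tpow C k V)) (pair a v)))"
proof -
  let ?A = "tpow C i V\<^sup>\<or>" and ?B = "tpow C k V\<^sup>\<or>" and ?X = "tpow C i V" and ?Y = "tpow C k V"
  have "EPP i k V = EP k V \<bullet> (ID ?B \<boxtimes> CL (EP i V) ?A ?X ?Y) \<bullet> ASS ?B ?A (?X \<otimes>\<^sub>o ?Y) \<bullet>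
      (SW ?A ?B \<boxtimes> ID (?X \<otimes>\<^sub>o ?Y))"
    by (rule arrow_eqI4) simp_all
  from arg_cong [OF this, of "\<lambda>h. ap h (pair (pair a b) v)"] show ?thesis using assms
      by (simp add: ap_EPP)
qed

lemma EP_JN_CLT:
  assumes "el x" "el a" "el v" "obj x = tpow C i V" "obj a = tpow C k V"
      "obj v = tpow C i V\<^sup>\<or> \<otimes>\<^sub>o tpow C k V\<^sup>\<or>"
    "dj x a" "dj v x" "dj x v" "dj v a"
  shows "ap (EP (i + k) V) (pair (ap (JN V\<^sup>\<or> i k) v) (ap (JN V i k) (pair x a)))
    = ap (EP k V) (pair (ap (CL (EPT i V) (tpow C i V) (tpow C i V\<^sup>\<or>) (tpow C k V\<^sup>\<or>)) (pair x v))
        a)"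
proof -
  let ?A = "tpow C i V\<^sup>\<or>" and ?B = "tpow C k V\<^sup>\<or>" and ?X = "tpow C i V" and ?Y = "tpow C k V"
  have "EPP i k V = EP k V \<bullet> (CL (EPT i V) ?X ?A ?B \<boxtimes> ID ?Y) \<bullet> (SW (?A \<otimes>\<^sub>o ?B) ?X \<boxtimes> ID ?Y) \<bullet>
      ASSI (?A \<otimes>\<^sub>o ?B) ?X ?Y"
    by (rule arrow_eqI4) simp_all
  from arg_cong [OF this, of "\<lambda>h. ap h (pair v (pair x a))"] show ?thesis using assms
      by (simp add: ap_EPP)
qed

text \<open>Contracting the first \<open>i\<close> factors and pairing the other \<open>k\<close>
  amounts to pairing all of them. The symmetrizers inside contraction and product are moved across
  the pairing by \<open>EP_SYM\<close> and vanish on symmetric tensors.\<close>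

lemma KD_adjoint_MU:
  assumes g: "i + k = g" and a: "el w" "el y" "el z" "obj w = Sym C k V\<^sup>\<or>" "obj y = Sym C i V\<^sup>\<or>"
      "obj z = Sym C g V"
    "dj w y" "dj y w" "dj w z" "dj y z"
  shows "ap (ES k V) (pair w (ap (KD i k g V) (pair y z)))
      = ap (ES g V) (pair (ap (MU i k V\<^sup>\<or>) (pair y w)) z)"
proof -
  let ?v = "ap (CT V i k) (ap (SI g V) z)" and ?y = "ap (SI i V\<^sup>\<or>) y" and ?w = "ap (SI k V\<^sup>\<or>) w"
  have "ap (ES k V) (pair w (ap (KD i k g V) (pair y z)))
      = ap (EP k V) (pair ?w (ap (CL (EP i V) (tpow C i V\<^sup>\<or>) (tpow C i V) (tpow C k V)) (pair ?y
          ?v)))"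
    using a g by (simp add: ap_ES ap_KK ap_SI_SP EP_SYM [symmetric])
  also have "\<dots> = ap (EP (i + k) V) (pair (ap (JN V\<^sup>\<or> i k) (pair ?y ?w)) (ap (JN V i k) ?v))"
    using a g by (subst EP_JN_CL) simp_all
  also have "\<dots> = ap (ES g V) (pair (ap (MU i k V\<^sup>\<or>) (pair y w)) z)"
    using a g by (simp add: ap_ES ap_MU ap_SI_SP EP_SYM)
  finally show ?thesis .
qed

lemma KU_adjoint_MU:
  assumes g: "i + k = g" and a: "el c" "el x" "el b" "obj c = Sym C g V\<^sup>\<or>" "obj x = Sym C i V"
      "obj b = Sym C k V"
    "dj c x" "dj x c" "dj c b" "dj x b"
  shows "ap (ES k V) (pair (ap (KU i k g V) (pair x c)) b)
      = ap (ES g V) (pair c (ap (MU i k V) (pair x b)))"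
proof -
  let ?v = "ap (CT V\<^sup>\<or> i k) (ap (SI g V\<^sup>\<or>) c)" and ?x = "ap (SI i V) x" and ?b = "ap (SI k V) b"
  have "ap (ES k V) (pair (ap (KU i k g V) (pair x c)) b)
      = ap (EP k V) (pair (ap (CL (EPT i V) (tpow C i V) (tpow C i V\<^sup>\<or>) (tpow C k V\<^sup>\<or>)) (pair ?x
          ?v)) ?b)"
    using a g by (simp add: ap_ES ap_KK ap_SI_SP EP_SYM)
  also have "\<dots> = ap (EP (i + k) V) (pair (ap (JN V\<^sup>\<or> i k) ?v) (ap (JN V i k) (pair ?x ?b)))"
    using a g by (subst EP_JN_CLT) simp_all
  also have "\<dots> = ap (ES g V) (pair c (ap (MU i k V) (pair x b)))"
    using a g by (simp add: ap_ES ap_MU ap_SI_SP EP_SYM [symmetric])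
  finally show ?thesis .
qed

definition "DD i k g V = Arrow (Sym C i V\<^sup>\<or>) (D_down C i g V) (Sym C k V \<otimes>\<^sub>o Sym C g V\<^sup>\<or>)"
definition "DU i k g V = Arrow (Sym C i V) (D_up C i g V) (Sym C k V\<^sup>\<or> \<otimes>\<^sub>o Sym C g V\<^sup>\<or>\<^sup>\<or>)"

lemma mor_KK: "mor (KK e A B i k g) = Sym_prj C k B
        \<cdot> contr_left C (mor e) (tpow C i A) (tpow C i B) (tpow C k B)
        \<cdot> (Sym_inj C i A \<otimes>\<^sub>m (cut C B i k \<cdot> Sym_inj C g B))"
  by (simp add: KK_def SP_def SI_def CL_def CT_def)

lemma DD_lft:
  assumes g: "i + k = g" and d: "dualpair (Sym C g V\<^sup>\<or>) (Sym C g V) (ES g V) c"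
  shows "DD i k g V = lft (Sym C g V\<^sup>\<or>) (Sym C g V) c (Sym C i V\<^sup>\<or>) (KD i k g V)"
proof -
  have "g - i = k" using g by simp
  then have "DD i k g V = Arrow (Sym C i V\<^sup>\<or>) (alpha_inv C (mor (ES g V)) (Sym C g V\<^sup>\<or>) (Sym C g V)
      (Sym C k V) \<cdot>
      transp C (Sym C i V\<^sup>\<or>) (Sym C g V) (Sym C k V) (mor (KD i k g V))) (Sym C k V \<otimes>\<^sub>o Sym C g
          V\<^sup>\<or>)"
    unfolding mor_KK by (simp add: DD_def D_down_def iota_star_def int_mult_def ES_def EP_def)
  also have "\<dots> = lft (Sym C g V\<^sup>\<or>) (Sym C g V) c (Sym C i V\<^sup>\<or>) (KD i k g V)"
    by (rule alpha_inv_transp [OF d]) (use g in simp_all)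
  finally show ?thesis .
qed

lemma DU_lft:
  assumes g: "i + k = g" and d: "dualpair (Sym C g V\<^sup>\<or>\<^sup>\<or>) (Sym C g V\<^sup>\<or>) (ES g V\<^sup>\<or>) c"
  shows "DU i k g V = lft (Sym C g V\<^sup>\<or>\<^sup>\<or>) (Sym C g V\<^sup>\<or>) c (Sym C i V) (KU i k g V)"
proof -
  have "g - i = k" using g by simp
  then have "DU i k g V = Arrow (Sym C i V) (alpha_inv C (mor (ES g V\<^sup>\<or>)) (Sym C g V\<^sup>\<or>\<^sup>\<or>) (Sym C g
      V\<^sup>\<or>) (Sym C k V\<^sup>\<or>) \<cdot>
      transp C (Sym C i V) (Sym C g V\<^sup>\<or>) (Sym C k V\<^sup>\<or>) (mor (KU i k g V))) (Sym C k V\<^sup>\<or> \<otimes>\<^sub>o Sym C g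
          V\<^sup>\<or>\<^sup>\<or>)"
    unfolding mor_KK by (simp add: DU_def D_up_def iota_def int_mult_def ES_def EP_def SW_def)
  also have "\<dots> = lft (Sym C g V\<^sup>\<or>\<^sup>\<or>) (Sym C g V\<^sup>\<or>) c (Sym C i V) (KU i k g V)"
    by (rule alpha_inv_transp [OF d]) (use g in simp_all)
  finally show ?thesis .
qed

lemma DD_simps [simp]:
  assumes g: "i + k = g"
  shows "ar (DD i k g V)" "src (DD i k g V) = Sym C i V\<^sup>\<or>"
      "trg (DD i k g V) = Sym C k V \<otimes>\<^sub>o Sym C g V\<^sup>\<or>"
    "ar (DU i k g V)" "src (DU i k g V) = Sym C i V" "trg (DU i k g V)
        = Sym C k V\<^sup>\<or> \<otimes>\<^sub>o Sym C g V\<^sup>\<or>\<^sup>\<or>"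
proof -
  obtain c where c: "dualpair (Sym C g V\<^sup>\<or>) (Sym C g V) (ES g V) c" using dualpair_Sym by blast
  obtain c' where c': "dualpair (Sym C g V\<^sup>\<or>\<^sup>\<or>) (Sym C g V\<^sup>\<or>) (ES g V\<^sup>\<or>) c'" using dualpair_Sym
      by blast
  show "ar (DD i k g V)" "ar (DU i k g V)" unfolding DD_lft [OF g c] DU_lft [OF g c']
    by (rule lft_simps [OF c], use g in simp_all) (rule lft_simps [OF c'], use g in simp_all)
qed (simp_all add: DD_def DU_def)

text \<open>By \<open>CR_cancel\<close> this characterizes the Poincare morphism, and it frees the
  later identities from the choice of a coevaluation.\<close>

lemma CR_DD: assumes g: "i + k = g"
  shows "CR (ES g V) (Sym C k V) (Sym C g V\<^sup>\<or>) (Sym C g V) \<bullet> (DD i k g V \<boxtimes> ID (Sym C g V))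
      = KD i k g V"
proof -
  obtain c where c: "dualpair (Sym C g V\<^sup>\<or>) (Sym C g V) (ES g V) c" using dualpair_Sym by blast
  show ?thesis unfolding DD_lft [OF g c] by (rule CR_lft [OF c]) (use g in simp_all)
qed

lemma CR_DU: assumes g: "i + k = g"
  shows "CR (ES g V\<^sup>\<or>) (Sym C k V\<^sup>\<or>) (Sym C g V\<^sup>\<or>\<^sup>\<or>) (Sym C g V\<^sup>\<or>) \<bullet> (DU i k g V \<boxtimes> ID (Sym C g V\<^sup>\<or>))
      = KU i k g V"
proof -
  obtain c where c: "dualpair (Sym C g V\<^sup>\<or>\<^sup>\<or>) (Sym C g V\<^sup>\<or>) (ES g V\<^sup>\<or>) c" using dualpair_Sym
      by blast
  show ?thesis unfolding DU_lft [OF g c] by (rule CR_lft [OF c]) (use g in simp_all)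
qed

lemma ap_CR_DD:
  assumes g: "i + k = g" and "el y" "el z" "obj y = Sym C i V\<^sup>\<or>" "obj z = Sym C g V" "dj y z"
  shows "ap (CR (ES g V) (Sym C k V) (Sym C g V\<^sup>\<or>) (Sym C g V)) (pair (ap (DD i k g V) y) z)
      = ap (KD i k g V) (pair y z)"
  using assms by (simp add: CR_DD [OF g, symmetric])

lemma ap_CR_DU:
  assumes g: "i + k = g" and "el x" "el z" "obj x = Sym C i V" "obj z = Sym C g V\<^sup>\<or>" "dj x z"
  shows "ap (CR (ES g V\<^sup>\<or>) (Sym C k V\<^sup>\<or>) (Sym C g V\<^sup>\<or>\<^sup>\<or>) (Sym C g V\<^sup>\<or>)) (pair (ap (DU i k g V) x) z)
      = ap (KU i k g V) (pair x z)"
  using assms by (simp add: CR_DU [OF g, symmetric])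

text \<open>At a coevaluation of \<open>\<or>\<^sup>gV\<close>, \<open>PSI\<close> is the trace of \<open>z \<mapsto> x (y \<rfloor> z)\<close>;
  \<open>TRA\<close> is the same trace in terms of \<open>D\<^sub>i\<^sub>,\<^sub>g\<close>.\<close>

abbreviation "TRA i k g V \<equiv> EST g V \<bullet> (MU i k V \<boxtimes> ID (Sym C g V\<^sup>\<or>)) \<bullet>
    ASSI (Sym C i V) (Sym C k V) (Sym C g V\<^sup>\<or>)"

abbreviation "PSI i k g V \<equiv> EST g V \<bullet> ((MU i k V \<bullet> (ID (Sym C i V) \<boxtimes> KD i k g V)) \<boxtimes> ID (Sym C g
    V\<^sup>\<or>)) \<bullet>
    ASSI (Sym C i V) (Sym C i V\<^sup>\<or> \<otimes>\<^sub>o Sym C g V) (Sym C g V\<^sup>\<or>) \<bullet>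
    (ID (Sym C i V) \<boxtimes> ASSI (Sym C i V\<^sup>\<or>) (Sym C g V) (Sym C g V\<^sup>\<or>))"

text \<open>The left side does not involve \<open>c\<close>, so the trace may be computed with any
  coevaluation. \<open>TRA_DD_eq\<close> uses this to pass to the block form.\<close>

lemma TRA_DD:
  assumes g: "i + k = g" and c: "dualpair (Sym C g V\<^sup>\<or>) (Sym C g V) (ES g V) c"
    and a: "el x" "el y" "obj x = Sym C i V" "obj y = Sym C i V\<^sup>\<or>" "dj x y" "base x = L"
        "base y = L"
  shows "ap (TRA i k g V) (pair x (ap (DD i k g V) y))
      = ap (PSI i k g V) (pair x (pair y (ap c (star L))))"
proof -
  let ?X = "Sym C i V" and ?Y = "Sym C i V\<^sup>\<or>" and ?G = "Sym C g V" and ?G' = "Sym C g V\<^sup>\<or>"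
  note s = dualpair_simps [OF c]
  have 1: "TRA i k g V \<bullet> (ID ?X \<boxtimes> ((KD i k g V \<boxtimes> ID ?G') \<bullet> ASSI ?Y ?G ?G')) = PSI i k g V"
    by (rule arrow_eqI4r) (simp_all add: g)
  have "ap (TRA i k g V) (pair x (ap (DD i k g V) y))
      = ap (TRA i k g V \<bullet> (ID ?X \<boxtimes> ((KD i k g V \<boxtimes> ID ?G') \<bullet> ASSI ?Y ?G ?G'))) (pair x (pair y (ap c
          (star L))))"
    unfolding DD_lft [OF g c] using a g by (simp add: s lft_def)
  then show ?thesis unfolding 1 .
qed

section \<open>The trace on a symmetric power\<close>

context
  fixes i k g :: nat and V :: 'o
  assumes g: "i + k = g"
begin

abbreviation "NN \<equiv> tpow C k V"
abbreviation "NN' \<equiv> tpow C k V\<^sup>\<or>"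
abbreviation "TT \<equiv> tpow C i V"
abbreviation "TT' \<equiv> tpow C i V\<^sup>\<or>"
abbreviation "XX \<equiv> Sym C i V"
abbreviation "YY \<equiv> Sym C i V\<^sup>\<or>"

text \<open>The trace on the level of tensor powers: \<open>KW\<close> contracts the block of
  \<open>i\<close> factors, \<open>WW\<close> symmetrizes, contracts with the first dual argument
  and puts the vector argument in the vacant place, and \<open>TH\<close> pairs the result with the
  dual blocks. Unlike in \<open>PSI\<close>, nothing is symmetrized after the contraction.\<close>

abbreviation "KW \<equiv> CL (EP i V) TT' TT NN \<bullet> (ID TT' \<boxtimes> SW NN TT)"
abbreviation "WW \<equiv> SW TT NN \<bullet> (SI i V \<boxtimes> (KW \<bullet> (SI i V\<^sup>\<or> \<boxtimes> SYMB V k i)))"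
abbreviation "TH \<equiv> EPP k i V \<bullet> SW (NN \<otimes>\<^sub>o TT) (NN' \<otimes>\<^sub>o TT') \<bullet> (WW \<boxtimes> ID (NN' \<otimes>\<^sub>o TT')) \<bullet>
   ASSI XX (YY \<otimes>\<^sub>o (NN \<otimes>\<^sub>o TT)) (NN' \<otimes>\<^sub>o TT') \<bullet> (ID XX \<boxtimes> ASSI YY (NN \<otimes>\<^sub>o TT) (NN' \<otimes>\<^sub>o TT'))"

lemma g': "k + i = g"
  using g by simp

lemma ES_QQ:
  assumes "el a" "el s" "obj a = NN' \<otimes>\<^sub>o TT'" "obj s = Sym C g V" "dj a s"
  shows "ap (ES g V) (pair (ap (QQ k i V\<^sup>\<or>) a) s)
      = ap (EPP k i V) (pair (ap (SYMB V\<^sup>\<or> k i) a) (ap (JJ k i V) s))"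
  using ap_EPP_JJ [of "ap (QQ k i V\<^sup>\<or>) a" s k i V] assms by (simp add: g' ap_JJ_QQ)

lemma JJ_MU:
  assumes "el x" "el a" "obj x = XX" "obj a = Sym C k V" "dj x a" "dj a x"
  shows "ap (JJ k i V) (ap (MU i k V) (pair x a))
      = ap (SYMB V k i) (pair (ap (SI k V) a) (ap (SI i V) x))"
proof -
  have "ap (MU k i V) (pair a x) = ap (QQ k i V) (pair (ap (SI k V) a) (ap (SI i V) x))"
    using assms by (simp add: ap_MU QQ_def)
  then show ?thesis using assms MU_commute [of x a i V k] by (simp add: ap_JJ_QQ)
qed

lemma SYMB_SYM:
  assumes "el n" "el t" "obj n = NN" "obj t = TT" "dj n t"
  shows "ap (SYMB V k i) (pair (ap (SYM V k) n) t) = ap (SYMB V k i) (pair n t)"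
  using arg_cong [OF SYM_JN_block(1) [OF span_SYM [of V k] span_ID [of V i]], of
      "\<lambda>h. ap h (pair n t)"] assms
  by (simp add: SYMB_def)

lemma CT_SI:
  assumes "el z" "obj z = Sym C g V"
  shows "ap (CT V i k) (ap (SI g V) z) = ap (SW NN TT) (ap (JJ k i V) z)"
  using arg_cong [OF SYM_JN_swap(2) [of k V i], of "\<lambda>h. ap h (ap (SI g V) z)"] assms
  by (simp add: JJ_def g g')

lemma SI_KD:
  assumes "el y" "el b" "obj y = YY" "obj b = NN \<otimes>\<^sub>o TT" "dj y b"
  shows "ap (SI k V) (ap (KD i k g V) (pair y (ap (QQ k i V) b)))
    = ap (SYM V k) (ap KW (pair (ap (SI i V\<^sup>\<or>) y) (ap (SYMB V k i) b)))"
  using assms g by (simp add: ap_KK ap_SI_SP CT_SI ap_JJ_QQ g')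

text \<open>The coevaluation of the symmetric power is the image under \<open>QQ\<close> of that of
  the tensor powers. The symmetrizer that the product creates is moved across the pairing, where it
  merges with the one already there.\<close>

lemma PSI_QQ: "PSI i k g V \<bullet> (ID XX \<boxtimes> ID YY \<boxtimes> (QQ k i V \<boxtimes> QQ k i V\<^sup>\<or>))
    = TH \<bullet> (ID XX \<boxtimes> ID YY \<boxtimes> (ID (NN \<otimes>\<^sub>o TT) \<boxtimes> SYMB V\<^sup>\<or> k i))" (is "?l = ?r")
proof (rule arrow_eqI4r [where X = XX and Y = YY and Z = "NN \<otimes>\<^sub>o TT" and W = "NN' \<otimes>\<^sub>o TT'"])
  fix L x y b a
  assume A: "wires L [(x, XX), (y, YY), (b, NN \<otimes>\<^sub>o TT), (a, NN' \<otimes>\<^sub>o TT')]"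
  let ?n = "ap KW (pair (ap (SI i V\<^sup>\<or>) y) (ap (SYMB V k i) b))"
  let ?s = "pair ?n (ap (SI i V) x)"
  have "ap ?l (pair x (pair y (pair b a)))
      = ap (ES g V) (pair (ap (QQ k i V\<^sup>\<or>) a) (ap (MU i k V) (pair x (ap (KD i k g V) (pair y (ap
          (QQ k i V) b))))))"
    using A g by (simp add: g')
  also have "\<dots> = ap (EPP k i V) (pair (ap (SYMB V\<^sup>\<or> k i) a) (ap (SYMB V k i) ?s))"
    using A g by (simp add: g' ES_QQ JJ_MU SI_KD SYMB_SYM)
  also have "\<dots> = ap (EPP k i V) (pair (ap (SYMB V\<^sup>\<or> k i) (ap (SYMB V\<^sup>\<or> k i) a)) ?s)"
    using A g by (subst adjointD [OF SYMB_adjoint bil_C1324 [OF bil_EP bil_EP]]) simp_all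
  also have "\<dots> = ap (EPP k i V) (pair (ap (SYMB V\<^sup>\<or> k i) a) ?s)"
    using A by (simp add: ap_SYMB_SYMB)
  also have "\<dots> = ap ?r (pair x (pair y (pair b a)))"
    using A by simp
  finally show "ap ?l (pair x (pair y (pair b a)))
    = ap ?r (pair x (pair y (pair b a)))" .
qed (use g in \<open>simp_all add: g'\<close>)

text \<open>\<open>WW\<close> begins by symmetrizing this input, and the symmetrizer is
  idempotent.\<close>

lemma TH_SYMB: "TH \<bullet> (ID XX \<boxtimes> ID YY \<boxtimes> (SYMB V k i \<boxtimes> ID (NN' \<otimes>\<^sub>o TT'))) = TH"
  by (rule arrow_eqI4r) (simp_all add: ap_SYMB_SYMB)

text \<open>Contractions of different strands commute.\<close>

lemma EP_KW:
  assumes "el n" "el y" "el w" "obj n = NN'" "obj y = TT'" "obj w = NN \<otimes>\<^sub>o TT" "dj n y" "dj y n"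
      "dj n w" "dj y w"
  shows "ap (EP k V) (pair n (ap (CL (EP i V) TT' TT NN) (pair y (ap (SW NN TT) w))))
    = ap (EP i V) (pair y (ap (CL (EP k V) NN' NN TT) (pair n w)))"
proof -
  have "EP k V \<bullet> (ID NN' \<boxtimes> KW) \<bullet> ASS NN' TT' (NN \<otimes>\<^sub>o TT)
      = EP i V \<bullet> (ID TT' \<boxtimes> CL (EP k V) NN' NN TT) \<bullet> ASS TT' NN' (NN \<otimes>\<^sub>o TT) \<bullet> (SW NN' TT' \<boxtimes> ID (NN
          \<otimes>\<^sub>o TT))"
    by (rule arrow_eqI4) (simp_all add: smul_ac)
  from arg_cong [OF this, of "\<lambda>h. ap h (pair (pair n y) w)"] show ?thesis using assms by simp
qed

abbreviation "PB \<equiv> ptr_body (EP k V) NN' NN TT TT (SYMB V k i)"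

text \<open>The crossings on the left only rearrange the inputs. In the new order the coevaluation
  of the \<open>i\<close> strands stands next to the vector argument and forms a zigzag with it, and
  that of the \<open>k\<close> strands is fed into the body of the partial trace.\<close>

lemma TH_XCH:
  "TH \<bullet> (ID XX \<boxtimes> ID YY \<boxtimes> XCH NN NN' TT TT') \<bullet> cross YY XX ((NN \<otimes>\<^sub>o NN') \<otimes>\<^sub>o (TT \<otimes>\<^sub>o TT')) \<bullet>
     (ID YY \<boxtimes> cross (NN \<otimes>\<^sub>o NN') XX (TT \<otimes>\<^sub>o TT')) \<bullet> cross (NN \<otimes>\<^sub>o NN') YY (XX \<otimes>\<^sub>o (TT \<otimes>\<^sub>o TT')) \<bullet>
     (ID (NN \<otimes>\<^sub>o NN') \<boxtimes> ID YY \<boxtimes> SW (TT \<otimes>\<^sub>o TT') XX)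
   = EP i V \<bullet> (SI i V\<^sup>\<or> \<boxtimes> ID TT) \<bullet> (ID YY \<boxtimes> PB) \<bullet> cross (NN \<otimes>\<^sub>o NN') YY TT \<bullet>
     (ID (NN \<otimes>\<^sub>o NN') \<boxtimes> ID YY \<boxtimes> (CR (EP i V) TT TT' TT \<bullet> (ID (TT \<otimes>\<^sub>o TT') \<boxtimes> SI i V)))"
  by (rule arrow_eqI6e) (simp_all add: ptr_simps [OF dualpair_tpow] ap_ptr_body [OF dualpair_tpow]
      EP_KW smul_ac)

lemma TRA_DD_eq:
  assumes a: "el x" "el y" "obj x = XX" "obj y = YY" "dj x y" "dj y x" "base x = L" "base y = L"
  shows "ap (TRA i k g V) (pair x (ap (DD i k g V) y))
      = smul (ap (ratios V k i) (star L)) (ap (ES i V) (pair y x))"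
proof -
  let ?C = "ap (CPP k i V) (star L)" and ?u = "ap (CP k V) (star L)" and ?v = "ap (CP i V) (star L)"
  note dk = dualpair_tpow [of k V] and di = dualpair_tpow [of i V]
  note s = dualpair_simps [OF dualpair_EPP [of k V i]] dualpair_simps [OF dk] dualpair_simps [OF di]
  note dS = dualpair_Sym_block [of k i V, unfolded g']
  have "ap (TRA i k g V) (pair x (ap (DD i k g V) y))
      = ap (PSI i k g V \<bullet> (ID XX \<boxtimes> ID YY \<boxtimes> (QQ k i V \<boxtimes> QQ k i V\<^sup>\<or>))) (pair x (pair y ?C))"
    unfolding TRA_DD [OF g dS a(1-5,7,8)] using a g s by (simp add: g')
  also have "\<dots> = ap TH (pair x (pair y (ap ((ID (NN \<otimes>\<^sub>o TT) \<boxtimes> SYMB V\<^sup>\<or> k i) \<bullet>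
      CPP k i V) (star L))))"
    unfolding PSI_QQ using a s by simp
  \<comment> \<open>The symmetrizer on the dual half is slid to the other half of the coevaluation,
    where \<open>TH\<close> already contains one.\<close>
  also have "(ID (NN \<otimes>\<^sub>o TT) \<boxtimes> SYMB V\<^sup>\<or> k i) \<bullet> CPP k i V = (SYMB V k i \<boxtimes> ID (NN' \<otimes>\<^sub>o TT')) \<bullet>
      CPP k i V"
    by (rule coev_slide [OF dualpair_EPP SYMB_adjoint, symmetric]) simp_all
  also have "ap TH (pair x (pair y (ap \<dots> (star L))))
      = ap (TH \<bullet> (ID XX \<boxtimes> ID YY \<boxtimes> (SYMB V k i \<boxtimes> ID (NN' \<otimes>\<^sub>o TT')))) (pair x (pair y ?C))"
    using a s by simp
  also have "\<dots> = ap TH (pair x (pair y (ap (XCH NN NN' TT TT') (pair ?u ?v))))"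
    unfolding TH_SYMB using a s by (simp add: tens_coev_def)
  also have "\<dots> = ap (EP i V \<bullet> (SI i V\<^sup>\<or> \<boxtimes> ID TT) \<bullet> (ID YY \<boxtimes> PB) \<bullet> cross (NN \<otimes>\<^sub>o NN') YY TT \<bullet>
     (ID (NN \<otimes>\<^sub>o NN') \<boxtimes> ID YY \<boxtimes> (CR (EP i V) TT TT' TT \<bullet> (ID (TT \<otimes>\<^sub>o TT') \<boxtimes> SI i V)))) (pair ?u
         (pair y (pair ?v x)))"
    unfolding TH_XCH [symmetric] using a s by simp
  \<comment> \<open>The loop of \<open>i\<close> strands is pulled straight; the loop of
    \<open>k\<close> strands is left in \<open>PB\<close>.\<close>
  also have "\<dots> = ap (EP i V) (pair (ap (SI i V\<^sup>\<or>) y) (ap PB (pair ?u (ap (SI i V) x))))"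
    using a s by (simp add: ptr_simps [OF dk] ap_CR_coev [OF di])
  also have "ap PB (pair ?u (ap (SI i V) x)) = ap (SC (ratios V k i) (SYM V i)) (ap (SI i V) x)"
    unfolding ptr_SYMB [symmetric] using a by (simp add: ap_ptr [OF dk])
  also have "ap (EP i V) (pair (ap (SI i V\<^sup>\<or>) y) \<dots>)
      = smul (ap (ratios V k i) (star L)) (ap (ES i V) (pair y x))"
    using a scalar_simps [OF scalar_ratios [of V k i]] by (simp add: ap_ES)
  finally show ?thesis .
qed

end

section \<open>The trace on the dual of a symmetric power\<close>

abbreviation "TRB i k g V \<equiv> EST g V\<^sup>\<or> \<bullet> (MU i k V\<^sup>\<or> \<boxtimes> ID (Sym C g V\<^sup>\<or>\<^sup>\<or>)) \<bullet>
    ASSI (Sym C i V\<^sup>\<or>) (Sym C k V\<^sup>\<or>) (Sym C g V\<^sup>\<or>\<^sup>\<or>)"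

text \<open>The trace of an operator on \<open>\<or>\<^sup>gV\<^sup>\<or>\<close> is that of its transpose on \<open>\<or>\<^sup>gV\<close>.\<close>

lemma TRB_DU_eq:
  assumes g: "i + k = g"
    and a: "el x" "el y" "obj x = Sym C i V" "obj y = Sym C i V\<^sup>\<or>" "dj x y" "dj y x" "base x = L"
        "base y = L"
  shows "ap (TRB i k g V) (pair y (ap (DU i k g V) x))
      = smul (ap (ratios V k i) (star L)) (ap (ES i V) (pair y x))"
proof -
  let ?G = "Sym C g V" and ?G' = "Sym C g V\<^sup>\<or>" and ?G'' = "Sym C g V\<^sup>\<or>\<^sup>\<or>" and ?X = "Sym C i V"
      and ?Y = "Sym C i V\<^sup>\<or>"
    and ?K' = "Sym C k V\<^sup>\<or>"
  let ?CR = "CR (ES g V\<^sup>\<or>) ?G' ?G'' ?G'" and ?W = "Sym C g V\<^sup>\<or> \<otimes>\<^sub>o Sym C g V\<^sup>\<or>\<^sup>\<or>"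
  obtain c where c: "dualpair ?G' ?G (ES g V) c" using dualpair_Sym by blast
  note s = dualpair_simps [OF c]
  let ?LL = "ES g V \<bullet> (?CR \<boxtimes> ID ?G) \<bullet> ASSI ?W ?G' ?G \<bullet> (ID ?W \<boxtimes> SW ?G ?G')"
  let ?RR = "EST g V\<^sup>\<or> \<bullet> SW ?G'' ?G' \<bullet> (ID ?G'' \<boxtimes> CL (ES g V) ?G' ?G ?G') \<bullet>
      ASS ?G'' ?G' (?G \<otimes>\<^sub>o ?G') \<bullet> (SW ?G' ?G'' \<boxtimes> ID (?G \<otimes>\<^sub>o ?G'))"
  have 1: "?LL = ?RR"
    by (rule arrow_eqI4) (simp_all add: smul_ac)
  have 2: "?RR \<bullet> (ID ?W \<boxtimes> c) = EST g V\<^sup>\<or> \<bullet> RU ?W"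
    by (rule arrow_eqI3l) (simp_all add: s ap_CL_coev [OF c])
  \<comment> \<open>The trace of the operator on \<open>?G'\<close> given by \<open>w\<close> is
    computed with a coevaluation of \<open>?G\<close>: the operator acts on the dual half, and the
    result is paired with the other half.\<close>
  have 3: "ap ?LL (pair w (ap c (star L))) = ap (EST g V\<^sup>\<or>) w"
      if "el w" "obj w = ?W" "base w = L" for w
    using arg_cong [OF 2, of "\<lambda>h. ap h (pair w (star L))"] that s unfolding 1 by simp
  let ?M = "(MU i k V\<^sup>\<or> \<boxtimes> ID ?G'') \<bullet> ASSI ?Y ?K' ?G''"
  have 4: "?CR \<bullet> (?M \<boxtimes> ID ?G') = MU i k V\<^sup>\<or> \<bullet> (ID ?Y \<boxtimes> CR (ES g V\<^sup>\<or>) ?K' ?G'' ?G') \<bullet>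
      ASS ?Y (?K' \<otimes>\<^sub>o ?G'') ?G'"
    by (rule arrow_eqI4l) (simp_all add: g)
  have 5: "ap ?CR (pair (ap ?M (pair y w)) d)
      = ap (MU i k V\<^sup>\<or>) (pair y (ap (CR (ES g V\<^sup>\<or>) ?K' ?G'' ?G') (pair w d)))"
    if "el y" "el w" "el d" "obj y = ?Y" "obj w = ?K' \<otimes>\<^sub>o ?G''" "obj d = ?G'" "dj y w" "dj y d"
        "dj w d" for y w d
    using arg_cong [OF 4, of "\<lambda>h. ap h (pair (pair y w) d)"] that g by simp
  \<comment> \<open>Two uses of adjointness show that the transpose of multiplication by
    \<open>y\<close> after contraction with \<open>x\<close> is multiplication by \<open>x\<close>
    after contraction with \<open>y\<close>.\<close>
  have 6: "?LL \<bullet> ((?M \<bullet> (ID ?Y \<boxtimes> DU i k g V)) \<boxtimes> ID (?G \<otimes>\<^sub>o ?G')) = PSI i k g V \<bullet>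
      ASS ?X ?Y (?G \<otimes>\<^sub>o ?G') \<bullet> (SW ?Y ?X \<boxtimes> ID (?G \<otimes>\<^sub>o ?G'))"
  proof (rule arrow_eqI4 [where X = ?Y and Y = ?X and Z = ?G and W = ?G'])
    fix L y x z d
    assume A: "wires L [(y, ?Y), (x, ?X), (z, ?G), (d, ?G')]"
    have "ap (?LL \<bullet> ((?M \<bullet> (ID ?Y \<boxtimes> DU i k g V)) \<boxtimes> ID (?G \<otimes>\<^sub>o ?G'))) (pair (pair y x) (pair z d))
        = ap (ES g V) (pair (ap ?CR (pair (ap ?M (pair y (ap (DU i k g V) x))) d)) z)"
      using A g by simp
    also have "\<dots> = ap (ES g V) (pair (ap (MU i k V\<^sup>\<or>) (pair y (ap (KU i k g V) (pair x d)))) z)"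
      using A g by (subst 5) (simp_all add: ap_CR_DU)
    also have "\<dots> = ap (ES k V) (pair (ap (KU i k g V) (pair x d)) (ap (KD i k g V) (pair y z)))"
      using A g by (subst KD_adjoint_MU) simp_all
    also have "\<dots> = ap (ES g V) (pair d (ap (MU i k V) (pair x (ap (KD i k g V) (pair y z)))))"
      using A g by (subst KU_adjoint_MU) simp_all
    also have "\<dots> = ap (PSI i k g V \<bullet> ASS ?X ?Y (?G \<otimes>\<^sub>o ?G') \<bullet> (SW ?Y ?X \<boxtimes> ID (?G \<otimes>\<^sub>o ?G')))
        (pair (pair y x) (pair z d))"
      using A g by simp
    finally show "ap (?LL \<bullet> ((?M \<bullet> (ID ?Y \<boxtimes> DU i k g V)) \<boxtimes> ID (?G \<otimes>\<^sub>o ?G'))) (pair (pair y x)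
        (pair z d))
      = ap (PSI i k g V \<bullet> ASS ?X ?Y (?G \<otimes>\<^sub>o ?G') \<bullet> (SW ?Y ?X \<boxtimes> ID (?G \<otimes>\<^sub>o ?G'))) (pair (pair y x)
          (pair z d))" .
  qed (use g in simp_all)
  have "ap (TRB i k g V) (pair y (ap (DU i k g V) x))
      = ap (EST g V\<^sup>\<or>) (ap (?M \<bullet> (ID ?Y \<boxtimes> DU i k g V)) (pair y x))"
    using a g by simp
  also have "\<dots> = ap ?LL (pair (ap (?M \<bullet> (ID ?Y \<boxtimes> DU i k g V)) (pair y x)) (ap c (star L)))"
    using a g by (subst 3) simp_all
  also have "\<dots> = ap (?LL \<bullet> ((?M \<bullet> (ID ?Y \<boxtimes> DU i k g V)) \<boxtimes> ID (?G \<otimes>\<^sub>o ?G'))) (pair (pair y x)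
      (ap c (star L)))"
    using a g s by simp
  also have "\<dots> = ap (PSI i k g V) (pair x (pair y (ap c (star L))))"
    unfolding 6 using a g s by simp
  also have "\<dots> = ap (TRA i k g V) (pair x (ap (DD i k g V) y))"
    by (rule TRA_DD [OF g c, symmetric]) (use a in simp_all)
  also have "\<dots> = smul (ap (ratios V k i) (star L)) (ap (ES i V) (pair y x))"
    by (rule TRA_DD_eq [OF g]) (use a in simp_all)
  finally show ?thesis .
qed

section \<open>The identities\<close>

definition "RF g V = Arrow (Sym C g V) (Sym_refl C g V) (Sym C g V\<^sup>\<or>\<^sup>\<or>)"

text \<open>The last equation is what characterizes the reflexivity morphism. The inverse in the
  definition of \<open>Sym_refl\<close> has to be shown to exist: the internal hom and
  \<open>Sym C g V\<^sup>\<or>\<^sup>\<or>\<close> are both duals of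
  \<open>Sym C g V\<^sup>\<or>\<close>.\<close>

lemma RF: "ar (RF g V)" "src (RF g V) = Sym C g V" "trg (RF g V) = Sym C g V\<^sup>\<or>\<^sup>\<or>"
    "ES g V\<^sup>\<or> \<bullet> (RF g V \<boxtimes> ID (Sym C g V\<^sup>\<or>)) = EST g V"
proof -
  let ?G = "Sym C g V" and ?G' = "Sym C g V\<^sup>\<or>" and ?G'' = "Sym C g V\<^sup>\<or>\<^sup>\<or>"
      and ?H = "IHom C (Sym C g V\<^sup>\<or>) \<I>"
  let ?S = "TRP ?G'' ?G' \<I> (ES g V\<^sup>\<or>)" and ?T = "TRP ?G ?G' \<I> (EST g V)"
  note S = TRP [of "ES g V\<^sup>\<or>" ?G'' ?G' \<I>, simplified]
      and T = TRP [of "EST g V" ?G ?G' \<I>, simplified]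
  obtain c where c: "dualpair ?G'' ?G' (ES g V\<^sup>\<or>) c" using dualpair_Sym by blast
  have e: "dualpair ?H ?G' (EV ?G' \<I>) (coevA ?G')" using dualpair_coev [of ?G']
      by (simp add: evA_eq dual_def)
  note s = dualpair_simps [OF c] dualpair_simps [OF e]
  \<comment> \<open>The comparison of the two duals: evaluate on the first half of a coevaluation
    and keep the second.\<close>
  let ?U = "CL (EV ?G' \<I>) ?H ?G' ?G'' \<bullet> (ID ?H \<boxtimes> c) \<bullet> RUI ?H"
  have U: "ar ?U" "src ?U = ?H" "trg ?U = ?G''" using s by simp_all
  have bE: "bil (EV ?G' \<I>) ?H ?G'" by (simp add: bil_def)
  have 1: "ES g V\<^sup>\<or> \<bullet> (CL (EV ?G' \<I>) ?H ?G' ?G'' \<boxtimes> ID ?G')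
      = EV ?G' \<I> \<bullet> (ID ?H \<boxtimes> CR (ES g V\<^sup>\<or>) ?G' ?G'' ?G') \<bullet> ASS ?H (?G' \<otimes>\<^sub>o ?G'') ?G'"
    by (rule arrow_eqI4l) (simp_all add: bE smul_ac)
  have EU: "ES g V\<^sup>\<or> \<bullet> (?U \<boxtimes> ID ?G') = EV ?G' \<I>"
  proof (rule arrow_eqI2 [where X = ?H and Y = ?G'])
    fix L h d assume a: "wires L [(h, ?H), (d, ?G')]"
    show "ap (ES g V\<^sup>\<or> \<bullet> (?U \<boxtimes> ID ?G')) (pair h d) = ap (EV ?G' \<I>) (pair h d)"
      using arg_cong [OF 1, of "\<lambda>f. ap f (pair (pair h (ap c (star L))) d)"] a
      by (simp add: bE s ap_CR_coev [OF c])
  qed (use U in simp_all)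
  have SU: "?S \<bullet> ?U = ID ?H"
  proof (rule transp_eqI)
    have "EV ?G' \<I> \<bullet> ((?S \<bullet> ?U) \<boxtimes> ID ?G') = (EV ?G' \<I> \<bullet> (?S \<boxtimes> ID ?G')) \<bullet> (?U \<boxtimes> ID ?G')"
      using S(1-3) U by (simp add: tens_ID_cmp(2) [symmetric] cmp_assoc del: cmp_simps)
    then show "EV ?G' \<I> \<bullet> ((?S \<bullet> ?U) \<boxtimes> ID ?G') = EV ?G' \<I> \<bullet> (ID ?H \<boxtimes> ID ?G')"
      using S(4) EU by simp
  qed (use S U in simp_all)
  have US: "?U \<bullet> ?S = ID ?G''"
  proof (rule pairing_cancel_left [OF c])
    have "ES g V\<^sup>\<or> \<bullet> ((?U \<bullet> ?S) \<boxtimes> ID ?G') = (ES g V\<^sup>\<or> \<bullet> (?U \<boxtimes> ID ?G')) \<bullet> (?S \<boxtimes> ID ?G')"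
      using S(1-3) U by (simp add: tens_ID_cmp(2) [symmetric] cmp_assoc)
    then show "ES g V\<^sup>\<or> \<bullet> ((?U \<bullet> ?S) \<boxtimes> ID ?G') = ES g V\<^sup>\<or> \<bullet> (ID ?G'' \<boxtimes> ID ?G')"
      using S(4) EU by simp
  qed (use S U in simp_all)
  have "inverses ?S ?U" using SU US S U by (simp add: inverses_def)
  then have "inverse_mor C ?G'' ?H (transp C ?G'' ?G' \<I> (ev_Sym C g V\<^sup>\<or>)) = mor ?U"
    unfolding TRP_def ES_def arrow.sel by (rule inverse_mor_Arrow)
  then have R: "RF g V = ?U \<bullet> ?T"
    using T(2) U(3) by (simp add: RF_def Sym_refl_def cmp_def TRP_def EST_def dual_def)
  show "ar (RF g V)" "src (RF g V) = Sym C g V" "trg (RF g V) = Sym C g V\<^sup>\<or>\<^sup>\<or>"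
    unfolding R using T U by simp_all
  have "ES g V\<^sup>\<or> \<bullet> (RF g V \<boxtimes> ID ?G') = (ES g V\<^sup>\<or> \<bullet> (?U \<boxtimes> ID ?G')) \<bullet> (?T \<boxtimes> ID ?G')"
    unfolding R using T(1-3) U by (simp add: tens_ID_cmp(2) [symmetric] cmp_assoc)
  then show "ES g V\<^sup>\<or> \<bullet> (RF g V \<boxtimes> ID ?G') = EST g V"
    using T(4) EU by simp
qed

context
  fixes i k g :: nat and V :: 'o
  assumes g: "i + k = g"
begin

lemma gg: "k + i = g"
  using g by simp

abbreviation "SVi \<equiv> Sym C i V"
abbreviation "SVi' \<equiv> Sym C i V\<^sup>\<or>"
abbreviation "SVk \<equiv> Sym C k V"
abbreviation "SVk' \<equiv> Sym C k V\<^sup>\<or>"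
abbreviation "SVg \<equiv> Sym C g V"
abbreviation "SVg' \<equiv> Sym C g V\<^sup>\<or>"
abbreviation "SVg'' \<equiv> Sym C g V\<^sup>\<or>\<^sup>\<or>"

text \<open>Evaluating the upper Poincare morphism on the dual half of the lower one gives a
  contraction. Its adjoint is multiplication, and the whole becomes the trace
  \<open>TRA\<close>.\<close>

lemma C1324_DU_DD: "C1324 (ES k V) (ES g V\<^sup>\<or>) SVk' SVg'' SVk SVg' \<bullet> (DU i k g V \<boxtimes> DD i k g V)
    = SC (ratios V k i) (EST i V)"
proof -
  let ?E = "C1324 (ES k V) (ES g V\<^sup>\<or>) SVk' SVg'' SVk SVg'"
  have 1: "?E = ES k V \<bullet> (CR (ES g V\<^sup>\<or>) SVk' SVg'' SVg' \<boxtimes> ID SVk) \<bullet> ASSI (SVk' \<otimes>\<^sub>o SVg'') SVg' SVk \<bullet>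
      (ID (SVk' \<otimes>\<^sub>o SVg'') \<boxtimes> SW SVk SVg')"
    by (rule arrow_eqI4) (simp_all add: smul_ac)
  have 2: "?E \<bullet> (DU i k g V \<boxtimes> ID (SVk \<otimes>\<^sub>o SVg')) = TRA i k g V"
    unfolding 1 by (rule arrow_eqI3r) (use g in \<open>simp_all add: ap_CR_DU KU_adjoint_MU\<close>)
  show ?thesis
  proof (rule arrow_eqI2 [where X = SVi and Y = SVi'])
    fix L x y assume a: "wires L [(x, SVi), (y, SVi')]"
    have "ap (?E \<bullet> (DU i k g V \<boxtimes> ID (SVk \<otimes>\<^sub>o SVg'))) (pair x (ap (DD i k g V) y))
        = smul (ap (ratios V k i) (star L)) (ap (ES i V) (pair y x))"
      unfolding 2 by (rule TRA_DD_eq [OF g]) (use a in simp_all)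
    then show "ap (?E \<bullet> (DU i k g V \<boxtimes> DD i k g V)) (pair x y)
        = ap (SC (ratios V k i) (EST i V)) (pair x y)"
      using a g by simp
  qed (use g in simp_all)
qed

text \<open>Both sides of the identity between \<open>contr13\<close> and \<open>contr_left\<close>
  turn out to be the product. This is the side of \<open>contr13\<close>, and \<open>CL_DD\<close>
  is the other one.\<close>

lemma C13_DD: "C13 (EST k V) SVk SVg' SVk' \<bullet> (DD i k g V \<boxtimes> ID SVk') = MU i k V\<^sup>\<or>"
proof -
  obtain c where c: "dualpair SVg' SVg (ES g V) c" using dualpair_Sym by blast
  have 1: "ES g V \<bullet> (C13 (EST k V) SVk SVg' SVk' \<boxtimes> ID SVg) = ES k V \<bullet> SW SVk SVk' \<bullet>
      (CR (ES g V) SVk SVg' SVg \<boxtimes> ID SVk') \<bullet>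
      ASSI (SVk \<otimes>\<^sub>o SVg') SVg SVk' \<bullet> (ID (SVk \<otimes>\<^sub>o SVg') \<boxtimes> SW SVk' SVg) \<bullet> ASS (SVk \<otimes>\<^sub>o SVg') SVk'
          SVg"
    by (rule arrow_eqI4ll) (simp_all add: smul_ac)
  show ?thesis
  proof (rule pairing_cancel_left [OF c])
    show "ES g V \<bullet> ((C13 (EST k V) SVk SVg' SVk' \<bullet> (DD i k g V \<boxtimes> ID SVk')) \<boxtimes> ID SVg)
        = ES g V \<bullet> (MU i k V\<^sup>\<or> \<boxtimes> ID SVg)" (is "?l = ?r")
    proof (rule arrow_eqI3l [where X = SVi' and Y = SVk' and Z = SVg])
      fix L y w z assume a: "wires L [(y, SVi'), (w, SVk'), (z, SVg)]"
      show "ap ?l (pair (pair y w) z)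
          = ap ?r (pair (pair y w) z)"
        using arg_cong [OF 1, of "\<lambda>h. ap h (pair (pair (ap (DD i k g V) y) w) z)"] a g
        by (simp add: ap_CR_DD KD_adjoint_MU)
    qed (use g in simp_all)
  qed (use g in simp_all)
qed

text \<open>Here the second argument is contracted first, so commutativity of the product
  enters.\<close>

lemma CL_DD: "CL (ES i V) SVi' SVi SVg' \<bullet> (ID SVi' \<boxtimes> DD k i g V) = MU i k V\<^sup>\<or>"
proof -
  obtain c where c: "dualpair SVg' SVg (ES g V) c" using dualpair_Sym by blast
  have 1: "ES g V \<bullet> (CL (ES i V) SVi' SVi SVg' \<boxtimes> ID SVg)
      = ES i V \<bullet> (ID SVi' \<boxtimes> CR (ES g V) SVi SVg' SVg) \<bullet> ASS SVi' (SVi \<otimes>\<^sub>o SVg') SVg"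
    by (rule arrow_eqI4l) (simp_all add: smul_ac)
  show ?thesis
  proof (rule pairing_cancel_left [OF c])
    show "ES g V \<bullet> ((CL (ES i V) SVi' SVi SVg' \<bullet> (ID SVi' \<boxtimes> DD k i g V)) \<boxtimes> ID SVg)
        = ES g V \<bullet> (MU i k V\<^sup>\<or> \<boxtimes> ID SVg)" (is "?l = ?r")
    proof (rule arrow_eqI3l [where X = SVi' and Y = SVk' and Z = SVg])
      fix L y w z assume a: "wires L [(y, SVi'), (w, SVk'), (z, SVg)]"
      show "ap ?l (pair (pair y w) z)
          = ap ?r (pair (pair y w) z)"
        using arg_cong [OF 1, of "\<lambda>h. ap h (pair (pair y (ap (DD k i g V) w)) z)"] a
          MU_commute [of y w i "V\<^sup>\<or>" k]
        by (simp add: g gg ap_CR_DD KD_adjoint_MU)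
    qed (simp_all add: g gg)
  qed (simp_all add: g gg)
qed

lemma ap_ES_RF:
  assumes "el z" "el d" "obj z = SVg" "obj d = SVg'" "dj z d" "dj d z"
  shows "ap (ES g V\<^sup>\<or>) (pair (ap (RF g V) z) d) = ap (ES g V) (pair d z)"
  using arg_cong [OF RF(4) [of g V], of "\<lambda>h. ap h (pair z d)"] assms by (simp add: RF(1-3))

text \<open>The values lie in the power of the double dual and are compared by pairing with
  \<open>SVg'\<close>; reflexivity translates this pairing into that of \<open>SVg\<close>.\<close>

lemma C13_DU: "C13 (ES k V) SVk' SVg'' SVk \<bullet> (DU i k g V \<boxtimes> ID SVk) = RF g V \<bullet> MU i k V"
proof -
  obtain c where c: "dualpair SVg'' SVg' (ES g V\<^sup>\<or>) c" using dualpair_Sym by blast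
  have 1: "ES g V\<^sup>\<or> \<bullet> (C13 (ES k V) SVk' SVg'' SVk \<boxtimes> ID SVg')
      = ES k V \<bullet> (CR (ES g V\<^sup>\<or>) SVk' SVg'' SVg' \<boxtimes> ID SVk) \<bullet>
      ASSI (SVk' \<otimes>\<^sub>o SVg'') SVg' SVk \<bullet> (ID (SVk' \<otimes>\<^sub>o SVg'') \<boxtimes> SW SVk SVg') \<bullet> ASS (SVk' \<otimes>\<^sub>o SVg'')
          SVk SVg'"
    by (rule arrow_eqI4ll) (simp_all add: smul_ac)
  show ?thesis
  proof (rule pairing_cancel_left [OF c])
    show "ES g V\<^sup>\<or> \<bullet> ((C13 (ES k V) SVk' SVg'' SVk \<bullet> (DU i k g V \<boxtimes> ID SVk)) \<boxtimes> ID SVg')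
        = ES g V\<^sup>\<or> \<bullet> ((RF g V \<bullet> MU i k V) \<boxtimes> ID SVg')" (is "?l = ?r")
    proof (rule arrow_eqI3l [where X = SVi and Y = SVk and Z = SVg'])
      fix L x b d assume a: "wires L [(x, SVi), (b, SVk), (d, SVg')]"
      show "ap ?l (pair (pair x b) d)
          = ap ?r (pair (pair x b) d)"
        using arg_cong [OF 1, of "\<lambda>h. ap h (pair (pair (ap (DU i k g V) x) b) d)"] a g
        by (simp add: ap_CR_DU KU_adjoint_MU ap_ES_RF RF)
    qed (use g in \<open>simp_all add: RF\<close>)
  qed (use g in \<open>simp_all add: RF\<close>)
qed

lemma CL_DU: "CL (EST i V) SVi SVi' SVg'' \<bullet> (ID SVi \<boxtimes> DU k i g V) = RF g V \<bullet> MU i k V"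
proof -
  obtain c where c: "dualpair SVg'' SVg' (ES g V\<^sup>\<or>) c" using dualpair_Sym by blast
  have 1: "ES g V\<^sup>\<or> \<bullet> (CL (EST i V) SVi SVi' SVg'' \<boxtimes> ID SVg') = ES i V \<bullet> SW SVi SVi' \<bullet>
      (ID SVi \<boxtimes> CR (ES g V\<^sup>\<or>) SVi' SVg'' SVg') \<bullet> ASS SVi (SVi' \<otimes>\<^sub>o SVg'') SVg'"
    by (rule arrow_eqI4l) (simp_all add: smul_ac)
  show ?thesis
  proof (rule pairing_cancel_left [OF c])
    show "ES g V\<^sup>\<or> \<bullet> ((CL (EST i V) SVi SVi' SVg'' \<bullet> (ID SVi \<boxtimes> DU k i g V)) \<boxtimes> ID SVg')
        = ES g V\<^sup>\<or> \<bullet> ((RF g V \<bullet> MU i k V) \<boxtimes> ID SVg')" (is "?l = ?r")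
    proof (rule arrow_eqI3l [where X = SVi and Y = SVk and Z = SVg'])
      fix L x b d assume a: "wires L [(x, SVi), (b, SVk), (d, SVg')]"
      show "ap ?l (pair (pair x b) d)
          = ap ?r (pair (pair x b) d)"
        using arg_cong [OF 1, of "\<lambda>h. ap h (pair (pair x (ap (DU k i g V) b)) d)"] a
          MU_commute [of x b i V k]
        by (simp add: g gg ap_CR_DU KU_adjoint_MU ap_ES_RF RF)
    qed (simp_all add: g gg RF)
  qed (simp_all add: g gg RF)
qed

text \<open>By nondegeneracy it is enough to pair with \<open>SVi'\<close>. Then
  \<open>CL_DD\<close> produces a product, and the composite becomes the trace
  \<open>TRB\<close>.\<close>

lemma CR_DD_DU: "CR (EST g V\<^sup>\<or>) SVi SVg' SVg'' \<bullet> (DD k i g V \<boxtimes> ID SVg'') \<bullet> DU i k g V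
    = SC (ratios V k i) (ID SVi)"
proof -
  obtain c where c: "dualpair SVi' SVi (ES i V) c" using dualpair_Sym by blast
  have 1: "ES i V \<bullet> (ID SVi' \<boxtimes> CR (EST g V\<^sup>\<or>) SVi SVg' SVg'') \<bullet> ASS SVi' (SVi \<otimes>\<^sub>o SVg') SVg''
      = EST g V\<^sup>\<or> \<bullet> (CL (ES i V) SVi' SVi SVg' \<boxtimes> ID SVg'')"
    by (rule arrow_eqI4l) (simp_all add: smul_ac)
  have 2: "ES i V \<bullet> (ID SVi' \<boxtimes> (CR (EST g V\<^sup>\<or>) SVi SVg' SVg'' \<bullet> (DD k i g V \<boxtimes> ID SVg'')))
      = TRB i k g V"
  proof (rule arrow_eqI3r [where X = SVi' and Y = SVk' and Z = SVg''])
    fix L y w d assume a: "wires L [(y, SVi'), (w, SVk'), (d, SVg'')]"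
    have "ap (CL (ES i V) SVi' SVi SVg') (pair y (ap (DD k i g V) w)) = ap (MU i k V\<^sup>\<or>) (pair y w)"
      using arg_cong [OF CL_DD, of "\<lambda>h. ap h (pair y w)"] a gg by simp
    then show "ap (ES i V \<bullet> (ID SVi' \<boxtimes> (CR (EST g V\<^sup>\<or>) SVi SVg' SVg'' \<bullet> (DD k i g V \<boxtimes> ID SVg''))))
        (pair y (pair w d)) = ap (TRB i k g V) (pair y (pair w d))"
      using arg_cong [OF 1, of "\<lambda>h. ap h (pair (pair y (ap (DD k i g V) w)) d)"] a
          by (simp add: g gg)
  qed (simp_all add: g gg)
  show ?thesis
  proof (rule pairing_cancel_right [OF c])
    show "ES i V \<bullet> (ID SVi' \<boxtimes> (CR (EST g V\<^sup>\<or>) SVi SVg' SVg'' \<bullet> (DD k i g V \<boxtimes> ID SVg'') \<bullet>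
        DU i k g V)) = ES i V \<bullet> (ID SVi' \<boxtimes> SC (ratios V k i) (ID SVi))" (is "?l = ?r")
    proof (rule arrow_eqI2 [where X = SVi' and Y = SVi])
      fix L y x assume a: "wires L [(y, SVi'), (x, SVi)]"
      have "ap (ES i V \<bullet> (ID SVi' \<boxtimes> (CR (EST g V\<^sup>\<or>) SVi SVg' SVg'' \<bullet> (DD k i g V \<boxtimes> ID SVg''))))
          (pair y (ap (DU i k g V) x)) = smul (ap (ratios V k i) (star L)) (ap (ES i V) (pair y x))"
        unfolding 2 by (rule TRB_DU_eq [OF g]) (use a in simp_all)
      then show "ap ?l (pair y x) = ap ?r (pair y x)"
        using a scalar_simps [OF scalar_ratios [of V k i]] by (simp add: g gg)
    qed (simp_all add: g gg)
  qed (simp_all add: g gg)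
qed

text \<open>Paired with \<open>SVk\<close>, the composite is \<open>TRA\<close> with the degrees
  exchanged: now \<open>i\<close> strands are closed and \<open>k\<close> stay open, whence
  \<open>ratios V i k\<close>.\<close>

lemma CR_DU_DD: "CR (ES g V\<^sup>\<or>) SVk' SVg'' SVg' \<bullet> (DU i k g V \<boxtimes> ID SVg') \<bullet> DD k i g V
    = SC (ratios V i k) (ID SVk')"
proof -
  obtain c where c: "dualpair SVk' SVk (ES k V) c" using dualpair_Sym by blast
  have 1: "ES k V \<bullet> (KU i k g V \<boxtimes> ID SVk) = TRA k i g V \<bullet> SW (SVi \<otimes>\<^sub>o SVg') SVk"
  proof (rule arrow_eqI3l [where X = SVi and Y = SVg' and Z = SVk])
    fix L x d b assume a: "wires L [(x, SVi), (d, SVg'), (b, SVk)]"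
    show "ap (ES k V \<bullet> (KU i k g V \<boxtimes> ID SVk)) (pair (pair x d) b)
        = ap (TRA k i g V \<bullet> SW (SVi \<otimes>\<^sub>o SVg') SVk) (pair (pair x d) b)"
      using a MU_commute [of x b i V k] by (simp add: g gg KU_adjoint_MU)
  qed (simp_all add: g gg)
  have 2: "CR (ES g V\<^sup>\<or>) SVk' SVg'' SVg' \<bullet> (DU i k g V \<boxtimes> ID SVg') \<bullet> DD k i g V
      = KU i k g V \<bullet> DD k i g V"
    using cmp_extend [OF CR_DU [OF g], of V "DD k i g V"] by (simp add: g gg)
  show ?thesis unfolding 2
  proof (rule pairing_cancel_left [OF c])
    show "ES k V \<bullet> ((KU i k g V \<bullet> DD k i g V) \<boxtimes> ID SVk)
        = ES k V \<bullet> (SC (ratios V i k) (ID SVk') \<boxtimes> ID SVk)" (is "?l = ?r")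
    proof (rule arrow_eqI2 [where X = SVk' and Y = SVk])
      fix L w b assume a: "wires L [(w, SVk'), (b, SVk)]"
      have "ap (ES k V) (pair (ap (KU i k g V) (ap (DD k i g V) w)) b)
          = ap (TRA k i g V) (pair b (ap (DD k i g V) w))"
        using arg_cong [OF 1, of "\<lambda>h. ap h (pair (ap (DD k i g V) w) b)"] a by (simp add: g gg)
      also have "\<dots> = smul (ap (ratios V i k) (star L)) (ap (ES k V) (pair w b))"
        by (rule TRA_DD_eq [OF gg]) (use a in simp_all)
      finally show "ap ?l (pair w b) = ap ?r (pair w b)"
        using a scalar_simps [OF scalar_ratios [of V i k]] by (simp add: g gg)
    qed (simp_all add: g gg)
  qed (simp_all add: g gg)
qed

end

section \<open>Products of Poincare morphisms\<close>

definition "PHI a b W = Arrow ((Sym C a W \<otimes>\<^sub>o Sym C (a + b) W\<^sup>\<or>) \<otimes>\<^sub>o (Sym C b W \<otimes>\<^sub>o Sym C (a + b)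
    W\<^sup>\<or>)) (phi13 C a b W) (Sym C (a + b) W\<^sup>\<or>)"

lemma PHI_eq: "PHI a b W = CL (EST (a + b) W) (Sym C (a + b) W) (Sym C (a + b) W\<^sup>\<or>) (Sym C (a + b)
    W\<^sup>\<or>) \<bullet>
    (MU a b W \<boxtimes> ID (Sym C (a + b) W\<^sup>\<or> \<otimes>\<^sub>o Sym C (a + b) W\<^sup>\<or>)) \<bullet>
    XCH (Sym C a W) (Sym C (a + b) W\<^sup>\<or>) (Sym C b W) (Sym C (a + b) W\<^sup>\<or>)"
  by (simp add: PHI_def phi13_def CL_def EST_def MU_def ID_def XCH_def tens_def cmp_def)

text \<open>Up to commutativity of the product, the expression in parentheses is \<open>TRA\<close>
  for \<open>W = V\<close> and \<open>TRB\<close> for \<open>W = V\<^sup>\<or>\<close>; the last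
  factor is carried along.\<close>

lemma PHI_trace:
  assumes g: "i + k = g"
  shows "PHI k i W = LU (Sym C g W\<^sup>\<or>) \<bullet>
    ((EST g W \<bullet> (MU i k W \<boxtimes> ID (Sym C g W\<^sup>\<or>)) \<bullet> ASSI (Sym C i W) (Sym C k W) (Sym C g W\<^sup>\<or>)) \<boxtimes> ID
        (Sym C g W\<^sup>\<or>)) \<bullet>
    (SW (Sym C k W \<otimes>\<^sub>o Sym C g W\<^sup>\<or>) (Sym C i W) \<boxtimes> ID (Sym C g W\<^sup>\<or>)) \<bullet> ASSI (Sym C k W \<otimes>\<^sub>o Sym C g
        W\<^sup>\<or>) (Sym C i W) (Sym C g W\<^sup>\<or>)"
    (is "_ = ?R")
proof (rule arrow_eqI4 [where X = "Sym C k W" and Y = "Sym C g W\<^sup>\<or>" and Z = "Sym C i W"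
    and W = "Sym C g W\<^sup>\<or>"])
  have g': "k + i = g" using g by simp
  fix L x y z w
  assume a: "wires L [(x, Sym C k W), (y, Sym C g W\<^sup>\<or>), (z, Sym C i W), (w, Sym C g W\<^sup>\<or>)]"
  show "ap (PHI k i W) (pair (pair x y) (pair z w)) = ap ?R (pair (pair x y) (pair z w))"
    using a MU_commute [of x z k W i] by (simp add: g g' PHI_eq)
qed (use g in \<open>simp_all add: PHI_eq add.commute [of k i]\<close>)

text \<open>The first Poincare morphism enters only through the trace \<open>TRB\<close>. This pairs
  the first argument with the first component of the second morphism and yields the coefficient; the
  rest is \<open>CL_DU\<close>.\<close>

lemma PHI_DU_DU:
  assumes g: "i + k = g"
  shows "PHI k i V\<^sup>\<or> \<bullet> (DU i k g V \<boxtimes> DU k i g V) = SC (ratios V k i) (RF g V \<bullet> MU i k V)"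
proof -
  have g': "k + i = g" using g by simp
  show ?thesis
  proof (rule arrow_eqI2 [where X = "Sym C i V" and Y = "Sym C k V"])
    fix L x b assume a: "wires L [(x, Sym C i V), (b, Sym C k V)]"
    have 1: "PHI k i V\<^sup>\<or> \<bullet> (DU i k g V \<boxtimes> ID (Sym C i V\<^sup>\<or> \<otimes>\<^sub>o Sym C g V\<^sup>\<or>\<^sup>\<or>))
        = SC (ratios V k i) (CL (EST i V) (Sym C i V) (Sym C i V\<^sup>\<or>) (Sym C g V\<^sup>\<or>\<^sup>\<or>))"
    proof (rule arrow_eqI3r [where X = "Sym C i V" and Y = "Sym C i V\<^sup>\<or>" and Z = "Sym C g V\<^sup>\<or>\<^sup>\<or>"])
      fix L x y d assume a: "wires L [(x, Sym C i V), (y, Sym C i V\<^sup>\<or>), (d, Sym C g V\<^sup>\<or>\<^sup>\<or>)]"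
      have "ap (TRB i k g V) (pair y (ap (DU i k g V) x))
          = smul (ap (ratios V k i) (star L)) (ap (ES i V) (pair y x))"
        by (rule TRB_DU_eq [OF g]) (use a in simp_all)
      then show "ap (PHI k i V\<^sup>\<or> \<bullet> (DU i k g V \<boxtimes> ID (Sym C i V\<^sup>\<or> \<otimes>\<^sub>o Sym C g V\<^sup>\<or>\<^sup>\<or>))) (pair x
          (pair y d))
        = ap (SC (ratios V k i) (CL (EST i V) (Sym C i V) (Sym C i V\<^sup>\<or>) (Sym C g V\<^sup>\<or>\<^sup>\<or>))) (pair x
            (pair y d))"
        using a scalar_simps [OF scalar_ratios [of V k i]] by (simp add: g g' PHI_trace [OF g])
    qed (simp_all add: g g' PHI_trace [OF g])
    show "ap (PHI k i V\<^sup>\<or> \<bullet> (DU i k g V \<boxtimes> DU k i g V)) (pair x b) = ap (SC (ratios V k i) (RF g V \<bullet>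
        MU i k V)) (pair x b)"
      using arg_cong [OF 1, of "\<lambda>h. ap h (pair x (ap (DU k i g V) b))"]
        arg_cong [OF CL_DU [OF g, of V], of "\<lambda>h. ap h (pair x b)"] a
      by (simp add: g g' RF PHI_trace [OF g] del: ap_CL)
  qed (simp_all add: g g' PHI_trace [OF g] RF)
qed

text \<open>As before, with \<open>TRA\<close> in place of \<open>TRB\<close>. The product remains
  by itself because \<open>CL_DD\<close> involves no reflexivity.\<close>

lemma PHI_DD_DD:
  assumes g: "i + k = g"
  shows "PHI k i V \<bullet> (DD i k g V \<boxtimes> DD k i g V) = SC (ratios V k i) (MU i k V\<^sup>\<or>)"
proof -
  have g': "k + i = g" using g by simp
  show ?thesis
  proof (rule arrow_eqI2 [where X = "Sym C i V\<^sup>\<or>" and Y = "Sym C k V\<^sup>\<or>"])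
    fix L y w assume a: "wires L [(y, Sym C i V\<^sup>\<or>), (w, Sym C k V\<^sup>\<or>)]"
    have 1: "PHI k i V \<bullet> (DD i k g V \<boxtimes> ID (Sym C i V \<otimes>\<^sub>o Sym C g V\<^sup>\<or>))
        = SC (ratios V k i) (CL (ES i V) (Sym C i V\<^sup>\<or>) (Sym C i V) (Sym C g V\<^sup>\<or>))"
    proof (rule arrow_eqI3r [where X = "Sym C i V\<^sup>\<or>" and Y = "Sym C i V" and Z = "Sym C g V\<^sup>\<or>"])
      fix L y x d assume a: "wires L [(y, Sym C i V\<^sup>\<or>), (x, Sym C i V), (d, Sym C g V\<^sup>\<or>)]"
      have "ap (TRA i k g V) (pair x (ap (DD i k g V) y))
          = smul (ap (ratios V k i) (star L)) (ap (ES i V) (pair y x))"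
        by (rule TRA_DD_eq [OF g]) (use a in simp_all)
      then show "ap (PHI k i V \<bullet> (DD i k g V \<boxtimes> ID (Sym C i V \<otimes>\<^sub>o Sym C g V\<^sup>\<or>))) (pair y (pair x d))
        = ap (SC (ratios V k i) (CL (ES i V) (Sym C i V\<^sup>\<or>) (Sym C i V) (Sym C g V\<^sup>\<or>))) (pair y (pair
            x d))"
        using a scalar_simps [OF scalar_ratios [of V k i]] by (simp add: g g' PHI_trace [OF g])
    qed (simp_all add: g g' PHI_trace [OF g])
    show "ap (PHI k i V \<bullet> (DD i k g V \<boxtimes> DD k i g V)) (pair y w)
        = ap (SC (ratios V k i) (MU i k V\<^sup>\<or>)) (pair y w)"
      using arg_cong [OF 1, of "\<lambda>h. ap h (pair y (ap (DD k i g V) w))"]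
        arg_cong [OF CL_DD [OF g, of V], of "\<lambda>h. ap h (pair y w)"] a
      by (simp add: g g' PHI_trace [OF g] del: ap_CL)
  qed (simp_all add: g g' PHI_trace [OF g])
qed

end

theorem theorem6p2:
  fixes C :: "('o, 'm, 'z) sym_tensor_category_scheme" (structure)
    and V :: 'o
    and g i :: nat
  assumes "pseudo_abelian_rigid_tensor_category_with_Sym C" and "i \<le> g"
  shows "(contr13_24 C (ev_Sym C (g - i) V) (ev_Sym C g V\<^sup>\<or>)
         (Sym C (g - i) V\<^sup>\<or>) (Sym C g V\<^sup>\<or>\<^sup>\<or>) (Sym C (g - i) V) (Sym C g V\<^sup>\<or>)
       \<cdot> (D_up C i g V \<otimes>\<^sub>m D_down C i g V)
     = act C (Sym C i V \<otimes>\<^sub>o Sym C i V\<^sup>\<or>) \<I> (coeff C V g (g - i)) (ev_Sym_tau C i V)) \<and>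
     (contr13 C (ev_Sym_tau C (g - i) V) (Sym C (g - i) V) (Sym C g V\<^sup>\<or>) (Sym C (g - i) V\<^sup>\<or>)
       \<cdot> (D_down C i g V \<otimes>\<^sub>m \<^bold>1 (Sym C (g - i) V\<^sup>\<or>))
     = contr_left C (ev_Sym C i V) (Sym C i V\<^sup>\<or>) (Sym C i V) (Sym C g V\<^sup>\<or>)
       \<cdot> (\<^bold>1 (Sym C i V\<^sup>\<or>) \<otimes>\<^sub>m D_down C (g - i) g V)) \<and>
     (contr13 C (ev_Sym C (g - i) V) (Sym C (g - i) V\<^sup>\<or>) (Sym C g V\<^sup>\<or>\<^sup>\<or>) (Sym C (g - i) V)
       \<cdot> (D_up C i g V \<otimes>\<^sub>m \<^bold>1 (Sym C (g - i) V))
     = contr_left C (ev_Sym_tau C i V) (Sym C i V) (Sym C i V\<^sup>\<or>) (Sym C g V\<^sup>\<or>\<^sup>\<or>)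
       \<cdot> (\<^bold>1 (Sym C i V) \<otimes>\<^sub>m D_up C (g - i) g V)) \<and>
     (contr_right C (ev_Sym_tau C g V\<^sup>\<or>) (Sym C i V) (Sym C g V\<^sup>\<or>) (Sym C g V\<^sup>\<or>\<^sup>\<or>)
       \<cdot> (D_down C (g - i) g V \<otimes>\<^sub>m \<^bold>1 (Sym C g V\<^sup>\<or>\<^sup>\<or>))
       \<cdot> D_up C i g V
     = act C (Sym C i V) (Sym C i V) (coeff C V g (g - i)) (\<^bold>1 (Sym C i V))) \<and>
     (contr_right C (ev_Sym C g V\<^sup>\<or>) (Sym C (g - i) V\<^sup>\<or>) (Sym C g V\<^sup>\<or>\<^sup>\<or>) (Sym C g V\<^sup>\<or>)
       \<cdot> (D_up C i g V \<otimes>\<^sub>m \<^bold>1 (Sym C g V\<^sup>\<or>))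
       \<cdot> D_down C (g - i) g V
     = act C (Sym C (g - i) V\<^sup>\<or>) (Sym C (g - i) V\<^sup>\<or>) (coeff C V g i) (\<^bold>1 (Sym C (g - i) V\<^sup>\<or>))) \<and>
     (phi13 C (g - i) i V\<^sup>\<or> \<cdot> (D_up C i g V \<otimes>\<^sub>m D_up C (g - i) g V)
     = act C (Sym C i V \<otimes>\<^sub>o Sym C (g - i) V) (Sym C g V\<^sup>\<or>\<^sup>\<or>) (coeff C V g (g - i))
         (Sym_refl C g V \<cdot> Sym_mult C i (g - i) V)) \<and>
     (phi13 C (g - i) i V \<cdot> (D_down C i g V \<otimes>\<^sub>m D_down C (g - i) g V)
     = act C (Sym C i V\<^sup>\<or> \<otimes>\<^sub>o Sym C (g - i) V\<^sup>\<or>) (Sym C g V\<^sup>\<or>) (coeff C V g (g - i))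
         (Sym_mult C i (g - i) V\<^sup>\<or>))"
proof -
  interpret pseudo_abelian_rigid_tensor_category_with_Sym C by (rule assms(1))
  \<comment> \<open>From here on the difference of degrees is a variable, and everything is
    symmetric in \<open>i\<close> and \<open>k\<close>.\<close>
  define k where "k = g - i"
  have g: "i + k = g" "k + i = g" "g - i = k" "g - k = i" using assms(2) by (simp_all add: k_def)
  have c: "coeff C V g k = mor (ratios V k i)" "coeff C V g i = mor (ratios V i k)"
    using mor_ratios_coeff [of V k i] mor_ratios_coeff [of V i k] g by simp_all
  show ?thesis unfolding g(3) c
    using arg_cong [OF C1324_DU_DD [OF g(1), of V], of mor] arg_cong [OF C13_DD [OF g(1), of V,
        folded CL_DD [OF g(1), of V]], of mor]
      arg_cong [OF C13_DU [OF g(1), of V, folded CL_DU [OF g(1), of V]], of mor]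
      arg_cong [OF CR_DD_DU [OF g(1), of V], of mor] arg_cong [OF CR_DU_DD [OF g(1), of V], of mor]
      arg_cong [OF PHI_DU_DU [OF g(1), of V], of mor] arg_cong [OF PHI_DD_DD [OF g(1), of V], of
          mor]
    by (simp add: mor_SC g ES_def EST_def DU_def DD_def C1324_def C13_def CL_def CR_def PHI_def
        RF_def MU_def
        ID_def tens_def cmp_def)
qed

end
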